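(* For each integer $n\ge 4$ there are words $A_n,B_n,C_n$ in the letters $1,2,3$ and some $\epsilon_n>0$ such that \begin{itemize} \item $N_{--}(n,\epsilon_n)\subset O(A_n)$; \item $N_{-+}(n,\epsilon_n)\subset O(B_n)$; \item $N_{+-}(n,\epsilon_n)\subset O(C_n)$; \item $N(n,\epsilon_n)-\overline{N_{++}(n,\epsilon_n)}\subset O(A_n)\cup O(B_n)\cup O(C_n)$. \end{itemize}
   Context: The parameter space of obtuse triangles is $\Delta=\{(x_1,x_2)\in\mathbb{R}^2: x_1>0,\ x_2>0,\ x_1+x_2<\pi/2\}$; the point $(x_1,x_2)$ represents the obtuse triangle (up to similarity) whose two small angles are $x_1$ and $x_2$ radians. Its sides are labelled $1,2,3$, where side $j$ is opposite the angle $x_j$ for $j=1,2$, and side $3$ is the longest side. A periodic billiard path in a triangle (unit speed motion, equal-angle reflections off the interiors of the sides, never hitting a vertex, closing up) has as its combinatorial type the periodic sequence of labels of the successive sides it hits. A finite word $W$ in $\{1,2,3\}$ is identified with the infinite periodic word obtained by repeating $W$. The orbit tile $O(W)\subset\Delta$ is the set of points whose corresponding triangle has a periodic billiard path of combinatorial type $W$. $V_n=(\pi/2n,\pi/2n)$. $B(\epsilon)$ is the ball of radius $\epsilon$ about the origin in $\mathbb{R}^2$, and for signs $\pm,\pm$, $B_{\pm,\pm}(\epsilon)$ is the intersection of $B(\epsilon)$ with the open quadrant of points whose first and second coordinates have the indicated signs. $N_{\pm,\pm}(n,\epsilon)=V_n+B_{\pm,\pm}(\epsilon)$ and $N(n,\epsilon)=V_n+B(\epsilon)$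 is the $\epsilon$-neighborhood of $V_n$. An overline denotes closure. *)

theory Defs
  imports "HOL-Analysis.Analysis"
begin

section \<open>Triangles\<close>

text \<open>
  The Euclidean plane in which the billiard takes place is \<^typ>\<open>complex\<close>. A triangle is given
  by its vertices \<open>P 1, P 2, P 3\<close>; side \<open>j\<close> is opposite the vertex \<open>P j\<close>, so that its endpoints
  are the two vertices following \<open>P j\<close> in the cyclic order 1, 2, 3.
\<close>

definition nxt :: "nat \<Rightarrow> nat" where
  "nxt j = j mod 3 + 1"

definition angle_at :: "(nat \<Rightarrow> complex) \<Rightarrow> nat \<Rightarrow> real" where
  "angle_at P j =
     (let a = P (nxt j) - P j; b = P (nxt (nxt j)) - P j
      in arccos ((a \<bullet> b) / (norm a * norm b)))"

definition open_side :: "(nat \<Rightarrow> complex) \<Rightarrow> nat \<Rightarrow> complex set" where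
  "open_side P j = open_segment (P (nxt j)) (P (nxt (nxt j)))"

definition side_dir :: "(nat \<Rightarrow> complex) \<Rightarrow> nat \<Rightarrow> complex" where
  "side_dir P j = P (nxt (nxt j)) - P (nxt j)"

definition Delta :: "(real \<times> real) set" where
  "Delta = {(x1, x2). x1 > 0 \<and> x2 > 0 \<and> x1 + x2 < pi / 2}"

text \<open>\<open>P\<close> is a triangle in the similarity class represented by a point of the parameter space.\<close>

definition represents :: "real \<times> real \<Rightarrow> (nat \<Rightarrow> complex) \<Rightarrow> bool" where
  "represents x P \<longleftrightarrow>
     \<not> collinear {P 1, P 2, P 3} \<and> angle_at P 1 = fst x \<and> angle_at P 2 = snd x"

section \<open>Periodic billiard paths and orbit tiles\<close>

text \<open>
  The reflection that fixes the direction \<open>d \<noteq> 0\<close> and negates the direction orthogonal to \<open>d\<close>.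
\<close>

definition reflect :: "complex \<Rightarrow> complex \<Rightarrow> complex" where
  "reflect d v = (2 * (v \<bullet> d) / (d \<bullet> d)) *\<^sub>R d - v"

text \<open>
  \<open>\<gamma>\<close> is the position as a function of time. The times \<open>\<tau> i\<close> enumerate in increasing order all
  the hits of the path, \<open>w i\<close> is the side hit at time \<open>\<tau> i\<close>, and \<open>u i\<close> is the velocity between
  the hits number \<open>i\<close> and \<open>i + 1\<close>. The second conjunct says that the hits do not accumulate, so
  that the motion is described for all times. As the hits are on open sides, no vertex is hit.
\<close>

definition billiard_path ::
    "(nat \<Rightarrow> complex) \<Rightarrow> (int \<Rightarrow> nat) \<Rightarrow> (real \<Rightarrow> complex) \<Rightarrow> bool" where
  "billiard_path P w \<gamma> \<longleftrightarrow>
     (\<exists>(\<tau> :: int \<Rightarrow> real) (u :: int \<Rightarrow> complex).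
        strict_mono \<tau> \<and>
        (\<forall>t. \<exists>i. \<tau> i \<le> t \<and> t < \<tau> (i + 1)) \<and>
        (\<forall>i. w i \<in> {1, 2, 3} \<and>
             \<gamma> (\<tau> i) \<in> open_side P (w i) \<and>
             norm (u i) = 1 \<and>
             u i = reflect (side_dir P (w i)) (u (i - 1)) \<and>
             (\<forall>t\<in>{\<tau> i..\<tau> (i + 1)}. \<gamma> t = \<gamma> (\<tau> i) + (t - \<tau> i) *\<^sub>R u i) \<and>
             (\<forall>t\<in>{\<tau> i<..<\<tau> (i + 1)}. \<gamma> t \<in> interior (convex hull {P 1, P 2, P 3}))))"

definition periodic_billiard_path ::
    "(nat \<Rightarrow> complex) \<Rightarrow> (int \<Rightarrow> nat) \<Rightarrow> (real \<Rightarrow> complex) \<Rightarrow> bool" where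
  "periodic_billiard_path P w \<gamma> \<longleftrightarrow>
     billiard_path P w \<gamma> \<and> (\<exists>T>0. \<forall>t. \<gamma> (t + T) = \<gamma> t)"

definition is_word :: "nat list \<Rightarrow> bool" where
  "is_word W \<longleftrightarrow> W \<noteq> [] \<and> set W \<subseteq> {1, 2, 3}"

definition periodic_word :: "nat list \<Rightarrow> int \<Rightarrow> nat" where
  "periodic_word W i = W ! nat (i mod int (length W))"

text \<open>
  As a word is identified with its infinite repetition, the path need not close up after exactly
  \<^term>\<open>length W\<close> hits.
\<close>

definition orbit_tile :: "nat list \<Rightarrow> (real \<times> real) set" where
  "orbit_tile W =
     {x \<in> Delta. \<exists>P \<gamma>. represents x P \<and> periodic_billiard_path P (periodic_word W) \<gamma>}"

section \<open>Neighbourhoods of the points \<open>V\<^sub>n\<close>\<close>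

definition V :: "nat \<Rightarrow> real \<times> real" where
  "V n = (pi / (2 * real n), pi / (2 * real n))"

text \<open>The signs \<open>s1\<close> and \<open>s2\<close> are \<open>1\<close> or \<open>-1\<close>.\<close>

definition B_quadrant :: "real \<Rightarrow> real \<Rightarrow> real \<Rightarrow> (real \<times> real) set" where
  "B_quadrant s1 s2 \<epsilon> = {p \<in> ball 0 \<epsilon>. sgn (fst p) = s1 \<and> sgn (snd p) = s2}"

definition N_quadrant :: "real \<Rightarrow> real \<Rightarrow> nat \<Rightarrow> real \<Rightarrow> (real \<times> real) set" where
  "N_quadrant s1 s2 n \<epsilon> = (\<lambda>p. V n + p) ` B_quadrant s1 s2 \<epsilon>"

definition N_ball :: "nat \<Rightarrow> real \<Rightarrow> (real \<times> real) set" where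
  "N_ball n \<epsilon> = (\<lambda>p. V n + p) ` ball 0 \<epsilon>"

end

theory Submission
  imports Defs
begin

text \<open>
  At \<open>V n\<close> both small angles are \<open>pi / (2 * n)\<close>, so that \<open>N = 2 * n\<close> triangles around an acute vertex
  fill exactly a straight angle. The proof exhibits words whose unfoldings are built from fans of
  almost \<open>N\<close> triangles around acute vertices, and follows them as the two angles vary near \<open>V n\<close>.

  Unfolding straightens a billiard path into a line that crosses a sequence of edges. If the sequence
  closes up to a translation along the line, a periodic path with this combinatorial type exists as
  soon as the endpoints of the crossed edges lie strictly above and below the line as prescribed
  (\<open>cyclic_crossings_orbit_tile\<close>). Only the heights of vertices over the line matter.

  The centres of the fans form a polygonal path, the skeleton, all of whose edges are copies of the
  longest side. If the skeleton edges before and after a vertex with angle \<open>\<alpha>\<close> are \<open>N - k\<close> triangles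
  apart, the skeleton turns there by \<open>e + k * \<alpha>\<close> up to sign, where the defect \<open>e = pi - N * \<alpha>\<close> vanishes
  at \<open>V n\<close> (\<open>skeleton_orbit_tile\<close>). In all words below the second half of the skeleton is the
  image of the first half, run backwards, under the rotation about its end that is made by \<open>N\<close>
  triangles. The direction of the path is then the bisector of the directions of the two halves, and
  the second half is controlled by conditions on the first (\<open>doubled_word_tile\<close>).

  At \<open>V n\<close> the strip of parallel paths has width zero: some vertices that should be above the line and
  some that should be below lie on it. The other vertices are on the correct side at \<open>V n\<close>, hence also
  nearby. For those on the line, let \<open>p\<close> and \<open>q\<close> be the defects of the two small angles.

  \<^item> The word A has a skeleton with four edges, which is a straight segment at \<open>V n\<close> and opens to a
    zigzag on the correct sides of the line if \<open>p > 0\<close> and \<open>q > 0\<close>, that is, if both angles are smaller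
    than \<open>pi / (2 * n)\<close> (\<open>word_A_germ\<close>).

  \<^item> The word B has a skeleton with twenty edges. At the two ends of the half skeleton the strip
    opens if and only if \<open>p > 0\<close>. At the other points on the line, the first derivatives of the heights in the
    directions of \<open>p\<close> and of \<open>- q\<close> have the correct signs, so the strip opens for \<open>p > 0\<close> and \<open>q \<le> 0\<close>
    (\<open>gradient_bounds\<close>, \<open>word_B_germ\<close>).

  \<^item> The word C is B with the labels 1 and 2 exchanged.

  As \<open>q = 0\<close> is included, the tiles of B and C contain the two half-axes next to the quadrant of A, and
  what remains of a small disc about \<open>V n\<close> is the closed quadrant in which both angles are at least
  \<open>pi / (2 * n)\<close>.
\<close>

section \<open>Closed polygons that obey the law of reflection\<close>

lemma nxt_eqs [simp]:
  "nxt (Suc 0) = 2" "nxt 2 = 3" "nxt 3 = Suc 0"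
  by (simp_all add: nxt_def)

text \<open>
  Only the coordinate of the opposite vertex vanishes; averaging two such points on different
  sides makes all three coordinates positive.
\<close>

lemma open_side_barycentric:
  assumes "i \<in> {1, 2, 3}" "A \<in> open_side P i"
  obtains b :: "nat \<Rightarrow> real" where "b i = 0" "\<And>k. k \<in> {1, 2, 3} \<Longrightarrow> k \<noteq> i \<Longrightarrow> b k > 0"
    "b 1 + b 2 + b 3 = 1" "A = b 1 *\<^sub>R P 1 + b 2 *\<^sub>R P 2 + b 3 *\<^sub>R P 3"
proof -
  obtain u where u: "0 < u" "u < 1" "A = (1 - u) *\<^sub>R P (nxt i) + u *\<^sub>R P (nxt (nxt i))"
    using assms(2) by (auto simp: open_side_def in_segment)
  let ?b = "\<lambda>k. if k = nxt i then 1 - u else if k = nxt (nxt i) then u else 0"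
  from assms(1) consider "i = 1" | "i = 2" | "i = 3" by auto
  then show thesis
    by cases (rule that[of ?b]; use u in \<open>auto simp: add.commute\<close>)+
qed

lemma interior_between_open_sides:
  assumes "\<not> collinear {P 1, P 2, P 3}" and ij: "i \<in> {1, 2, 3}" "j \<in> {1, 2, 3}" "i \<noteq> j"
    and "A \<in> open_side P i" "B \<in> open_side P j" and t: "0 < t" "t < (1::real)"
  shows "(1 - t) *\<^sub>R A + t *\<^sub>R B \<in> interior (convex hull {P 1, P 2, P 3 :: complex})"
proof -
  obtain b where b: "b i = 0" "\<And>k. k \<in> {1, 2, 3} \<Longrightarrow> k \<noteq> i \<Longrightarrow> b k > 0"
    "b 1 + b 2 + b 3 = 1" "A = b 1 *\<^sub>R P 1 + b 2 *\<^sub>R P 2 + b 3 *\<^sub>R P 3"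
    using open_side_barycentric assms by blast
  obtain c where c: "c j = 0" "\<And>k. k \<in> {1, 2, 3} \<Longrightarrow> k \<noteq> j \<Longrightarrow> c k > 0"
    "c 1 + c 2 + c 3 = 1" "B = c 1 *\<^sub>R P 1 + c 2 *\<^sub>R P 2 + c 3 *\<^sub>R P 3"
    using open_side_barycentric assms by blast
  define e where "e k = (1 - t) * b k + t * c k" for k
  have pos: "e k > 0" if "k \<in> {1, 2, 3}" for k
  proof -
    have "b k \<ge> 0" using b(1) b(2)[OF that] by (cases "k = i") auto
    moreover have "c k \<ge> 0" using c(1) c(2)[OF that] by (cases "k = j") auto
    moreover have "b k > 0 \<or> c k > 0" using b(2)[OF that] c(2)[OF that] ij by blast
    ultimately show ?thesis using t unfolding e_def
      by (auto intro: add_pos_nonneg add_nonneg_pos)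
  qed
  have "e 1 + e 2 + e 3 = (1 - t) * (b 1 + b 2 + b 3) + t * (c 1 + c 2 + c 3)"
    unfolding e_def by algebra
  then have sum: "e 1 + e 2 + e 3 = 1" using b(3) c(3) by simp
  have "(1 - t) *\<^sub>R A + t *\<^sub>R B = e 1 *\<^sub>R P 1 + e 2 *\<^sub>R P 2 + e 3 *\<^sub>R P 3"
    unfolding b(4) c(4) e_def by (simp add: algebra_simps)
  moreover have "DIM(complex) = 2" by simp
  ultimately show ?thesis
    using interior_convex_hull_3_minimal[OF assms(1)] pos[of 1] pos[of 2] pos[of 3] sum by auto
qed

text \<open>
  These sums supply the hitting times of a path from the lengths of its segments, in both
  time directions.
\<close>

lemma int_partial_sums:
  fixes r :: "int \<Rightarrow> real"
  obtains \<tau> :: "int \<Rightarrow> real" where "\<tau> 0 = 0" "\<And>i. \<tau> (i + 1) = \<tau> i + r i"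
proof -
  define \<tau> where "\<tau> i = (if i \<ge> 0 then \<Sum>j\<in>{0..<i}. r j else - (\<Sum>j\<in>{i..<0}. r j))" for i
  have "\<tau> (i + 1) = \<tau> i + r i" for i
  proof (cases "i \<ge> 0")
    case True
    then have "{0..<i + 1} = insert i {0..<i}" by auto
    with True show ?thesis by (simp add: \<tau>_def)
  next
    case False
    then have "{i..<0} = insert i {i + 1..<0}" by auto
    with False show ?thesis by (cases "i = -1") (auto simp: \<tau>_def)
  qed
  moreover have "\<tau> 0 = 0" by (simp add: \<tau>_def)
  ultimately show thesis using that by blast
qed

text \<open>
  The hitting times grow by a fixed positive amount per period, so they exhaust the time axis, and
  the path at time \<open>t\<close> is read off from the last hit before \<open>t\<close>.
\<close>

lemma closed_polygon_is_billiard_path: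
  fixes X u :: "int \<Rightarrow> complex" and r :: "int \<Rightarrow> real" and w :: "int \<Rightarrow> nat"
  assumes tri: "\<not> collinear {P 1, P 2, P 3}" and L: "L > 0"
    and per: "\<And>i. X (i + L) = X i" "\<And>i. u (i + L) = u i" "\<And>i. r (i + L) = r i"
    and w: "\<And>i. w i \<in> {1, 2, 3}" "\<And>i. w (i + 1) \<noteq> w i"
    and X: "\<And>i. X i \<in> open_side P (w i)" "\<And>i. X (i + 1) = X i + r i *\<^sub>R u i"
    and r: "\<And>i. r i > 0" and u: "\<And>i. norm (u i) = 1"
    and refl: "\<And>i. u (i + 1) = reflect (side_dir P (w (i + 1))) (u i)"
  shows "\<exists>\<gamma>. periodic_billiard_path P w \<gamma>"
proof -
  obtain \<tau> where \<tau>0: "\<tau> 0 = 0" and \<tau>: "\<And>i. \<tau> (i + 1) = \<tau> i + r i"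
    using int_partial_sums by blast
  have less: "\<tau> i < \<tau> (i + 1 + int n)" for i n
  proof (induction n)
    case (Suc n)
    have "\<tau> (i + 1 + int (Suc n)) = \<tau> (i + 1 + int n) + r (i + 1 + int n)"
      using \<tau>[of "i + 1 + int n"] by (simp add: algebra_simps)
    then show ?case using Suc r[of "i + 1 + int n"] by linarith
  qed (use \<tau> r in simp)
  have mono: "strict_mono \<tau>"
  proof
    fix i j :: int assume "i < j"
    then have "j = i + 1 + int (nat (j - i - 1))" by simp
    then show "\<tau> i < \<tau> j" using less by metis
  qed
  define \<Lambda> where "\<Lambda> = \<tau> L"
  have "\<Lambda> > 0" using strict_monoD[OF mono L] by (simp add: \<Lambda>_def \<tau>0)
  have shift: "\<tau> (i + L) = \<tau> i + \<Lambda>" for i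
  proof (induction i rule: int_induct[where k = 0])
    case (step1 i)
    then show ?case using \<tau>[of "i + L"] \<tau>[of i] per(3)[of i] by (simp add: algebra_simps)
  next
    case (step2 i)
    then show ?case using \<tau>[of "i - 1 + L"] \<tau>[of "i - 1"] per(3)[of "i - 1"]
      by (simp add: algebra_simps)
  qed (simp add: \<Lambda>_def \<tau>0)
  have shifts: "\<tau> (i + int n * L) = \<tau> i + n * \<Lambda>" for i n
  proof (induction n)
    case (Suc n)
    then show ?case using shift[of "i + int n * L"] by (simp add: algebra_simps)
  qed simp
  have ex: "\<exists>i. \<tau> i \<le> t \<and> t < \<tau> (i + 1)" for t
  proof -
    obtain k :: nat where k: "\<bar>t\<bar> < k * \<Lambda>" using reals_Archimedean3[OF \<open>\<Lambda> > 0\<close>] by blast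
    define i0 where "i0 = - (int k * L)"
    have "\<tau> i0 = - (k * \<Lambda>)" using shifts[of i0 k] by (simp add: i0_def \<tau>0)
    then have lo: "\<tau> i0 \<le> t" using k by linarith
    have "\<tau> (i0 + int (nat (2 * int k * L))) = \<tau> (0 + int k * L)"
      using L by (simp add: i0_def mult.commute)
    then have "t < \<tau> (i0 + int (nat (2 * int k * L)))" using k unfolding shifts \<tau>0 by linarith
    then have "\<exists>n. t < \<tau> (i0 + int n)" by blast
    then obtain n where n: "t < \<tau> (i0 + int n)" "\<forall>m<n. \<not> t < \<tau> (i0 + int m)"
      using exists_least_iff[of "\<lambda>n. t < \<tau> (i0 + int n)"] by blast
    have "n \<noteq> 0" using n(1) lo by (cases n) auto
    then obtain m where m: "n = Suc m" using not0_implies_Suc by blast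
    show ?thesis using n m by (intro exI[of _ "i0 + int m"]) (auto simp: algebra_simps)
  qed
  have uniq: "i = j" if "\<tau> i \<le> t" "t < \<tau> (i + 1)" "\<tau> j \<le> t" "t < \<tau> (j + 1)" for i j t
  proof (rule ccontr)
    assume "i \<noteq> j"
    then have "i + 1 \<le> j \<or> j + 1 \<le> i" by linarith
    then have "\<tau> (i + 1) \<le> \<tau> j \<or> \<tau> (j + 1) \<le> \<tau> i"
      using monoD[OF strict_mono_mono[OF mono]] by blast
    then show False using that by linarith
  qed
  define idx where "idx t = (THE i. \<tau> i \<le> t \<and> t < \<tau> (i + 1))" for t
  have idx: "idx t = i" if "\<tau> i \<le> t" "t < \<tau> (i + 1)" for t i
    unfolding idx_def using that uniq by blast
  define \<gamma> where "\<gamma> t = X (idx t) + (t - \<tau> (idx t)) *\<^sub>R u (idx t)" for t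
  have at\<tau>: "\<gamma> (\<tau> i) = X i" for i
    using idx[of i "\<tau> i"] r[of i] \<tau>[of i] by (simp add: \<gamma>_def)
  have on: "\<gamma> t = \<gamma> (\<tau> i) + (t - \<tau> i) *\<^sub>R u i" if "t \<in> {\<tau> i..\<tau> (i + 1)}" for i t
  proof (cases "t = \<tau> (i + 1)")
    case True
    then show ?thesis using at\<tau>[of i] at\<tau>[of "i + 1"] X(2)[of i] \<tau>[of i] by simp
  next
    case False
    then have "idx t = i" using idx that by auto
    then show ?thesis by (simp add: \<gamma>_def at\<tau>[unfolded \<gamma>_def])
  qed
  have inside: "\<gamma> t \<in> interior (convex hull {P 1, P 2, P 3})" if "t \<in> {\<tau> i<..<\<tau> (i + 1)}" for i t
  proof -
    define q where "q = (t - \<tau> i) / r i"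
    have q: "0 < q" "q < 1" using that r[of i] \<tau>[of i] by (auto simp: q_def)
    have "\<gamma> t = X i + (q * r i) *\<^sub>R u i" using on[of t i] that at\<tau> r[of i] by (simp add: q_def)
    also have "\<dots> = (1 - q) *\<^sub>R X i + q *\<^sub>R X (i + 1)"
      unfolding X(2) by (simp add: algebra_simps)
    finally show ?thesis
      using interior_between_open_sides[OF tri w(1) w(1) _ X(1) X(1) q, of i "i + 1"] w(2)[of i]
      by simp
  qed
  have "billiard_path P w \<gamma>"
    unfolding billiard_path_def
  proof (rule exI[of _ \<tau>], rule exI[of _ u], intro conjI allI ballI)
    show "\<exists>i. \<tau> i \<le> t \<and> t < \<tau> (i + 1)" for t by (rule ex)
    show "w i \<in> {1, 2, 3}" for i by (rule w)
    show "\<gamma> (\<tau> i) \<in> open_side P (w i)" for i unfolding at\<tau> by (rule X)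
    show "u i = reflect (side_dir P (w i)) (u (i - 1))" for i using refl[of "i - 1"] by simp
  qed (fact mono u on inside)+
  moreover have "\<gamma> (t + \<Lambda>) = \<gamma> t" for t
  proof -
    obtain i where i: "\<tau> i \<le> t" "t < \<tau> (i + 1)" using ex by blast
    have "idx t = i" "idx (t + \<Lambda>) = i + L"
      using i idx[of "i + L" "t + \<Lambda>"] shift[of i] shift[of "i + 1"] by (auto intro: idx simp: algebra_simps)
    then show ?thesis using per shift by (simp add: \<gamma>_def)
  qed
  ultimately show ?thesis using \<open>\<Lambda> > 0\<close> unfolding periodic_billiard_path_def by blast
qed

section \<open>Triangles, and edges crossed by a straight line\<close>

text \<open>
  Everything is done for one triangle in each similarity class: its longest side, side 3, is the unit
  segment from 0 to 1, and the labels 1, 2, 3 run counterclockwise. The law of sines gives the lengths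
  of the other sides, and \<open>dir x d u\<close> is the unit vector from vertex \<open>d\<close> to vertex \<open>u\<close>.
\<close>

definition ang :: "real \<times> real \<Rightarrow> nat \<Rightarrow> real" where
  "ang x j = (if j = 1 then fst x else if j = 2 then snd x else pi - fst x - snd x)"

definition side_len :: "real \<times> real \<Rightarrow> nat \<Rightarrow> real" where
  "side_len x j = sin (ang x j) / sin (ang x 3)"

definition tri :: "real \<times> real \<Rightarrow> nat \<Rightarrow> complex" where
  "tri x j = (if j = 1 then 0 else if j = 2 then 1 else side_len x 2 *\<^sub>R cis (fst x))"

definition dir :: "real \<times> real \<Rightarrow> nat \<Rightarrow> nat \<Rightarrow> complex" where
  "dir x d u =
     (if (d, u) = (1, 2) then 1 else if (d, u) = (2, 1) then -1
      else if (d, u) = (1, 3) then cis (fst x) else if (d, u) = (3, 1) then - cis (fst x)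
      else if (d, u) = (2, 3) then - cis (- snd x) else cis (- snd x))"

text \<open>
  For an edge with endpoints \<open>d\<close> and \<open>u\<close> this says that the third vertex is on the left of the way
  from \<open>d\<close> to \<open>u\<close>.
\<close>

definition ccw :: "nat \<Rightarrow> nat \<Rightarrow> bool" where
  "ccw d u \<longleftrightarrow> u = nxt d"

context
  fixes x :: "real \<times> real"
  assumes x: "x \<in> Delta"
begin

lemma Delta_facts:
  "0 < fst x" "0 < snd x" "fst x + snd x < pi / 2"
  using x by (auto simp: Delta_def)

lemma ang_pos: "0 < ang x j"
  using Delta_facts by (simp add: ang_def)

lemma ang_less_pi: "ang x j < pi"
  using Delta_facts by (simp add: ang_def)

lemma sin_ang_pos: "sin (ang x j) > 0"
  by (simp add: sin_gt_zero ang_pos ang_less_pi)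

lemma side_len_pos: "side_len x j > 0"
  by (simp add: side_len_def sin_ang_pos)

lemma side_len_3 [simp]: "side_len x 3 = 1"
  using sin_ang_pos[of 3] by (simp add: side_len_def)

lemma long_side_decomp: "side_len x 2 *\<^sub>R cis (fst x) + side_len x 1 *\<^sub>R cis (- snd x) = 1"
proof -
  have "sin (ang x 3) = sin (fst x + snd x)"
    unfolding ang_def using sin_pi_minus[of "fst x + snd x"] by (simp add: algebra_simps)
  then have *: "sin (ang x 3) = sin (fst x) * cos (snd x) + cos (fst x) * sin (snd x)"
    by (simp add: sin_add)
  have "sin (ang x 3) \<noteq> 0" using sin_ang_pos[of 3] by simp
  then have "side_len x 2 * cos (fst x) + side_len x 1 * cos (snd x) = 1"
    unfolding side_len_def ang_def[of x 1] ang_def[of x 2]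
    by (simp add: add_divide_distrib[symmetric] * mult.commute)
  moreover have "side_len x 2 * sin (fst x) - side_len x 1 * sin (snd x) = 0"
    unfolding side_len_def ang_def[of x 1] ang_def[of x 2] by simp
  ultimately show ?thesis by (simp add: complex_eq_iff)
qed

lemma label_pairs:
  assumes "d \<in> {1, 2, 3}" "u \<in> {1, 2, 3}" "d \<noteq> (u :: nat)"
  obtains "d = 1" "u = 2" | "d = 2" "u = 1" | "d = 1" "u = 3" | "d = 3" "u = 1"
    | "d = 2" "u = 3" | "d = 3" "u = 2"
  using assms by auto

lemma tri_side:
  assumes "d \<in> {1, 2, 3}" "u \<in> {1, 2, 3}" "d \<noteq> u"
  shows "tri x u - tri x d = side_len x (6 - d - u) *\<^sub>R dir x d u"
proof -
  have *: "side_len x 2 *\<^sub>R cis (fst x) = 1 - side_len x 1 *\<^sub>R cis (- snd x)"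
    using long_side_decomp by (simp add: eq_diff_eq)
  show ?thesis
    by (rule label_pairs[OF assms]) (simp_all add: tri_def dir_def * flip: One_nat_def)
qed

text \<open>
  The third vertex of the labels 1, 2, 3 is the complement of the other two to 6.
\<close>

lemma dir_turn:
  assumes "d \<in> {1, 2, 3}" "u \<in> {1, 2, 3}" "d \<noteq> u"
  shows "dir x d (6 - d - u) = dir x d u * cis (if ccw d u then ang x d else - ang x d)"
proof -
  have *: "cis (pi - fst x - snd x) = - cis (- fst x) * cis (- snd x)"
    "cis (fst x + snd x - pi) = - cis (fst x) * cis (snd x)" "cis (fst x - pi) = - cis (fst x)"
    by (simp_all add: complex_eq_iff cos_add sin_add cos_diff sin_diff)
  show ?thesis
    by (rule label_pairs[OF assms]) (simp_all add: dir_def ccw_def ang_def * cis_mult mult.assoc)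
qed

lemma dir_swap:
  assumes "d \<in> {1, 2, 3}" "u \<in> {1, 2, 3}" "d \<noteq> u"
  shows "dir x u d = - dir x d u"
  by (rule label_pairs[OF assms]) (simp_all add: dir_def)

lemma norm_dir: "norm (dir x d u) = 1"
  by (simp add: dir_def)

lemma tri_noncollinear: "\<not> collinear {tri x 1, tri x 2, tri x 3}"
proof
  assume "collinear {tri x 1, tri x 2, tri x 3}"
  then have "collinear {0, 1, side_len x 2 *\<^sub>R cis (fst x)}" by (simp add: tri_def)
  then obtain c where "side_len x 2 *\<^sub>R cis (fst x) = c *\<^sub>R (1 :: complex)"
    by (auto simp: collinear_lemma)
  then have "side_len x 2 * sin (fst x) = 0" by (auto simp: complex_eq_iff)
  then show False using side_len_pos[of 2] sin_ang_pos[of 1] by (simp add: ang_def)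
qed

lemma tri_represents: "represents x (tri x)"
proof -
  have "angle_at (tri x) 1 = fst x"
    using side_len_pos[of 2] Delta_facts
    by (simp add: angle_at_def tri_def Let_def inner_complex_def arccos_cos)
  moreover have "angle_at (tri x) 2 = snd x"
  proof -
    have "tri x 3 - tri x 2 = - (side_len x 1 *\<^sub>R cis (- snd x))" "tri x 1 - tri x 2 = -1"
      using tri_side[of 2 3] by (auto simp: dir_def tri_def)
    then show ?thesis
      using side_len_pos[of 1] Delta_facts
      by (simp add: angle_at_def Let_def inner_complex_def arccos_cos)
  qed
  ultimately show ?thesis using tri_noncollinear by (simp add: represents_def)
qed

end

text \<open>
  In coordinates along the mirror, the reflection is complex conjugation.
\<close>

lemma reflect_polar:
  assumes "norm s = 1" "c \<noteq> 0"
  shows "reflect (c *\<^sub>R s) (s * z) = s * cnj z"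
proof -
  have "s \<bullet> s = 1" using assms(1) by (simp add: dot_square_norm)
  moreover have "(s * z) \<bullet> s = Re z * (s \<bullet> s)"
    by (simp add: inner_complex_def algebra_simps)
  ultimately have "reflect (c *\<^sub>R s) (s * z) = (2 * Re z) *\<^sub>R s - s * z"
    using assms(2) by (simp add: reflect_def)
  also have "\<dots> = s * (complex_of_real (2 * Re z) - z)"
    by (simp add: scaleR_conv_of_real algebra_simps)
  also have "complex_of_real (2 * Re z) - z = cnj z" by (simp add: complex_eq_iff)
  finally show ?thesis .
qed

text \<open>
  A crossing \<open>(d, u, a, b, z)\<close> describes an edge of the unfolding that is crossed by the unfolded path,
  which runs to the right along the real axis: the labels \<open>d\<close> and \<open>u\<close> of the lower and the upper
  endpoint, their heights \<open>a\<close> and \<open>b\<close>, and the unit vector \<open>z\<close> from the lower to the upper one.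
  Horizontal positions are not recorded, because the heights determine them up to a translation.
\<close>

type_synonym crossing = "nat \<times> nat \<times> real \<times> real \<times> complex"

fun crossed :: "real \<times> real \<Rightarrow> crossing \<Rightarrow> bool" where
  "crossed x (d, u, a, b, z) \<longleftrightarrow>
     d \<in> {1, 2, 3} \<and> u \<in> {1, 2, 3} \<and> d \<noteq> u \<and> a < 0 \<and> 0 < b \<and> norm z = 1 \<and>
     b - a = side_len x (6 - d - u) * Im z"

text \<open>
  The path passes to the next edge of a triangle. The two edges share a vertex, around which the edge
  turns clockwise if this pivot is below the path, and counterclockwise if it is above. The
  other endpoint is replaced by the third vertex of the triangle.
\<close>

fun hinge :: "real \<times> real \<Rightarrow> crossing \<Rightarrow> crossing \<Rightarrow> bool" where
  "hinge x (d, u, a, b, z) (d', u', a', b', z') \<longleftrightarrow>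
     d' = d \<and> u' = 6 - d - u \<and> a' = a \<and> z' = z * cis (- ang x d) \<or>
     u' = u \<and> d' = 6 - d - u \<and> b' = b \<and> z' = z * cis (ang x u)"

fun letter :: "crossing \<Rightarrow> nat" where
  "letter (d, u, a, b, z) = 6 - d - u"

text \<open>
  The point of the triangle that is hit, and the direction of the path after the hit, both folded
  back. The unfolded triangle behind the edge has the orientation of the original one or the opposite
  one, hence the conjugation.
\<close>

fun hit_point :: "real \<times> real \<Rightarrow> crossing \<Rightarrow> complex" where
  "hit_point x (d, u, a, b, z) = tri x d + (- a / Im z) *\<^sub>R dir x d u"

fun exit_dir :: "real \<times> real \<Rightarrow> crossing \<Rightarrow> complex" where
  "exit_dir x (d, u, a, b, z) = dir x d u * (if ccw d u then z else cnj z)"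

lemma crossed_Im_pos:
  assumes "x \<in> Delta" "crossed x (d, u, a, b, z)"
  shows "Im z > 0"
proof -
  have "side_len x (6 - d - u) * Im z > 0" using assms(2) by simp
  then show ?thesis using side_len_pos[OF assms(1)] zero_less_mult_pos by blast
qed

lemma hit_point_on_side:
  assumes x: "x \<in> Delta" and e: "crossed x (d, u, a, b, z)"
  shows "hit_point x (d, u, a, b, z) \<in> open_side (tri x) (6 - d - u)"
    "hit_point x (d, u, a, b, z) = tri x u - (b / Im z) *\<^sub>R dir x d u"
proof -
  let ?l = "side_len x (6 - d - u)"
  note Im = crossed_Im_pos[OF x e] and l = side_len_pos[OF x, of "6 - d - u"]
  have side: "tri x u - tri x d = ?l *\<^sub>R dir x d u" using tri_side[OF x, of d u] e by simp
  define t where "t = - a / (b - a)"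
  have ba: "b - a = ?l * Im z" and ab: "a < 0" "0 < b" using e by auto
  have t: "0 < t" "t < 1" using ab unfolding t_def by (simp_all add: field_simps)
  have "- a / Im z = t * ?l" using Im l unfolding t_def ba by simp
  then have pt: "hit_point x (d, u, a, b, z) = tri x d + t *\<^sub>R (tri x u - tri x d)"
    by (simp add: side)
  have "tri x d \<noteq> tri x u" using side l norm_dir[OF x, of d u] by auto
  then have "hit_point x (d, u, a, b, z) \<in> open_segment (tri x d) (tri x u)"
    using t pt by (auto simp: in_segment algebra_simps intro!: exI[of _ t])
  moreover have "open_segment (tri x d) (tri x u) = open_side (tri x) (6 - d - u)"
    using e by (auto simp: open_side_def open_segment_commute)
  ultimately show "hit_point x (d, u, a, b, z) \<in> open_side (tri x) (6 - d - u)" by simp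
  have "tri x u = tri x d + ?l *\<^sub>R dir x d u" using side by (simp add: algebra_simps)
  moreover have "?l = (b - a) / Im z" using ba Im by simp
  ultimately show "hit_point x (d, u, a, b, z) = tri x u - (b / Im z) *\<^sub>R dir x d u"
    using Im by (simp add: diff_divide_distrib scaleR_diff_left)
qed

text \<open>
  Consecutive edges bear different labels, and the orientation of the triangles alternates.
\<close>

lemma pivot_labels:
  assumes "d \<in> {1, 2, 3}" "u \<in> {1, 2, 3}" "d \<noteq> u"
    and "d' = d \<and> u' = 6 - d - u \<or> d' = 6 - d - u \<and> u' = u"
  shows "6 - d' - u' \<noteq> 6 - d - u" "ccw d' u' \<longleftrightarrow> \<not> ccw d u" "ccw u d \<longleftrightarrow> \<not> ccw d u"
proof -
  have "(d, u) \<in> {(1, 2), (2, 1), (1, 3), (3, 1), (2, 3), (3, 2)}" using assms(1-3) by auto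
  then show "6 - d' - u' \<noteq> 6 - d - u" "ccw d' u' \<longleftrightarrow> \<not> ccw d u" "ccw u d \<longleftrightarrow> \<not> ccw d u"
    using assms(4) by (elim insertE emptyE disjE conjE; simp add: ccw_def)+
qed

text \<open>
  The cotangents of the angles between the path and the two edges at the pivot differ by a quantity
  whose sign is that of the sine of the angle of the triangle there. This is why the second edge is
  reached after the first one, so that no condition on horizontal positions is needed.
\<close>

lemma hinge_advances:
  assumes x: "x \<in> Delta" and e: "crossed x e" "crossed x e'" and h: "hinge x e e'"
  shows "\<exists>r>0. hit_point x e' = hit_point x e + r *\<^sub>R exit_dir x e"
    and "exit_dir x e' = reflect (side_dir (tri x) (letter e')) (exit_dir x e)"
    and "letter e' \<noteq> letter e"
proof -
  obtain d u a b z where e_eq: "e = (d, u, a, b, z)" by (cases e)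
  obtain d' u' a' b' z' where e'_eq: "e' = (d', u', a', b', z')" by (cases e')
  note e = e[unfolded e_eq e'_eq]
  have Im: "Im z > 0" "Im z' > 0" using crossed_Im_pos[OF x] e by blast+
  have nz: "z * cnj z = 1" "z' * cnj z' = 1" using e by (auto simp: complex_norm_square[symmetric])
  have lab: "d \<in> {1, 2, 3}" "u \<in> {1, 2, 3}" "d \<noteq> u" "d' \<in> {1, 2, 3}" "u' \<in> {1, 2, 3}" "d' \<noteq> u'"
    using e by auto
  have sgn: "a < 0" "b > 0" using e by auto
  have pivot: "d' = d \<and> u' = 6 - d - u \<or> d' = 6 - d - u \<and> u' = u"
    using h unfolding e_eq e'_eq by auto
  show "letter e' \<noteq> letter e" using pivot_labels(1)[OF lab(1-3) pivot] by (simp add: e_eq e'_eq)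
  note opp = pivot_labels(2)[OF lab(1-3) pivot]
  define D where "D = dir x d u"
  define G where "G w = (if ccw d u then w else cnj w)" for w
  define F where "F w = (if ccw d u then cnj w else w)" for w
  define \<sigma> where "\<sigma> = (if ccw d u then - \<i> else \<i>)"
  have exit: "exit_dir x e = D * G z" by (simp add: e_eq D_def G_def)
  have GF: "G z * F z = 1" "G z' * F z' = 1" using nz by (auto simp: G_def F_def mult.commute)
  have cot: "F w = Im w *\<^sub>R (complex_of_real (Re w / Im w) + \<sigma>)" if "Im w > 0" for w
    using that by (simp add: complex_eq_iff F_def \<sigma>_def)
  \<comment> \<open>Two points at the same height, on the two edges at the pivot, differ by a multiple of the
    direction of motion.\<close>
  have shift: "(c / Im z') *\<^sub>R (D * (G z * F z')) - (c / Im z) *\<^sub>R D =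
      (c * (Re z' / Im z' - Re z / Im z)) *\<^sub>R (D * G z)" for c
  proof -
    have "(c / Im z') *\<^sub>R (D * (G z * F z')) - (c / Im z) *\<^sub>R D =
        (c / Im z') *\<^sub>R (D * (G z * F z')) - (c / Im z) *\<^sub>R (D * (G z * F z))" by (simp add: GF)
    also have "\<dots> = c *\<^sub>R (D * G z * (complex_of_real (Re z' / Im z') + \<sigma>))
        - c *\<^sub>R (D * G z * (complex_of_real (Re z / Im z) + \<sigma>))"
      using Im by (simp add: cot mult.assoc)
    also have "\<dots> = (c * (Re z' / Im z' - Re z / Im z)) *\<^sub>R (D * G z)"
      by (simp add: scaleR_conv_of_real algebra_simps)
    finally show ?thesis .
  qed
  have key: "(\<exists>r>0. hit_point x e' = hit_point x e + r *\<^sub>R exit_dir x e) \<and>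
      dir x d' u' = D * (G z * F z')"
    using h[unfolded e_eq e'_eq hinge.simps]
  proof (elim disjE conjE)
    assume *: "d' = d" "u' = 6 - d - u" "a' = a" "z' = z * cis (- ang x d)"
    have zz: "z * cnj z' = cis (ang x d)" using nz by (simp add: * cis_cnj mult.assoc[symmetric])
    then have "cnj z * z' = cis (- ang x d)" by (metis cis_cnj complex_cnj_cnj complex_cnj_mult)
    then have D': "dir x d' u' = D * (G z * F z')"
      using dir_turn[OF x lab(1-3)] zz by (simp add: *(1,2) D_def G_def F_def)
    have "Im (z * cnj z') > 0" using zz sin_ang_pos[OF x] by simp
    then have "Re z' / Im z' - Re z / Im z > 0" using Im by (simp add: field_simps)
    then have "- a * (Re z' / Im z' - Re z / Im z) > 0" using sgn by (simp add: mult_neg_pos)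
    moreover have "hit_point x e' = hit_point x e + (- a * (Re z' / Im z' - Re z / Im z)) *\<^sub>R exit_dir x e"
    proof -
      have "hit_point x e' = tri x d + (- a / Im z') *\<^sub>R (D * (G z * F z'))"
        unfolding D'[symmetric] by (simp add: e'_eq *(1,3))
      moreover have "hit_point x e = tri x d + (- a / Im z) *\<^sub>R D" by (simp add: e_eq D_def)
      ultimately show ?thesis unfolding exit shift[symmetric] by simp
    qed
    ultimately show ?thesis using D' by blast
  next
    assume *: "u' = u" "d' = 6 - d - u" "b' = b" "z' = z * cis (ang x u)"
    have zz: "cnj z * z' = cis (ang x u)" using nz by (simp add: * mult.assoc[symmetric] mult.commute)
    then have zz': "z * cnj z' = cis (- ang x u)" by (metis cis_cnj complex_cnj_cnj complex_cnj_mult)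
    have "dir x u d' = dir x u d * cis (if ccw u d then ang x u else - ang x u)"
      using dir_turn[OF x lab(2,1) lab(3)[symmetric]] by (simp add: *(2) add.commute)
    then have D': "dir x d' u' = D * (G z * F z')"
      using dir_swap[OF x lab(1-3)] dir_swap[OF x lab(5,4) lab(6)[symmetric]] zz zz'
        pivot_labels(3)[OF lab(1-3) pivot]
      by (simp add: *(1) D_def G_def F_def)
    have "Im (cnj z * z') > 0" using zz sin_ang_pos[OF x] by simp
    then have "Re z' / Im z' - Re z / Im z < 0" using Im by (simp add: field_simps)
    then have "- b * (Re z' / Im z' - Re z / Im z) > 0" using sgn by (simp add: mult_less_0_iff)
    moreover have "hit_point x e' = hit_point x e + (- b * (Re z' / Im z' - Re z / Im z)) *\<^sub>R exit_dir x e"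
    proof -
      have "hit_point x e' = tri x u - (b / Im z') *\<^sub>R (D * (G z * F z'))"
        unfolding D'[symmetric] using hit_point_on_side(2)[OF x e(2)] by (simp only: e'_eq *(1,3))
      moreover have "hit_point x e = tri x u - (b / Im z) *\<^sub>R D"
        using hit_point_on_side(2)[OF x e(1)] by (simp only: e_eq D_def)
      ultimately show ?thesis unfolding exit shift[symmetric] by simp
    qed
    ultimately show ?thesis using D' by blast
  qed
  then show "\<exists>r>0. hit_point x e' = hit_point x e + r *\<^sub>R exit_dir x e" by blast
  obtain c where c: "c \<noteq> 0" "side_dir (tri x) (letter e') = c *\<^sub>R dir x d' u'"
  proof (cases "ccw d' u'")
    case True
    then show thesis
      using lab(4-6) side_len_pos[OF x, of "letter e'"] tri_side[OF x, of d' u'] unfolding e'_eq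
      by (intro that[of "side_len x (letter e')"]) (auto simp: ccw_def side_dir_def e'_eq)
  next
    case False
    then show thesis
      using lab(4-6) side_len_pos[OF x, of "letter e'"] tri_side[OF x, of u' d'] dir_swap[OF x, of d' u']
      by (intro that[of "- side_len x (letter e')"]) (auto simp: ccw_def side_dir_def e'_eq)
  qed
  show "exit_dir x e' = reflect (side_dir (tri x) (letter e')) (exit_dir x e)"
    proof -
    have "exit_dir x e = dir x d' u' * G z'" using key GF(2) exit by (simp add: ac_simps)
    then show ?thesis using reflect_polar[OF norm_dir[OF x] c(1)] opp
      unfolding c(2) by (auto simp: e'_eq G_def)
  qed
qed

text \<open>
  The cycle of crossings contains the condition that the unfolding closes up: its last edge must
  lead to the first one with the same direction and the same heights.
\<close>

lemma cyclic_crossings_orbit_tile: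
  assumes x: "x \<in> Delta" and ne: "es \<noteq> []"
    and crossed: "\<And>e. e \<in> set es \<Longrightarrow> crossed x e"
    and hinge: "successively (hinge x) (es @ [hd es])"
  shows "x \<in> orbit_tile (map letter es)"
proof -
  define L where "L = int (length es)"
  have L: "L > 0" using ne by (simp add: L_def)
  define e where "e i = es ! nat (i mod L)" for i :: int
  have in_set: "e i \<in> set es" for i
    using L by (auto simp: e_def L_def intro!: nth_mem nat_less_iff[THEN iffD2])
  have step: "hinge x (e i) (e (i + 1))" for i
  proof -
    define k where "k = nat (i mod L)"
    have k: "k < length es" "int k = i mod L" using L by (auto simp: k_def L_def nat_less_iff)
    have "(i + 1) mod L = (int k + 1) mod L" by (simp add: k(2) mod_add_left_eq)
    also have "\<dots> = (if int k + 1 = L then 0 else int k + 1)"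
      using k(1) by (auto simp: L_def)
    finally have "e (i + 1) = (es @ [hd es]) ! Suc k"
      using k(1) ne by (auto simp: e_def L_def nth_append hd_conv_nth nat_add_distrib)
    moreover have "e i = (es @ [hd es]) ! k" using k(1) by (simp add: e_def k_def nth_append)
    ultimately show ?thesis using hinge k(1) by (simp add: successively_conv_nth)
  qed
  note ok = crossed[OF in_set]
  obtain r where r: "\<And>i. r i > 0" "\<And>i. hit_point x (e (i + 1)) = hit_point x (e i) + r i *\<^sub>R exit_dir x (e i)"
    using hinge_advances(1)[OF x ok ok step] by metis
  have unit: "norm (exit_dir x (e i)) = 1" for i
    using ok[of i] norm_dir[OF x] by (cases "e i") (auto simp: norm_mult)
  have per: "e (i + L) = e i" for i by (simp add: e_def)
  have r_norm: "r i = norm (hit_point x (e (i + 1)) - hit_point x (e i))" for i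
    using r[of i] unit[of i] by simp
  have "\<exists>\<gamma>. periodic_billiard_path (tri x) (\<lambda>i. letter (e i)) \<gamma>"
  proof (rule closed_polygon_is_billiard_path[OF tri_noncollinear[OF x] L,
        where X = "\<lambda>i. hit_point x (e i)" and u = "\<lambda>i. exit_dir x (e i)" and r = r])
    show "r (i + L) = r i" for i
      using per[of i] per[of "i + 1"] by (simp add: r_norm algebra_simps)
    show "letter (e i) \<in> {1, 2, 3}" for i using ok[of i] by (cases "e i") auto
    have "hit_point x e' \<in> open_side (tri x) (letter e')" if "crossed x e'" for e'
      using that hit_point_on_side(1)[OF x] by (cases e') (simp only: letter.simps)
    then show "hit_point x (e i) \<in> open_side (tri x) (letter (e i))" for i using ok by blast
  qed (use per r unit hinge_advances[OF x ok ok step] in auto)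
  moreover have "(\<lambda>i. letter (e i)) = periodic_word (map letter es)"
    using L by (auto simp: periodic_word_def e_def L_def fun_eq_iff nat_less_iff)
  ultimately show ?thesis
    using x tri_represents[OF x] unfolding orbit_tile_def by auto
qed

section \<open>Unfoldings made of fans\<close>

text \<open>
  The fans are centred at the vertices of a skeleton, which alternate between the two acute labels;
  \<open>A\<close> is the label at even positions. The spokes of a fan are numbered from the edge to the previous
  skeleton vertex on. Even spokes are longest sides, with label 3, and odd spokes are short sides.
\<close>

definition lab :: "nat \<Rightarrow> nat \<Rightarrow> nat" where
  "lab A i = (if even i then A else 3 - A)"

text \<open>
  The labels of the spokes \<open>t, \<dots>, M - 1\<close>. Spoke \<open>M\<close> is the edge to the next skeleton vertex and is
  counted in the next fan, if the path crosses it.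
\<close>

definition fan_word :: "nat \<Rightarrow> nat \<Rightarrow> nat \<Rightarrow> nat \<Rightarrow> nat list" where
  "fan_word A i t M = map (\<lambda>j. if even j then 3 else 3 - lab A i) [t..<M]"

definition spoke_len :: "nat \<Rightarrow> real \<times> real \<Rightarrow> nat \<Rightarrow> nat \<Rightarrow> real" where
  "spoke_len A x i j = (if even j then 1 else side_len x (3 - lab A i))"

lemma successively_concat_map_upt:
  assumes ne: "\<And>i. i < k \<Longrightarrow> B i \<noteq> []"
    and inner: "\<And>i. i < k \<Longrightarrow> successively R (B i)"
    and link: "\<And>i. Suc i < k \<Longrightarrow> R (last (B i)) (hd (B (Suc i)))"
  shows "successively R (concat (map B [0..<k])) \<and>
    (k > 0 \<longrightarrow> concat (map B [0..<k]) \<noteq> [] \<and> last (concat (map B [0..<k])) = last (B (k - 1)))"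
  using assms
proof (induction k)
  case (Suc k)
  then show ?case by (cases k) (auto simp: successively_append_iff)
qed simp

lemma hd_concat_map_upt:
  assumes "k > 0" "B 0 \<noteq> []"
  shows "hd (concat (map B [0..<k])) = hd (B 0)"
  using assms by (simp add: upt_conv_Cons)

text \<open>
  The skeleton vertex \<open>i\<close> is at height \<open>h i\<close> over the path, below it if \<open>s i = 1\<close> and above it if
  \<open>s i = -1\<close>; \<open>\<omega> i\<close> is the direction of the skeleton edge that leads to it, and \<open>M i\<close> triangles fit
  between this edge and the next one. If two consecutive vertices are on different sides, the path
  crosses the skeleton edge between them. If they are on the same side, it passes around this edge
  through the obtuse vertex of the adjacent triangle, whose two short sides are the last spoke of one
  fan and spoke 1 of the next; this is the case \<open>t = 1\<close>.
\<close>

theorem skeleton_orbit_tile: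
  fixes A K :: nat and s h :: "nat \<Rightarrow> real" and M t :: "nat \<Rightarrow> nat" and \<omega> :: "nat \<Rightarrow> complex"
  assumes x: "x \<in> Delta" and A: "A \<in> {1, 2}" and K: "even K" "K > 0"
    and M: "\<And>i. i \<le> K \<Longrightarrow> even (M i) \<and> M i \<ge> 2"
    and s: "\<And>i. i \<le> K \<Longrightarrow> s i = 1 \<or> s i = -1"
    and t: "\<And>i. i < K \<Longrightarrow> t (Suc i) = (if s (Suc i) = s i then 1 else 0)"
    and closed: "s K = s 0" "t K = t 0" "M K = M 0" "h K = h 0" "\<omega> K = \<omega> 0"
    and unit: "norm (\<omega> 0) = 1"
    and turn: "\<And>i. i < K \<Longrightarrow> \<omega> (Suc i) = - \<omega> i * cis (- s i * M i * ang x (lab A i))"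
    and climb: "\<And>i. i < K \<Longrightarrow> h (Suc i) = h i + Im (\<omega> (Suc i))"
    and pivot: "\<And>i. i < K \<Longrightarrow> s i * h i < 0"
    and spoke: "\<And>i j. i < K \<Longrightarrow> 1 \<le> j \<Longrightarrow> j < M i \<Longrightarrow>
      s i * (h i - spoke_len A x i j * Im (\<omega> i * cis (- s i * j * ang x (lab A i)))) > 0"
  shows "x \<in> orbit_tile (concat (map (\<lambda>i. fan_word A i (t i) (M i)) [0..<K]))"
proof -
  define q where "q i j = \<omega> i * cis (- s i * j * ang x (lab A i))" for i j :: nat
  define o' where "o' i j = (if even j then 3 - lab A i else 3)" for i j :: nat
  define g where "g i j = h i - spoke_len A x i j * Im (q i j)" for i j :: nat
  define edge :: "nat \<Rightarrow> nat \<Rightarrow> crossing" where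
    "edge i j = (if s i = 1 then (lab A i, o' i j, h i, g i j, - q i j) else (o' i j, lab A i, g i j, h i, q i j))"
    for i j
  define B where "B i = map (edge i) [t i..<M i]" for i
  have unit: "norm (\<omega> i) = 1" if "i \<le> K" for i
    using that by (induction i) (use unit turn in \<open>auto simp: norm_mult\<close>)
  have lab: "lab A i \<in> {1, 2}" "lab A (Suc i) = 3 - lab A i" for i
    using A by (auto simp: lab_def)
  have labK: "lab A K = lab A 0" using K by (simp add: lab_def)
  have per: "edge K j = edge 0 j" for j
    by (simp add: edge_def q_def o'_def g_def spoke_len_def labK closed)
  have t_le: "t i \<le> 1" if "i \<le> K" for i
    using that t[of "i - 1"] closed(2) t[of "K - 1"] K by (cases i) auto
  have t_less: "t i < M i" if "i \<le> K" for i using t_le[OF that] M[OF that] by simp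
  have pivot': "s i * h i < 0" if "i \<le> K" for i
    using pivot[of i] pivot[of 0] closed K that by (cases "i = K") auto
  have ang3: "cis (ang x 3) = - cis (- ang x (lab A i)) * cis (- ang x (3 - lab A i))" for i
    using lab(1)[of i] by (auto simp: ang_def cis_mult minus_cis algebra_simps)
  \<comment> \<open>A skeleton edge is the sum of the two short sides of the triangle next to it.\<close>
  have decomp: "side_len x (3 - lab A i) *\<^sub>R cis (ang x (lab A i)) +
      side_len x (lab A i) *\<^sub>R cis (- ang x (3 - lab A i)) = 1" for i
  proof -
    have "side_len x 2 *\<^sub>R cis (ang x 1) + side_len x 1 *\<^sub>R cis (- ang x 2) = 1"
      using long_side_decomp[OF x] by (simp add: ang_def)
    moreover from arg_cong[OF this, of cnj]
    have "side_len x 1 *\<^sub>R cis (ang x 2) + side_len x 2 *\<^sub>R cis (- ang x 1) = 1"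
      by (simp add: cis_cnj add.commute)
    ultimately show ?thesis using lab(1)[of i] by auto
  qed
  have q_end: "q i (M i) = - \<omega> (Suc i)" if "i < K" for i
    using turn[OF that] by (simp add: q_def)
  have q0: "q i 0 = \<omega> i" for i by (simp add: q_def)
  have q_Suc: "q i (Suc j) = q i j * cis (- s i * ang x (lab A i))" for i j
    by (simp add: q_def cis_mult mult.assoc algebra_simps)
  have inner: "hinge x (edge i j) (edge i (Suc j))" if "i \<le> K" for i j
    using s[OF that] lab(1)[of i] by (auto simp: edge_def q_Suc o'_def)
  have crossed: "crossed x (edge i j)" if i: "i < K" and j: "t i \<le> j" "j < M i" for i j
  proof -
    \<comment> \<open>Spoke 0 ends at the previous skeleton vertex, which lies on the other side when it is crossed.\<close>
    have backward: "s (Suc k) * (h (Suc k) - Im (\<omega> (Suc k))) > 0" if "k < K" "t (Suc k) = 0" for k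
      using that t[of k] s[of k] s[of "Suc k"] climb[of k] pivot[of k] by (auto split: if_splits)
    have "s i * g i j > 0"
    proof (cases "j = 0")
      case True
      then have "s i * (h i - Im (\<omega> i)) > 0"
        using backward[of "i - 1"] backward[of "K - 1"] closed i j(1) K by (cases i) auto
      with True show ?thesis by (simp add: g_def spoke_len_def q0)
    next
      case False
      then show ?thesis using spoke[OF i _ j(2)] by (simp add: g_def q_def)
    qed
    moreover have "norm (q i j) = 1" using unit[of i] i by (simp add: q_def norm_mult)
    moreover have "h i - g i j = side_len x (6 - lab A i - o' i j) * Im (q i j)"
      "h i - g i j = side_len x (6 - o' i j - lab A i) * Im (q i j)"
      using lab(1)[of i] x by (auto simp: g_def spoke_len_def o'_def)
    ultimately show ?thesis
      using pivot[OF i] s[of i] i lab(1)[of i] by (auto simp: edge_def o'_def)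
  qed
  have link: "hinge x (edge i (M i - 1)) (edge (Suc i) (t (Suc i)))" if i: "i < K" for i
  proof -
    have M1: "Suc (M i - 1) = M i" "odd (M i - 1)" using M[of i] i by auto
    have si: "s i = 1 \<or> s i = -1" "s (Suc i) = 1 \<or> s (Suc i) = -1" using s i by auto
    show ?thesis
    proof (cases "s (Suc i) = s i")
      case False
      \<comment> \<open>The skeleton edge is at once the last spoke of one fan and spoke 0 of the next.\<close>
      have "edge (Suc i) 0 = edge i (M i)"
        using False si lab[of i] M[of i] i climb[OF i]
        by (auto simp: edge_def q0 q_end o'_def g_def spoke_len_def)
      then show ?thesis using inner[of i "M i - 1"] False t[OF i] i M1 by simp
    next
      case True
      \<comment> \<open>Here the pivot is the obtuse vertex between the two fans.\<close>
      define \<alpha> \<beta> where "\<alpha> = ang x (lab A i)" and "\<beta> = ang x (3 - lab A i)"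
      have "q i (M i - 1) * cis (- s i * \<alpha>) = - \<omega> (Suc i)"
        using q_Suc[of i "M i - 1"] q_end[OF i] M1 by (simp add: \<alpha>_def)
      then have "q i (M i - 1) * cis (- s i * \<alpha>) * cis (s i * \<alpha>) = - \<omega> (Suc i) * cis (s i * \<alpha>)"
        by simp
      then have qi: "q i (M i - 1) = - \<omega> (Suc i) * cis (s i * \<alpha>)"
        by (simp add: cis_mult mult.assoc)
      have qS: "q (Suc i) 1 = \<omega> (Suc i) * cis (- s i * \<beta>)"
        using True lab(2)[of i] by (simp add: q_def \<beta>_def)
      have "side_len x (3 - lab A i) *\<^sub>R cis (s i * \<alpha>) + side_len x (lab A i) *\<^sub>R cis (- s i * \<beta>) = 1"
        using si(1)
      proof
        assume "s i = 1"
        then show ?thesis using decomp[of i] by (simp add: \<alpha>_def \<beta>_def)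
      next
        assume "s i = -1"
        then show ?thesis
          using arg_cong[OF decomp[of i], of cnj] by (simp add: \<alpha>_def \<beta>_def cis_cnj)
      qed
      then have "\<omega> (Suc i) * (side_len x (3 - lab A i) *\<^sub>R cis (s i * \<alpha>) + side_len x (lab A i) *\<^sub>R cis (- s i * \<beta>)) = \<omega> (Suc i)"
        by simp
      then have "side_len x (3 - lab A i) * Im (\<omega> (Suc i) * cis (s i * \<alpha>)) +
          side_len x (lab A i) * Im (\<omega> (Suc i) * cis (- s i * \<beta>)) = Im (\<omega> (Suc i))"
        by (simp add: complex_eq_iff algebra_simps)
      moreover have "3 - lab A (Suc i) = lab A i" using lab[of i] by auto
      then have "g (Suc i) 1 = h (Suc i) - side_len x (lab A i) * Im (\<omega> (Suc i) * cis (- s i * \<beta>))"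
        unfolding g_def qS by (simp add: spoke_len_def)
      moreover have "g i (M i - 1) = h i + side_len x (3 - lab A i) * Im (\<omega> (Suc i) * cis (s i * \<alpha>))"
        using M1(2) unfolding g_def qi by (simp add: spoke_len_def algebra_simps)
      ultimately have gg: "g (Suc i) 1 = g i (M i - 1)" using climb[OF i] by linarith
      have c3: "cis (ang x 3) = - cis (- \<alpha>) * cis (- \<beta>)" using ang3[of i] by (simp add: \<alpha>_def \<beta>_def)
      have c3': "cis (- ang x 3) = - cis \<alpha> * cis \<beta>"
        using arg_cong[OF c3, of cnj] by (simp add: cis_cnj)
      have cc: "cis \<alpha> * cis (- \<alpha>) = 1" "cis (- \<alpha>) * cis \<alpha> = 1" by (simp_all add: cis_mult)
      have z: "s i = 1 \<Longrightarrow> - q (Suc i) 1 = - q i (M i - 1) * cis (ang x 3)"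
        "s i = -1 \<Longrightarrow> q (Suc i) 1 = q i (M i - 1) * cis (- ang x 3)"
        unfolding qi qS c3 c3' using cc by (simp_all add: algebra_simps)
      have "o' i (M i - 1) = 3" "o' (Suc i) 1 = 3" using M1 by (simp_all add: o'_def)
      then have "hinge x (edge i (M i - 1)) (edge (Suc i) 1)"
        using si(1) True gg z lab[of i] by (auto simp: edge_def)
      then show ?thesis using True t[OF i] by simp
    qed
  qed
  have "successively (hinge x) (concat (map B [0..<K])) \<and>
    (K > 0 \<longrightarrow> concat (map B [0..<K]) \<noteq> [] \<and> last (concat (map B [0..<K])) = last (B (K - 1)))"
  proof (rule successively_concat_map_upt)
    fix i assume i: "i < K"
    show "B i \<noteq> []" using t_less[of i] i by (simp add: B_def)
    show "successively (hinge x) (B i)"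
      using inner[of i] i by (simp add: B_def successively_conv_nth)
  next
    fix i assume i: "Suc i < K"
    then show "hinge x (last (B i)) (hd (B (Suc i)))"
      using link[of i] t_less[of i] t_less[of "Suc i"] by (simp add: B_def last_map hd_map)
  qed
  moreover have "hd (concat (map B [0..<K])) = edge 0 (t 0)"
    using hd_concat_map_upt[of K B] K t_less[of 0] by (simp add: B_def hd_map)
  moreover have "last (B (K - 1)) = edge (K - 1) (M (K - 1) - 1)"
    using t_less[of "K - 1"] by (simp add: B_def last_map)
  moreover have "hinge x (edge (K - 1) (M (K - 1) - 1)) (edge 0 (t 0))"
    using link[of "K - 1"] K per closed by simp
  ultimately have "successively (hinge x) (concat (map B [0..<K]) @ [hd (concat (map B [0..<K]))])"
    and ne: "concat (map B [0..<K]) \<noteq> []"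
    using K by (auto simp: successively_append_iff)
  then have "x \<in> orbit_tile (map letter (concat (map B [0..<K])))"
    using crossed by (intro cyclic_crossings_orbit_tile[OF x]) (auto simp: B_def)
  also have "map letter (concat (map B [0..<K])) = concat (map (\<lambda>i. fan_word A i (t i) (M i)) [0..<K])"
  proof -
    have "6 - (lab A i + (3 - lab A i)) = 3" "6 - (3 - lab A i + lab A i) = 3" for i
      using lab(1)[of i] by auto
    then show ?thesis
      by (auto simp: map_concat B_def fan_word_def edge_def o'_def intro!: arg_cong[of _ _ concat])
  qed
  finally show ?thesis .
qed

section \<open>Skeletons that are symmetric under a rotation\<close>

text \<open>
  A doubled skeleton has \<open>2 * m\<close> edges. Its vertices 0 and \<open>m\<close> carry fans of \<open>N\<close> triangles, the first below
  and the second above the path. Signs \<open>s i\<close> and numbers \<open>k i\<close> are prescribed for \<open>0 < i < m\<close>, with fans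
  of \<open>N - k i\<close> triangles, and the second half is the first one run backwards with opposite signs.
\<close>

definition mirror_sign :: "nat \<Rightarrow> (nat \<Rightarrow> real) \<Rightarrow> nat \<Rightarrow> real" where
  "mirror_sign m s i =
     (if i = 0 \<or> i = 2 * m then 1 else if i = m then -1 else if i < m then s i else - s (2 * m - i))"

definition mirror_fan :: "nat \<Rightarrow> nat \<Rightarrow> (nat \<Rightarrow> nat) \<Rightarrow> nat \<Rightarrow> nat" where
  "mirror_fan N m k i =
     (if i = 0 \<or> i = 2 * m \<or> i = m then N else if i < m then N - k i else N - k (2 * m - i))"

definition first_spoke :: "nat \<Rightarrow> (nat \<Rightarrow> real) \<Rightarrow> nat \<Rightarrow> nat" where
  "first_spoke m s i =
     (if mirror_sign m s i = mirror_sign m s (if i = 0 then 2 * m - 1 else i - 1) then 1 else 0)"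

definition doubled_word :: "nat \<Rightarrow> nat \<Rightarrow> nat \<Rightarrow> (nat \<Rightarrow> real) \<Rightarrow> (nat \<Rightarrow> nat) \<Rightarrow> nat list" where
  "doubled_word A N m s k =
     concat (map (\<lambda>i. fan_word A i (first_spoke m s i) (mirror_fan N m k i)) [0..<2 * m])"

text \<open>
  The position of the outer end of spoke \<open>j\<close> of fan \<open>i\<close>, for a skeleton with vertices \<open>v\<close> and headings \<open>\<theta>\<close>.
\<close>

definition spoke_end :: "nat \<Rightarrow> real \<times> real \<Rightarrow> (nat \<Rightarrow> real) \<Rightarrow> (nat \<Rightarrow> real) \<Rightarrow> (nat \<Rightarrow> complex) \<Rightarrow> nat \<Rightarrow> nat \<Rightarrow> complex"
  where "spoke_end A x s \<theta> v i j =
    v i - spoke_len A x i j *\<^sub>R (cis (\<theta> i) * cis (- s i * j * ang x (lab A i)))"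

text \<open>
  Let \<open>S = v m\<close> be the displacement along the first half. The second half is the image of the first
  half under \<open>z \<mapsto> S + cis (- p) * (S - z)\<close>, the rotation about \<open>S\<close> by \<open>N\<close> triangles, so the total
  displacement is \<open>(1 + cis (- p)) * S\<close> and has the direction of \<open>S * cis (- p / 2)\<close>. For a point \<open>z\<close> of the
  first half put \<open>Z = z * cnj S\<close>. The heights of \<open>z\<close> and of its image, in units of \<open>1 / norm S\<close>, are
  \<open>Im Z * cos (p / 2) + Re Z * sin (p / 2)\<close> and \<open>- Im Z * cos (p / 2) + Re Z * sin (p / 2)\<close>. If the path
  is placed at height \<open>c * sin (p / 2)\<close>, then \<open>z\<close> and its image are on the two correct sides if and only
  if \<open>Im Z * cos (p / 2)\<close> exceeds \<open>\<bar>Re Z - c\<bar> * sin (p / 2)\<close> in the prescribed direction. The vertices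
  \<open>0\<close> and \<open>S\<close> have \<open>Im Z = 0\<close>, and for them the condition is \<open>0 < c < norm S ^ 2\<close>.
\<close>

theorem doubled_word_tile:
  fixes A N m :: nat and s \<theta> :: "nat \<Rightarrow> real" and k :: "nat \<Rightarrow> nat" and v :: "nat \<Rightarrow> complex"
    and c p :: real
  assumes x: "x \<in> Delta" and A: "A \<in> {1, 2}" and m: "even m" "m > 0" and N: "even N" "N \<ge> 2"
    and p_def: "p = pi - N * ang x A" and p: "0 < p" "p < pi"
    and s: "\<And>i. 1 \<le> i \<Longrightarrow> i < m \<Longrightarrow> s i = 1 \<or> s i = -1"
    and k: "\<And>i. 1 \<le> i \<Longrightarrow> i < m \<Longrightarrow> even (k i) \<and> k i + 2 \<le> N"
    and \<theta>: "\<And>i. 1 \<le> i \<Longrightarrow> i < m \<Longrightarrow> \<theta> (Suc i) = \<theta> i + s i * (pi - (N - k i) * ang x (lab A i))"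
    and v: "v 0 = 0" "\<And>i. i < m \<Longrightarrow> v (Suc i) = v i + cis (\<theta> (Suc i))"
    and c: "0 < c" "c < norm (v m) ^ 2"
    and pivot: "\<And>i. 1 \<le> i \<Longrightarrow> i < m \<Longrightarrow>
      s i * Im (v i * cnj (v m)) * cos (p / 2) + \<bar>Re (v i * cnj (v m)) - c\<bar> * sin (p / 2) < 0"
    and spoke: "\<And>i j z. 1 \<le> i \<Longrightarrow> i < m \<Longrightarrow> 1 \<le> j \<Longrightarrow> j < N - k i \<Longrightarrow> z = spoke_end A x s \<theta> v i j \<Longrightarrow>
      s i * Im (z * cnj (v m)) * cos (p / 2) - \<bar>Re (z * cnj (v m)) - c\<bar> * sin (p / 2) > 0"
    and start_fan: "\<And>j. 1 \<le> j \<Longrightarrow> j < N \<Longrightarrow>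
      spoke_len A x 0 j * Im (cis (\<theta> 1) * cis (j * ang x A) * cnj (v m) * cis (p / 2)) > c * sin (p / 2)"
    and mid_fan: "\<And>j. 1 \<le> j \<Longrightarrow> j < N \<Longrightarrow>
      spoke_len A x 0 j * Im (cis (\<theta> m) * cis (j * ang x A) * cnj (v m) * cis (p / 2))
        > (norm (v m) ^ 2 - c) * sin (p / 2)"
  shows "x \<in> orbit_tile (doubled_word A N m s k)"
proof -
  define S where "S = v m"
  \<comment> \<open>Multiplication by this number makes the direction of the path real.\<close>
  define W where "W = cnj S * cis (p / 2)"
  have S0: "norm S > 0" using c unfolding S_def by (metis less_trans norm_ge_zero order_less_le power_zero_numeral zero_less_power2)
  have SS: "S * cnj S = complex_of_real (norm S ^ 2)" by (rule complex_norm_square[symmetric])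
  define \<theta>' where "\<theta>' i = (if i = 0 then \<theta> 1 - p else if i \<le> m then \<theta> i else \<theta> (2 * m + 1 - i) - p)" for i
  define v' where "v' i = (if i \<le> m then v i else S + cis (- p) * (S - v (2 * m - i)))" for i
  define \<omega> where "\<omega> i = cis (\<theta>' i) * W /\<^sub>R norm S" for i
  define h where "h i = (Im (v' i * W) - c * sin (p / 2)) / norm S" for i
  let ?s = "mirror_sign m s" and ?M = "mirror_fan N m k"
  have sp: "sin (p / 2) > 0" using p by (simp add: sin_gt_zero)
  have first: "Im (z * W) = Im (z * cnj S) * cos (p / 2) + Re (z * cnj S) * sin (p / 2)" for z
  proof -
    define Z where "Z = z * cnj S"
    have "z * W = Z * cis (p / 2)" by (simp add: W_def Z_def)
    then show ?thesis unfolding Z_def[symmetric] by simp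
  qed
  have second: "Im ((S + cis (- p) * (S - z)) * W) =
      - Im (z * cnj S) * cos (p / 2) + Re (z * cnj S) * sin (p / 2)" for z
  proof -
    define Z where "Z = z * cnj S"
    have c2: "cis (- p) * cis (p / 2) = cis (- (p / 2))" by (simp add: cis_mult)
    have "(S + cis (- p) * (S - z)) * W =
        S * cnj S * cis (p / 2) + (S * cnj S - Z) * (cis (- p) * cis (p / 2))"
      by (simp add: W_def Z_def algebra_simps)
    also have "\<dots> = norm S ^ 2 * (cis (p / 2) + cis (- (p / 2))) - Z * cis (- (p / 2))"
      unfolding c2 SS by (simp add: algebra_simps)
    finally show ?thesis unfolding Z_def[symmetric] by (simp add: of_real_power[symmetric] del: of_real_power)
  qed
  note times_complex.simps [simp del]
  have word: "doubled_word A N m s k = concat (map (\<lambda>i. fan_word A i (first_spoke m s i) (?M i)) [0..<2 * m])"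
    by (simp add: doubled_word_def)
  show ?thesis unfolding word
  proof (rule skeleton_orbit_tile[OF x A, where s = ?s and h = h and \<omega> = \<omega>])
    show "even (2 * m)" "0 < 2 * m" using m by auto
    show "?s (2 * m) = ?s 0" "?M (2 * m) = ?M 0" by (simp_all add: mirror_sign_def mirror_fan_def)
    show "first_spoke m s (2 * m) = first_spoke m s 0" using m
      by (simp add: first_spoke_def mirror_sign_def)
    show "first_spoke m s (Suc i) = (if ?s (Suc i) = ?s i then 1 else 0)" for i
      by (simp add: first_spoke_def)
    have lens: "i = 0 \<or> i = m \<or> i = 2 * m \<or> (1 \<le> i \<and> i < m) \<or> (1 \<le> 2 * m - i \<and> 2 * m - i < m \<and> m < i)"
      if "i \<le> 2 * m" for i using that by linarith
    show "even (?M i) \<and> 2 \<le> ?M i" if "i \<le> 2 * m" for i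
      using lens[OF that] k[of i] k[of "2 * m - i"] N by (auto simp: mirror_fan_def)
    show "?s i = 1 \<or> ?s i = -1" if "i \<le> 2 * m" for i
      using lens[OF that] s[of i] s[of "2 * m - i"] by (auto simp: mirror_sign_def)
    show "norm (\<omega> 0) = 1" using S0 by (simp add: \<omega>_def W_def norm_mult)
    show "\<omega> (2 * m) = \<omega> 0" using m by (simp add: \<omega>_def \<theta>'_def)
    have "v' (2 * m) = S + cis (- p) * (S - 0)" using m v by (simp add: v'_def)
    moreover have "Im ((S + cis (- p) * (S - 0)) * W) = 0" unfolding second by simp
    ultimately have "Im (v' (2 * m) * W) = 0" by simp
    then show "h (2 * m) = h 0" using v by (simp add: h_def v'_def)
    have \<theta>'_step: "\<theta>' (Suc i) = \<theta>' i + ?s i * (pi - ?M i * ang x (lab A i))" if i: "i < 2 * m" for i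
    proof -
      consider "i = 0" | "i = m" | "1 \<le> i" "i < m" | "m < i" "i < 2 * m" using i by linarith
      then show ?thesis
      proof cases
        case 1
        then show ?thesis using m p_def by (simp add: \<theta>'_def mirror_sign_def mirror_fan_def lab_def)
      next
        case 2
        then show ?thesis using m p_def
          by (simp add: \<theta>'_def mirror_sign_def mirror_fan_def lab_def)
      next
        case 3
        then show ?thesis using \<theta>[of i] k[of i] by (simp add: \<theta>'_def mirror_sign_def mirror_fan_def of_nat_diff)
      next
        case 4
        have "lab A (2 * m - i) = lab A i" using 4 by (simp add: lab_def)
        moreover have "2 * m + 1 - i = Suc (2 * m - i)" "2 * m + 1 - Suc i = 2 * m - i" using 4 by simp_all
        moreover have "1 \<le> 2 * m - i" "2 * m - i < m" using 4 by auto
        ultimately show ?thesis using 4 \<theta>[of "2 * m - i"] k[of "2 * m - i"]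
          by (simp add: \<theta>'_def mirror_sign_def mirror_fan_def of_nat_diff)
      qed
    qed
    show "\<omega> (Suc i) = - \<omega> i * cis (- ?s i * ?M i * ang x (lab A i))" if "i < 2 * m" for i
    proof -
      have "cis (\<theta>' (Suc i)) = cis (\<theta>' i) * cis (?s i * pi) * cis (- ?s i * ?M i * ang x (lab A i))"
        unfolding \<theta>'_step[OF that] by (simp add: cis_mult algebra_simps)
      moreover have "cis (?s i * pi) = -1"
        using \<open>\<And>i. i \<le> 2 * m \<Longrightarrow> ?s i = 1 \<or> ?s i = -1\<close>[of i] that by (auto simp: complex_eq_iff)
      ultimately show ?thesis by (simp add: \<omega>_def)
    qed
    have v'_step: "v' (Suc i) = v' i + cis (\<theta>' (Suc i))" if i: "i < 2 * m" for i
    proof (cases "i < m")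
      case True
      then show ?thesis using v by (simp add: v'_def \<theta>'_def)
    next
      case False
      define l where "l = 2 * m - Suc i"
      have l: "2 * m - i = Suc l" "2 * m + 1 - Suc i = Suc l" "l < m" using False i by (auto simp: l_def)
      have "v' i = S + cis (- p) * (S - v (Suc l))"
        using False l by (cases "i = m") (auto simp: v'_def S_def)
      then have vi: "v' i = S + cis (- p) * (S - v l - cis (\<theta> (Suc l)))" using v(2)[of l] l by simp
      have vS: "v' (Suc i) = S + cis (- p) * (S - v l)" using False by (simp add: v'_def l_def)
      have "\<theta>' (Suc i) = \<theta> (Suc l) - p" using False l by (simp add: \<theta>'_def)
      then have c: "cis (\<theta>' (Suc i)) = cis (- p) * cis (\<theta> (Suc l))" by (simp add: cis_mult)
      show ?thesis unfolding vi vS c by (simp add: algebra_simps)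
    qed
    show "h (Suc i) = h i + Im (\<omega> (Suc i))" if "i < 2 * m" for i
      unfolding h_def \<omega>_def v'_step[OF that] using S0 by (simp add: field_simps)
    have above: "Im (z * W) - c * sin (p / 2) > 0 \<and> Im ((S + cis (- p) * (S - z)) * W) - c * sin (p / 2) < 0"
      if "Im (z * cnj S) * cos (p / 2) - \<bar>Re (z * cnj S) - c\<bar> * sin (p / 2) > 0" for z
    proof -
      have "\<bar>(Re (z * cnj S) - c) * sin (p / 2)\<bar> = \<bar>Re (z * cnj S) - c\<bar> * sin (p / 2)"
        using sp by (simp add: abs_mult)
      then have "\<bar>Re (z * cnj S) * sin (p / 2) - c * sin (p / 2)\<bar> = \<bar>Re (z * cnj S) - c\<bar> * sin (p / 2)"
        by (simp add: left_diff_distrib)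
      with that first[of z] second[of z] show ?thesis by (intro conjI) linarith+
    qed
    have below: "Im (z * W) - c * sin (p / 2) < 0 \<and> Im ((S + cis (- p) * (S - z)) * W) - c * sin (p / 2) > 0"
      if "Im (z * cnj S) * cos (p / 2) + \<bar>Re (z * cnj S) - c\<bar> * sin (p / 2) < 0" for z
    proof -
      have "\<bar>(Re (z * cnj S) - c) * sin (p / 2)\<bar> = \<bar>Re (z * cnj S) - c\<bar> * sin (p / 2)"
        using sp by (simp add: abs_mult)
      then have "\<bar>Re (z * cnj S) * sin (p / 2) - c * sin (p / 2)\<bar> = \<bar>Re (z * cnj S) - c\<bar> * sin (p / 2)"
        by (simp add: left_diff_distrib)
      with that first[of z] second[of z] show ?thesis by (intro conjI) linarith+
    qed
    have sides: "s' * (Im (z * W) - c * sin (p / 2)) > 0"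
      "s' * (Im ((S + cis (- p) * (S - z)) * W) - c * sin (p / 2)) < 0"
      if "s' * Im (z * cnj S) * cos (p / 2) - \<bar>Re (z * cnj S) - c\<bar> * sin (p / 2) > 0"
        "s' = 1 \<or> s' = -1" for z s'
      using that above[of z] below[of z] by auto
    have SW: "Im (S * W) = norm S ^ 2 * sin (p / 2)" unfolding first SS by simp
    show "?s i * h i < 0" if i: "i < 2 * m" for i
    proof -
      have "?s i * (Im (v' i * W) - c * sin (p / 2)) < 0"
      proof -
        consider "i = 0" | "i = m" | "1 \<le> i" "i < m" | "m < i" "i < 2 * m" using i by linarith
        then show ?thesis
        proof cases
          case 1
          then show ?thesis using v c sp by (simp add: mirror_sign_def v'_def)
        next
          case 2
          then show ?thesis using m c sp SW by (simp add: mirror_sign_def v'_def S_def)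
        next
          case 3
          then show ?thesis using sides(1)[of "- s i" "v i"] pivot[OF 3] s[OF 3]
            by (auto simp: mirror_sign_def v'_def S_def)
        next
          case 4
          define l where "l = 2 * m - i"
          have l: "1 \<le> l" "l < m" using 4 by (auto simp: l_def)
          have "- s l * (Im ((S + cis (- p) * (S - v l)) * W) - c * sin (p / 2)) < 0"
            using pivot[OF l] s[OF l] by (intro sides(2)) (auto simp: S_def)
          then show ?thesis using 4 by (simp add: mirror_sign_def v'_def l_def)
        qed
      qed
      then show ?thesis using S0 by (simp add: h_def divide_less_0_iff zero_less_divide_iff mult_less_0_iff)
    qed
    show "?s i * (h i - spoke_len A x i j * Im (\<omega> i * cis (- ?s i * j * ang x (lab A i)))) > 0"
      if i: "i < 2 * m" and j: "1 \<le> j" "j < ?M i" for i j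
    proof -
      define y where "y = v' i - spoke_len A x i j *\<^sub>R (cis (\<theta>' i) * cis (- ?s i * j * ang x (lab A i)))"
      have "?s i * (Im (y * W) - c * sin (p / 2)) > 0"
      proof -
        consider "i = 0" | "i = m" | "1 \<le> i" "i < m" | "m < i" "i < 2 * m" using i by linarith
        then show ?thesis
        proof cases
          case 1
          have jN: "j < N" using 1 j by (simp add: mirror_fan_def)
          define a where "a = \<theta> 1 + (N - j) * ang x A"
          have "\<theta> 1 - p + - (j * ang x A) = a - pi"
            using jN by (simp add: p_def a_def of_nat_diff algebra_simps)
          then have "cis (\<theta> 1 - p) * cis (- (j * ang x A)) = cis (a - pi)" by (simp only: cis_mult)
          also have "\<dots> = - cis a" by (simp add: complex_eq_iff)
          also have "cis a = cis (\<theta> 1) * cis ((N - j) * ang x A)" by (simp add: cis_mult a_def)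
          finally have "cis (\<theta> 1 - p) * cis (- (j * ang x A)) = - (cis (\<theta> 1) * cis ((N - j) * ang x A))" .
          then have "y * W = spoke_len A x 0 j *\<^sub>R (cis (\<theta> 1) * cis ((N - j) * ang x A) * cnj S * cis (p / 2))"
            using 1 v by (simp add: y_def \<theta>'_def v'_def mirror_sign_def lab_def W_def mult.assoc)
          moreover have "spoke_len A x 0 j = spoke_len A x 0 (N - j)"
            using N jN by (simp add: spoke_len_def)
          ultimately have "Im (y * W) > c * sin (p / 2)"
            using start_fan[of "N - j"] jN j(1) by (simp add: S_def)
          then show ?thesis using 1 by (simp add: mirror_sign_def)
        next
          case 2
          have jN: "j < N" using 2 j m by (simp add: mirror_fan_def)
          have "spoke_len A x m j = spoke_len A x 0 j" using m by (simp add: spoke_len_def lab_def)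
          then have "Im (y * W) = Im (S * W) - spoke_len A x 0 j *
              Im (cis (\<theta> m) * cis (j * ang x A) * cnj S * cis (p / 2))"
            using 2 m by (simp add: y_def \<theta>'_def v'_def mirror_sign_def lab_def W_def S_def
                left_diff_distrib mult.assoc)
          then show ?thesis using 2 m mid_fan[OF j(1) jN] unfolding SW
            by (simp add: mirror_sign_def S_def algebra_simps)
        next
          case 3
          have "y = spoke_end A x s \<theta> v i j" using 3 by (simp add: y_def spoke_end_def \<theta>'_def v'_def mirror_sign_def)
          then show ?thesis using sides(1)[of "s i" y] spoke[OF 3 j(1)] s[OF 3] j(2) 3
            by (simp add: mirror_sign_def mirror_fan_def S_def)
        next
          case 4
          define l where "l = 2 * m - i"
          have l: "1 \<le> l" "l < m" using 4 by (auto simp: l_def)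
          \<comment> \<open>The image of a fan is traversed backwards, so its spokes are numbered from the other end.\<close>
          have jl: "1 \<le> N - k l - j" "N - k l - j < N - k l" "j < N - k l"
            using j 4 by (auto simp: mirror_fan_def l_def)
          have v'i: "v' i = S + cis (- p) * (S - v l)" using 4 by (simp add: v'_def l_def)
          have lab: "lab A i = lab A l" using 4 by (simp add: lab_def l_def)
          have len: "spoke_len A x i j = spoke_len A x l (N - k l - j)"
            using jl k[OF l] N by (simp add: spoke_len_def lab)
          have sl: "?s i = - s l" using 4 by (simp add: mirror_sign_def l_def)
          have "\<theta>' i = \<theta> (Suc l) - p" using 4 by (simp add: \<theta>'_def l_def Suc_diff_le)
          moreover have "real (N - k l) = real (N - k l - j) + real j" using jl by simp
          ultimately have "\<theta>' i + - ?s i * j * ang x (lab A i) =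
              - p + (\<theta> l + s l * pi + - s l * (N - k l - j) * ang x (lab A l))"
            unfolding sl lab \<theta>[OF l] by (simp add: algebra_simps)
          then have "cis (\<theta>' i) * cis (- ?s i * j * ang x (lab A i)) =
              cis (- p) * (cis (\<theta> l) * cis (s l * pi) * cis (- s l * (N - k l - j) * ang x (lab A l)))"
            by (simp only: cis_mult)
          also have "cis (s l * pi) = -1" using s[OF l] by (auto simp: complex_eq_iff)
          finally have "y = S + cis (- p) * (S - spoke_end A x s \<theta> v l (N - k l - j))"
            using len v'i by (simp add: y_def spoke_end_def algebra_simps scaleR_conv_of_real)
          then have "s l * (Im (y * W) - c * sin (p / 2)) < 0"
            using sides(2)[of "s l" "spoke_end A x s \<theta> v l (N - k l - j)"]
              spoke[OF l jl(1,2) refl] s[OF l] by (simp add: S_def)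
          then show ?thesis unfolding sl by simp
        qed
      qed
      moreover have "h i - spoke_len A x i j * Im (\<omega> i * cis (- ?s i * j * ang x (lab A i))) =
          (Im (y * W) - c * sin (p / 2)) / norm S"
      proof -
        have "y * W = v' i * W - spoke_len A x i j *\<^sub>R (cis (\<theta>' i) * W * cis (- ?s i * j * ang x (lab A i)))"
          by (simp add: y_def algebra_simps)
        moreover have "\<omega> i * cis (- ?s i * j * ang x (lab A i)) =
            (1 / norm S) *\<^sub>R (cis (\<theta>' i) * W * cis (- ?s i * j * ang x (lab A i)))"
          by (simp add: \<omega>_def divide_inverse)
        ultimately show ?thesis unfolding h_def by (simp add: diff_divide_distrib)
      qed
      ultimately show ?thesis using S0 by (simp only: times_divide_eq_right zero_less_divide_iff) simp
    qed
  qed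
qed

section \<open>Doubled skeletons near \<open>V\<^sub>n\<close>\<close>

text \<open>
  Points near \<open>V\<^sub>n\<close> are described by the defects \<open>E = (p, q)\<close> of the angles with labels \<open>A\<close> and \<open>3 - A\<close>, so
  that \<open>E = 0\<close> is \<open>V\<^sub>n\<close>. The skeleton starts at the origin, in the direction of the real axis.
\<close>

definition defect :: "real \<times> real \<Rightarrow> nat \<Rightarrow> real" where
  "defect E i = (if even i then fst E else snd E)"

definition alpha :: "nat \<Rightarrow> real \<times> real \<Rightarrow> nat \<Rightarrow> real" where
  "alpha n E i = (pi - defect E i) / (2 * real n)"

definition offset_point :: "nat \<Rightarrow> nat \<Rightarrow> real \<times> real \<Rightarrow> real \<times> real" where
  "offset_point A n E = (if A = 1 then (alpha n E 0, alpha n E 1) else (alpha n E 1, alpha n E 0))"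

text \<open>
  The turn at vertex \<open>l\<close> is \<open>pi\<close> minus the angle \<open>(2 * n - k l) * alpha n E l\<close> of the fan, rewritten
  with the defect.
\<close>

definition heading :: "nat \<Rightarrow> (nat \<Rightarrow> real) \<Rightarrow> (nat \<Rightarrow> nat) \<Rightarrow> real \<times> real \<Rightarrow> nat \<Rightarrow> real" where
  "heading n s k E i = (\<Sum>l = 1..<i. s l * (defect E l + k l * alpha n E l))"

definition vertex :: "nat \<Rightarrow> (nat \<Rightarrow> real) \<Rightarrow> (nat \<Rightarrow> nat) \<Rightarrow> real \<times> real \<Rightarrow> nat \<Rightarrow> complex" where
  "vertex n s k E i = (\<Sum>j = 1..i. cis (heading n s k E j))"

definition spoke_radius :: "nat \<Rightarrow> real \<times> real \<Rightarrow> nat \<Rightarrow> nat \<Rightarrow> real" where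
  "spoke_radius n E i j =
     (if even j then 1 else sin (alpha n E (Suc i)) / sin (pi - alpha n E 0 - alpha n E 1))"

definition spoke_tip ::
  "nat \<Rightarrow> (nat \<Rightarrow> real) \<Rightarrow> (nat \<Rightarrow> nat) \<Rightarrow> real \<times> real \<Rightarrow> nat \<Rightarrow> nat \<Rightarrow> complex" where
  "spoke_tip n s k E i j = vertex n s k E i -
     spoke_radius n E i j *\<^sub>R (cis (heading n s k E i) * cis (- s i * j * alpha n E i))"

lemma ang_offset_point: "A \<in> {1, 2} \<Longrightarrow> ang (offset_point A n E) (lab A i) = alpha n E i"
  by (auto simp: ang_def offset_point_def lab_def alpha_def defect_def)

lemma spoke_len_offset_point:
  assumes "A \<in> {1, 2}"
  shows "spoke_len A (offset_point A n E) i j = spoke_radius n E i j"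
proof -
  have "3 - lab A i = lab A (Suc i)" using assms by (auto simp: lab_def)
  moreover have "ang (offset_point A n E) 3 = pi - alpha n E 0 - alpha n E 1"
    by (simp add: ang_def offset_point_def)
  ultimately show ?thesis
    using ang_offset_point[OF assms]
    by (simp add: spoke_len_def spoke_radius_def side_len_def)
qed

lemma eventually_pos_nhds:
  fixes f :: "'a::t2_space \<Rightarrow> real"
  assumes "isCont f a" "f a > 0"
  shows "\<forall>\<^sub>F x in nhds a. f x > 0"
  using assms order_tendstoD(1)[of f "f a" "at a" 0]
  by (simp add: isCont_def eventually_nhds_conv_at)

lemma alpha_0: "alpha n 0 i = pi / (2 * n)"
  by (simp add: alpha_def defect_def)

context
  fixes n :: nat
  assumes n: "n \<ge> 3"
begin

lemma sin_sum_alpha_0: "sin (pi - alpha n 0 i - alpha n 0 j) > 0"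
proof (rule sin_gt_zero)
  have "pi / (2 * n) \<le> pi / 4" using n by (intro divide_left_mono) auto
  then show "0 < pi - alpha n 0 i - alpha n 0 j" unfolding alpha_0 using pi_gt_zero by linarith
  show "pi - alpha n 0 i - alpha n 0 j < pi" unfolding alpha_0 using n by simp
qed

lemma isCont_defect [continuous_intros]: "isCont (\<lambda>E. defect E i) E"
  by (cases "even i") (auto simp: defect_def intro!: continuous_intros)

lemma isCont_alpha [continuous_intros]: "isCont (\<lambda>E. alpha n E i) E"
  using n unfolding alpha_def by (intro continuous_intros) auto

lemma isCont_heading [continuous_intros]: "isCont (\<lambda>E. heading n s k E i) E"
  unfolding heading_def by (intro continuous_intros)

lemma isCont_cis_comp [continuous_intros]:
  fixes f :: "'a::t2_space \<Rightarrow> real" shows "isCont f a \<Longrightarrow> isCont (\<lambda>x. cis (f x)) a"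
  unfolding isCont_def by (rule tendsto_cis)

lemma isCont_vertex [continuous_intros]: "isCont (\<lambda>E. vertex n s k E i) E"
  unfolding vertex_def by (intro continuous_intros)

lemma isCont_spoke_radius [continuous_intros]: "isCont (\<lambda>E. spoke_radius n E i j) 0"
  using sin_sum_alpha_0[of 0 1] unfolding spoke_radius_def
  by (cases "even j") (auto intro!: continuous_intros)

lemma isCont_spoke_tip [continuous_intros]: "isCont (\<lambda>E. spoke_tip n s k E i j) 0"
  unfolding spoke_tip_def by (intro continuous_intros)

text \<open>
  At \<open>E = 0\<close> the terms with \<open>sin (p / 2)\<close> vanish, so there each condition on the two full fans reduces
  to an inequality between heights. These are strict, hence persist near \<open>V\<^sub>n\<close> by continuity. The
  conditions on the other fans are left as germs in a region \<open>R\<close>, because at \<open>V\<^sub>n\<close> some of them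
  hold only with equality.
\<close>

theorem doubled_word_germ:
  fixes A m :: nat and s :: "nat \<Rightarrow> real" and k :: "nat \<Rightarrow> nat" and c :: real
    and R :: "real \<times> real \<Rightarrow> bool"
  assumes A: "A \<in> {1, 2}" and m: "even m" "m > 0"
    and s: "\<And>i. 1 \<le> i \<Longrightarrow> i < m \<Longrightarrow> s i = 1 \<or> s i = -1"
    and k: "\<And>i. 1 \<le> i \<Longrightarrow> i < m \<Longrightarrow> even (k i) \<and> k i + 2 \<le> 2 * n"
    and c: "0 < c" "c < norm (vertex n s k 0 m) ^ 2"
    and R: "\<And>E. R E \<Longrightarrow> fst E > 0"
    and pivot: "\<And>i. 1 \<le> i \<Longrightarrow> i < m \<Longrightarrow> \<forall>\<^sub>F E in nhds 0. R E \<longrightarrow>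
      s i * Im (vertex n s k E i * cnj (vertex n s k E m)) * cos (fst E / 2) +
      \<bar>Re (vertex n s k E i * cnj (vertex n s k E m)) - c\<bar> * sin (fst E / 2) < 0"
    and spoke: "\<And>i j. 1 \<le> i \<Longrightarrow> i < m \<Longrightarrow> 1 \<le> j \<Longrightarrow> j < 2 * n - k i \<Longrightarrow> \<forall>\<^sub>F E in nhds 0. R E \<longrightarrow>
      s i * Im (spoke_tip n s k E i j * cnj (vertex n s k E m)) * cos (fst E / 2) -
      \<bar>Re (spoke_tip n s k E i j * cnj (vertex n s k E m)) - c\<bar> * sin (fst E / 2) > 0"
    and fan: "\<And>j. 1 \<le> j \<Longrightarrow> j < 2 * n \<Longrightarrow> Im (cis (j * (pi / (2 * n))) * cnj (vertex n s k 0 m)) > 0"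
    and last: "cis (heading n s k 0 m) = 1"
  shows "\<forall>\<^sub>F E in nhds 0. R E \<longrightarrow> offset_point A n E \<in> orbit_tile (doubled_word A (2 * n) m s k)"
proof -
  have Delta: "\<forall>\<^sub>F E in nhds 0. offset_point A n E \<in> Delta"
  proof -
    have "\<forall>\<^sub>F E in nhds 0. alpha n E i > 0" for i
      by (rule eventually_pos_nhds) (use n in \<open>auto simp: alpha_0 intro!: continuous_intros\<close>)
    moreover have "\<forall>\<^sub>F E in nhds 0. pi / 2 - alpha n E 0 - alpha n E 1 > 0"
    proof (rule eventually_pos_nhds)
      have "pi / (2 * n) < pi / 4" using n by (intro divide_strict_left_mono) auto
      then show "pi / 2 - alpha n 0 0 - alpha n 0 1 > 0" unfolding alpha_0 by linarith
    qed (intro continuous_intros)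
    ultimately have "\<forall>\<^sub>F E in nhds 0. alpha n E 0 > 0 \<and> alpha n E 1 > 0 \<and> pi / 2 - alpha n E 0 - alpha n E 1 > 0"
      by (intro eventually_conj)
    then show ?thesis by eventually_elim (simp add: Delta_def offset_point_def)
  qed
  have p: "\<forall>\<^sub>F E :: real \<times> real in nhds 0. pi - fst E > 0"
    by (rule eventually_pos_nhds) (auto intro!: continuous_intros)
  have c': "\<forall>\<^sub>F E in nhds 0. norm (vertex n s k E m) ^ 2 - c > 0"
    by (rule eventually_pos_nhds) (use c in \<open>auto intro!: continuous_intros\<close>)
  have radius: "spoke_radius n 0 0 j > 0" for j
    using sin_sum_alpha_0[of 0 1] sin_sum_alpha_0 n unfolding spoke_radius_def
    by (auto simp: alpha_0 field_simps intro!: divide_pos_pos sin_gt_zero)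
  have fan_start: "\<forall>\<^sub>F E in nhds 0. spoke_radius n E 0 j * Im (cis (heading n s k E 1) *
      cis (j * alpha n E 0) * cnj (vertex n s k E m) * cis (fst E / 2)) - c * sin (fst E / 2) > 0"
    if "1 \<le> j" "j < 2 * n" for j
  proof (rule eventually_pos_nhds)
    have "heading n s k 0 1 = 0" by (simp add: heading_def)
    then show "spoke_radius n 0 0 j * Im (cis (heading n s k 0 1) * cis (j * alpha n 0 0) *
        cnj (vertex n s k 0 m) * cis (fst 0 / 2)) - c * sin (fst 0 / 2) > 0"
      using fan[OF that] radius[of j] by (simp add: alpha_0)
  qed (intro continuous_intros isCont_Im isCont_cnj; simp)
  have fan_mid: "\<forall>\<^sub>F E in nhds 0. spoke_radius n E 0 j * Im (cis (heading n s k E m) *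
      cis (j * alpha n E 0) * cnj (vertex n s k E m) * cis (fst E / 2)) -
      (norm (vertex n s k E m) ^ 2 - c) * sin (fst E / 2) > 0"
    if "1 \<le> j" "j < 2 * n" for j
  proof (rule eventually_pos_nhds)
    show "spoke_radius n 0 0 j * Im (cis (heading n s k 0 m) * cis (j * alpha n 0 0) *
        cnj (vertex n s k 0 m) * cis (fst 0 / 2)) - (norm (vertex n s k 0 m) ^ 2 - c) * sin (fst 0 / 2) > 0"
      using fan[OF that] radius[of j] by (simp add: last alpha_0)
  qed (intro continuous_intros isCont_Im isCont_cnj; simp)
  have "\<forall>\<^sub>F E in nhds 0. \<forall>i\<in>{1..<m}. R E \<longrightarrow>
      s i * Im (vertex n s k E i * cnj (vertex n s k E m)) * cos (fst E / 2) +
      \<bar>Re (vertex n s k E i * cnj (vertex n s k E m)) - c\<bar> * sin (fst E / 2) < 0"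
    using pivot by (intro eventually_ball_finite) auto
  moreover have "\<forall>\<^sub>F E in nhds 0. \<forall>i\<in>{1..<m}. \<forall>j\<in>{1..<2 * n - k i}. R E \<longrightarrow>
      s i * Im (spoke_tip n s k E i j * cnj (vertex n s k E m)) * cos (fst E / 2) -
      \<bar>Re (spoke_tip n s k E i j * cnj (vertex n s k E m)) - c\<bar> * sin (fst E / 2) > 0"
    using spoke by (intro eventually_ball_finite ballI) auto
  moreover have "\<forall>\<^sub>F E in nhds 0. \<forall>j\<in>{1..<2 * n}. spoke_radius n E 0 j * Im (cis (heading n s k E 1) *
      cis (j * alpha n E 0) * cnj (vertex n s k E m) * cis (fst E / 2)) - c * sin (fst E / 2) > 0"
    using fan_start by (intro eventually_ball_finite) auto
  moreover have "\<forall>\<^sub>F E in nhds 0. \<forall>j\<in>{1..<2 * n}. spoke_radius n E 0 j * Im (cis (heading n s k E m) *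
      cis (j * alpha n E 0) * cnj (vertex n s k E m) * cis (fst E / 2)) -
      (norm (vertex n s k E m) ^ 2 - c) * sin (fst E / 2) > 0"
    using fan_mid by (intro eventually_ball_finite) auto
  ultimately show ?thesis using Delta p c'
  proof eventually_elim
    case (elim E)
    show ?case
    proof
      assume "R E"
      have A0: "lab A 0 = A" by (simp add: lab_def)
      note ang = ang_offset_point[OF A, of n E]
      have ang0: "ang (offset_point A n E) A = alpha n E 0" using ang[of 0] by (simp add: A0)
      have tip: "spoke_end A (offset_point A n E) s (heading n s k E) (vertex n s k E) i j = spoke_tip n s k E i j" for i j
        by (simp add: spoke_end_def spoke_tip_def ang spoke_len_offset_point[OF A])
      show "offset_point A n E \<in> orbit_tile (doubled_word A (2 * n) m s k)"
      proof (rule doubled_word_tile[where p = "fst E" and c = c and \<theta> = "heading n s k E" and v = "vertex n s k E"])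
        show "fst E = pi - real (2 * n) * ang (offset_point A n E) A"
          using n by (simp add: ang0 alpha_def defect_def)
        show "heading n s k E (Suc i) = heading n s k E i +
            s i * (pi - real (2 * n - k i) * ang (offset_point A n E) (lab A i))" if "1 \<le> i" "i < m" for i
          using that k[OF that] n by (simp add: ang heading_def alpha_def of_nat_diff field_simps)
        show "vertex n s k E (Suc i) = vertex n s k E i + cis (heading n s k E (Suc i))" for i
          by (simp add: vertex_def)
        show "s i * Im (z * cnj (vertex n s k E m)) * cos (fst E / 2) -
           \<bar>Re (z * cnj (vertex n s k E m)) - c\<bar> * sin (fst E / 2) > 0"
          if "1 \<le> i" "i < m" "1 \<le> j" "j < 2 * n - k i"
            "z = spoke_end A (offset_point A n E) s (heading n s k E) (vertex n s k E) i j" for i j z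
          using elim(2) \<open>R E\<close> that(1-4) unfolding that(5) tip by (metis atLeastLessThan_iff)
        show "spoke_len A (offset_point A n E) 0 j * Im (cis (heading n s k E 1) * cis (j * ang (offset_point A n E) A) *
            cnj (vertex n s k E m) * cis (fst E / 2)) > c * sin (fst E / 2)" if "1 \<le> j" "j < 2 * n" for j
          using elim(3) that unfolding ang0 spoke_len_offset_point[OF A] by (metis atLeastLessThan_iff diff_gt_0_iff_gt)
        show "spoke_len A (offset_point A n E) 0 j * Im (cis (heading n s k E m) * cis (j * ang (offset_point A n E) A) *
            cnj (vertex n s k E m) * cis (fst E / 2)) > (norm (vertex n s k E m) ^ 2 - c) * sin (fst E / 2)"
          if "1 \<le> j" "j < 2 * n" for j
          using elim(4) that unfolding ang0 spoke_len_offset_point[OF A] by (metis atLeastLessThan_iff diff_gt_0_iff_gt)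
        show "s i * Im (vertex n s k E i * cnj (vertex n s k E m)) * cos (fst E / 2) +
            \<bar>Re (vertex n s k E i * cnj (vertex n s k E m)) - c\<bar> * sin (fst E / 2) < 0" if "1 \<le> i" "i < m" for i
          using elim(1) \<open>R E\<close> that by (metis atLeastLessThan_iff)
        show "vertex n s k E 0 = 0" by (simp add: vertex_def)
        show "2 \<le> 2 * n" "even (2 * n)" using n by auto
        show "fst E < pi" "c < norm (vertex n s k E m) ^ 2" using elim by auto
      qed (fact elim A m s k c R[OF \<open>R E\<close>])+
    qed
  qed
qed

end

section \<open>Strict and degenerate conditions\<close>

text \<open>
  Along an arc shorter than a half-turn, the height of a point on a circle is smallest at the ends. The
  proof weights the end points by \<open>sin B\<close> and \<open>sin A\<close>, whose sum exceeds \<open>sin (A + B)\<close>.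
\<close>

lemma sine_on_arc:
  fixes Y :: complex
  assumes y: "a < y" "y < b" "b - a < pi" and \<mu>: "0 < \<mu>" "\<mu> \<le> Im (Y * cis a)" "\<mu> \<le> Im (Y * cis b)"
  shows "\<mu> < Im (Y * cis y)"
proof -
  define A B where "A = y - a" and "B = b - y"
  have pos: "sin A > 0" "sin B > 0" "sin (A + B) > 0"
    using y by (auto simp: A_def B_def intro!: sin_gt_zero)
  have "cos A < 1" "cos B < 1"
    using y cos_monotone_0_pi[of 0 A] cos_monotone_0_pi[of 0 B] by (auto simp: A_def B_def)
  then have "sin A * cos B + cos A * sin B < sin A * 1 + 1 * sin B"
    using pos by (intro add_strict_mono) auto
  then have sum: "sin (A + B) < sin A + sin B" by (simp add: sin_add)
  have "sin (A + B) * Im (Y * cis y) = sin B * Im (Y * cis (y - A)) + sin A * Im (Y * cis (y + B))"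
    by (simp add: sin_add cos_add sin_diff cos_diff algebra_simps)
  then have "sin (A + B) * Im (Y * cis y) = sin B * Im (Y * cis a) + sin A * Im (Y * cis b)"
    by (simp add: A_def B_def)
  moreover have "\<mu> * (sin B + sin A) \<le> sin B * Im (Y * cis a) + sin A * Im (Y * cis b)"
    using mult_left_mono[OF \<mu>(2) less_imp_le[OF pos(2)]] mult_left_mono[OF \<mu>(3) less_imp_le[OF pos(1)]]
    unfolding distrib_left mult.commute[of \<mu>] by linarith
  moreover have "\<mu> * sin (A + B) < \<mu> * (sin B + sin A)" using sum \<mu>(1) by simp
  ultimately have "\<mu> * sin (A + B) < Im (Y * cis y) * sin (A + B)" by (simp add: mult.commute)
  then show ?thesis using pos(3) by simp
qed

text \<open>
  On the region, the linear part is at least a positive multiple of the norm, which beats the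
  remainder.
\<close>

lemma half_quadrant_germ:
  fixes f :: "real \<times> real \<Rightarrow> real"
  assumes f: "(f has_derivative (\<lambda>h. a * fst h + b * snd h)) (at 0)" "f 0 = 0"
    and ab: "a > 0" "b < 0"
  shows "\<forall>\<^sub>F E in nhds 0. 0 < fst E \<and> snd E \<le> 0 \<longrightarrow> f E > 0"
proof -
  define e where "e = min a (- b) / 2"
  have e: "e > 0" "e < a" "e < - b" using ab by (auto simp: e_def)
  then obtain d where d: "d > 0" "\<And>E. norm E < d \<Longrightarrow> \<bar>f E - (a * fst E + b * snd E)\<bar> \<le> e * norm E"
    using f unfolding has_derivative_at_alt by force
  have "f E > 0" if E: "dist E 0 < d" "0 < fst E" "snd E \<le> 0" for E
  proof -
    have "norm E \<le> fst E - snd E"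
      using norm_Pair_le[of "fst E" "snd E"] E by simp
    then have "e * norm E \<le> e * (fst E - snd E)" using e by simp
    moreover have "e * fst E < a * fst E" using e E by simp
    moreover have "e * - snd E \<le> - b * - snd E" using e E by (intro mult_right_mono) auto
    ultimately show ?thesis using d(2)[of E] E(1) by (simp add: right_diff_distrib abs_le_iff)
  qed
  then show ?thesis using d(1) by (auto simp: eventually_nhds_metric)
qed

text \<open>
  The condition for a point that lies on the path at \<open>V\<^sub>n\<close>, in the form of \<open>doubled_word_tile\<close>. The
  absolute value is replaced by both signs, and each of the two functions has a gradient to which
  \<open>half_quadrant_germ\<close> applies; \<open>sin (fst E / 2)\<close> contributes one half to the derivative.
\<close>

lemma degenerate_germ:
  fixes Z :: "real \<times> real \<Rightarrow> complex"
  assumes Z: "(Z has_derivative Z') (at 0)" "Im (Z 0) = 0" "\<And>h. Im (Z' h) = a * fst h + b * snd h"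
    and b: "b > 0" and a: "2 * a + \<bar>Re (Z 0) - c\<bar> < 0"
  shows "\<forall>\<^sub>F E in nhds 0. 0 < fst E \<and> snd E \<le> 0 \<longrightarrow>
    -1 * Im (Z E) * cos (fst E / 2) - \<bar>Re (Z E) - c\<bar> * sin (fst E / 2) > 0"
proof -
  have one: "\<forall>\<^sub>F E in nhds 0. 0 < fst E \<and> snd E \<le> 0 \<longrightarrow>
      - Im (Z E) * cos (fst E / 2) - \<sigma> * (Re (Z E) - c) * sin (fst E / 2) > 0"
    if \<sigma>: "\<bar>\<sigma>\<bar> = 1" for \<sigma> :: real
  proof (rule half_quadrant_germ[where a = "- a - \<sigma> * (Re (Z 0) - c) / 2" and b = "- b"])
    show "((\<lambda>E. - Im (Z E) * cos (fst E / 2) - \<sigma> * (Re (Z E) - c) * sin (fst E / 2)) has_derivative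
        (\<lambda>h. (- a - \<sigma> * (Re (Z 0) - c) / 2) * fst h + - b * snd h)) (at 0)"
      using Z(2,3) by (auto intro!: derivative_eq_intros Z(1) simp: fun_eq_iff field_simps)
    have "\<bar>\<sigma> * (Re (Z 0) - c)\<bar> = \<bar>Re (Z 0) - c\<bar>" using \<sigma> by (simp add: abs_mult)
    then show "- a - \<sigma> * (Re (Z 0) - c) / 2 > 0" using a by linarith
  qed (use Z(2) b in auto)
  show ?thesis using one[of 1, simplified] one[of "-1", simplified]
  proof eventually_elim
    case (elim E)
    then show ?case by (auto simp: abs_if left_diff_distrib)
  qed
qed

context
  fixes n :: nat
  assumes n: "n \<ge> 3"
begin

lemma spoke_radius_0: "spoke_radius n 0 i j = (if even j then 1 else 1 / (2 * cos (pi / (2 * n))))"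
proof -
  have x: "0 < pi / (2 * n)" "pi / (2 * n) < pi" using n by (auto simp: field_simps)
  have "sin (pi - pi / (2 * n) - pi / (2 * n)) = sin (2 * (pi / (2 * n)))"
    using sin_pi_minus[of "2 * (pi / (2 * n))"] by (simp add: algebra_simps)
  also have "\<dots> = 2 * sin (pi / (2 * n)) * cos (pi / (2 * n))" by (rule sin_double)
  finally show ?thesis using sin_gt_zero[OF x] by (simp add: spoke_radius_def alpha_0)
qed

lemma half_less_cos: "1 / 2 < cos (pi / (2 * n))"
proof -
  have "pi / (2 * n) < pi / 3" using n by (intro divide_strict_left_mono) auto
  then have "cos (pi / 3) < cos (pi / (2 * n))" using n by (intro cos_monotone_0_pi) auto
  then show ?thesis by (simp add: cos_60)
qed

text \<open>
  At \<open>V\<^sub>n\<close> only the first and the last inner spoke of a fan need to be inspected. Both are short; by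
  \<open>sine_on_arc\<close> the spokes between them point higher, and a long spoke is longer than a short one since
  \<open>2 * cos (pi / (2 * n)) > 1\<close>.
\<close>

lemma inner_spokes:
  fixes S :: complex and s :: "nat \<Rightarrow> real"
  assumes si: "s i = 1 \<or> s i = -1" and M: "even M" "M \<le> 2 * n" and j: "1 < j" "j < M - 1"
    and v: "s i * Im (vertex n s k 0 i * cnj S) < 0"
    and ends: "s i * Im (spoke_tip n s k 0 i 1 * cnj S) \<ge> 0"
      "s i * Im (spoke_tip n s k 0 i (M - 1) * cnj S) \<ge> 0"
  shows "s i * Im (spoke_tip n s k 0 i j * cnj S) > 0"
proof -
  define x where "x = pi / (2 * n)"
  define \<rho> where "\<rho> = 1 / (2 * cos x)"
  define Y where "Y = - complex_of_real (s i) * cis (heading n s k 0 i) * cnj S"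
  define H where "H = - (s i * Im (vertex n s k 0 i * cnj S))"
  have \<rho>: "0 < \<rho>" "\<rho> < 1" using half_less_cos by (auto simp: \<rho>_def x_def)
  have H: "H > 0" using v by (simp add: H_def)
  have tip: "s i * Im (spoke_tip n s k 0 i l * cnj S) =
      spoke_radius n 0 i l * Im (Y * cis (- s i * l * x)) - H" for l
    by (simp add: spoke_tip_def Y_def H_def alpha_0 x_def algebra_simps)
  have M1: "odd (M - 1)" using M j by auto
  have rad: "spoke_radius n 0 i 1 = \<rho>" "spoke_radius n 0 i (M - 1) = \<rho>"
    using M1 by (simp_all add: spoke_radius_0 \<rho>_def x_def)
  have lo: "H / \<rho> \<le> Im (Y * cis (- s i * 1 * x))"
    using ends(1) \<rho>(1) unfolding tip rad by (subst pos_divide_le_eq) (simp_all add: mult.commute)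
  have hi: "H / \<rho> \<le> Im (Y * cis (- s i * (M - 1) * x))"
    using ends(2) \<rho>(1) unfolding tip rad by (subst pos_divide_le_eq) (simp_all add: mult.commute)
  have x: "x > 0" using n by (simp add: x_def)
  have "(real (M - 1) - 1) * x < 2 * n * x" using M j x by (intro mult_strict_right_mono) auto
  then have len: "(real (M - 1) - 1) * x < pi" using n by (simp add: x_def)
  have jM: "real 1 * x < j * x" "j * x < real (M - 1) * x" using j x by (auto simp del: of_nat_diff)
  have mid: "H / \<rho> < Im (Y * cis (- s i * j * x))"
    using si
  proof
    assume "s i = 1"
    then show ?thesis using sine_on_arc[of "- (M - 1) * x" "- j * x" "- 1 * x" "H / \<rho>" Y] lo hi len jM H \<rho>
      by (simp add: algebra_simps)
  next
    assume "s i = -1"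
    then show ?thesis using sine_on_arc[of "1 * x" "j * x" "(M - 1) * x" "H / \<rho>" Y] lo hi len jM H \<rho>
      by (simp add: algebra_simps)
  qed
  have "H / \<rho> > 0" using H \<rho> by simp
  then have "\<rho> * (H / \<rho>) < spoke_radius n 0 i j * Im (Y * cis (- s i * j * x))"
    using mid \<rho> by (intro mult_le_less_imp_less) (auto simp: spoke_radius_0 \<rho>_def x_def)
  then show ?thesis using \<rho> unfolding tip by simp
qed

lemma strict_pivot_germ:
  assumes "s i * Im (vertex n s k 0 i * cnj (vertex n s k 0 m)) < 0"
  shows "\<forall>\<^sub>F E in nhds 0. s i * Im (vertex n s k E i * cnj (vertex n s k E m)) * cos (fst E / 2) +
      \<bar>Re (vertex n s k E i * cnj (vertex n s k E m)) - c\<bar> * sin (fst E / 2) < 0"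
proof -
  have "\<forall>\<^sub>F E in nhds 0. - (s i * Im (vertex n s k E i * cnj (vertex n s k E m)) * cos (fst E / 2) +
      \<bar>Re (vertex n s k E i * cnj (vertex n s k E m)) - c\<bar> * sin (fst E / 2)) > 0"
  proof (rule eventually_pos_nhds)
    show "isCont (\<lambda>E. - (s i * Im (vertex n s k E i * cnj (vertex n s k E m)) * cos (fst E / 2) +
      \<bar>Re (vertex n s k E i * cnj (vertex n s k E m)) - c\<bar> * sin (fst E / 2))) 0"
      by (intro continuous_intros isCont_Im isCont_Re isCont_cnj isCont_vertex n; (rule n | simp))
  qed (use assms in simp)
  then show ?thesis by eventually_elim linarith
qed

lemma strict_spoke_germ:
  assumes "s i * Im (spoke_tip n s k 0 i j * cnj (vertex n s k 0 m)) > 0"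
  shows "\<forall>\<^sub>F E in nhds 0. s i * Im (spoke_tip n s k E i j * cnj (vertex n s k E m)) * cos (fst E / 2) -
      \<bar>Re (spoke_tip n s k E i j * cnj (vertex n s k E m)) - c\<bar> * sin (fst E / 2) > 0"
proof (rule eventually_pos_nhds)
  show "isCont (\<lambda>E. s i * Im (spoke_tip n s k E i j * cnj (vertex n s k E m)) * cos (fst E / 2) -
      \<bar>Re (spoke_tip n s k E i j * cnj (vertex n s k E m)) - c\<bar> * sin (fst E / 2)) 0"
    by (intro continuous_intros isCont_Im isCont_Re isCont_cnj isCont_vertex isCont_spoke_tip; (rule n | simp))
qed (use assms in simp)

section \<open>Both angles smaller than \<open>pi / (2 * n)\<close>\<close>

text \<open>
  The half skeleton has two edges, with directions \<open>1\<close> and \<open>cis (- q)\<close>, and \<open>S = 1 + cis (- q)\<close>. Its middle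
  vertex has to be above the path, but has height zero at \<open>V\<^sub>n\<close>. For it \<open>Z = 1 + cis q\<close>, so with \<open>c = 2\<close> the
  condition is \<open>sin q * cos (p / 2) > (1 - cos q) * sin (p / 2)\<close>, where \<open>1 - cos q \<le> sin q\<close>.
\<close>

lemma word_A_germ:
  "\<forall>\<^sub>F E in nhds 0. 0 < fst E \<and> 0 < snd E \<longrightarrow>
    offset_point 1 n E \<in> orbit_tile (doubled_word 1 (2 * n) 2 (\<lambda>_. -1) (\<lambda>_. 0))"
proof -
  let ?s = "\<lambda>_ :: nat. - 1 :: real" and ?k = "\<lambda>_ :: nat. 0 :: nat"
  define x where "x = pi / (2 * n)"
  have v1: "vertex n ?s ?k E 1 = 1" for E by (simp add: vertex_def heading_def)
  have v2: "vertex n ?s ?k E 2 = 1 + cis (- snd E)" for E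
    by (simp add: vertex_def heading_def defect_def numeral_2_eq_2)
  show ?thesis
  proof (rule doubled_word_germ[OF n, where R = "\<lambda>E. 0 < fst E \<and> 0 < snd E" and c = 2])
    show "2 < norm (vertex n ?s ?k 0 2) ^ 2" by (simp add: v2)
    show "Im (cis (j * (pi / (2 * n))) * cnj (vertex n ?s ?k 0 2)) > 0" if "1 \<le> j" "j < 2 * n" for j
      using that n by (simp add: v2 sin_gt_zero field_simps)
    show "cis (heading n ?s ?k 0 2) = 1" by (simp add: heading_def defect_def numeral_2_eq_2)
    show "\<forall>\<^sub>F E in nhds 0. 0 < fst E \<and> 0 < snd E \<longrightarrow>
        ?s i * Im (vertex n ?s ?k E i * cnj (vertex n ?s ?k E 2)) * cos (fst E / 2) +
        \<bar>Re (vertex n ?s ?k E i * cnj (vertex n ?s ?k E 2)) - 2\<bar> * sin (fst E / 2) < 0"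
      if "1 \<le> i" "i < 2" for i
    proof -
      have i: "i = 1" using that by simp
      have "\<forall>\<^sub>F E :: real \<times> real in nhds 0. dist E 0 < 1"
        by (auto simp: eventually_nhds_metric intro!: exI[of _ 1])
      then show ?thesis unfolding i v1 v2
      proof eventually_elim
        case (elim E)
        show ?case
        proof
          assume E: "0 < fst E \<and> 0 < snd E"
          have small: "fst E < 1" "snd E < 1"
            using elim norm_fst_le[of "fst E" "snd E"] norm_snd_le[of "snd E" "fst E"] by auto
          have pi: "pi > 3" by (rule pi_gt3)
          have s: "sin (fst E / 2) > 0" "sin (snd E) > 0" "cos (snd E) > 0"
            using E small pi by (auto intro!: sin_gt_zero cos_gt_zero)
          have "sin (fst E / 2) < cos (fst E / 2)"
          proof -
            have "cos (pi / 2 - fst E / 2) < cos (fst E / 2)"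
              using E small pi by (intro cos_monotone_0_pi) auto
            then show ?thesis by (simp add: cos_sin_eq[symmetric] sin_cos_eq)
          qed
          moreover have "1 - cos (snd E) \<le> sin (snd E)"
          proof -
            have "1 \<le> (sin (snd E) + cos (snd E))\<^sup>2"
              using s sin_cos_squared_add[of "snd E"] by (simp add: power2_sum)
            then show ?thesis using s by (smt (verit) power2_le_imp_le power_one)
          qed
          ultimately have "(1 - cos (snd E)) * sin (fst E / 2) < sin (snd E) * cos (fst E / 2)"
            using s by (intro order_le_less_trans[OF mult_right_mono mult_strict_left_mono]) auto
          then show "- 1 * Im (1 * cnj (1 + cis (- snd E))) * cos (fst E / 2) +
              \<bar>Re (1 * cnj (1 + cis (- snd E))) - 2\<bar> * sin (fst E / 2) < 0"
            using cos_le_one[of "snd E"] by (simp add: abs_of_nonpos)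
        qed
      qed
    qed
    show "\<forall>\<^sub>F E in nhds 0. 0 < fst E \<and> 0 < snd E \<longrightarrow>
        ?s i * Im (spoke_tip n ?s ?k E i j * cnj (vertex n ?s ?k E 2)) * cos (fst E / 2) -
        \<bar>Re (spoke_tip n ?s ?k E i j * cnj (vertex n ?s ?k E 2)) - 2\<bar> * sin (fst E / 2) > 0"
      if "1 \<le> i" "i < 2" "1 \<le> j" "j < 2 * n - ?k i" for i j
    proof -
      have i: "i = 1" using that by simp
      have "sin (j * pi / (2 * n)) > 0" using that n by (simp add: sin_gt_zero field_simps)
      then have "?s i * Im (spoke_tip n ?s ?k 0 i j * cnj (vertex n ?s ?k 0 2)) > 0"
        using half_less_cos unfolding i spoke_tip_def v1 v2
        by (simp add: spoke_radius_0 alpha_0 heading_def)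
      from strict_spoke_germ[of ?s, OF this, of 2] show ?thesis by eventually_elim simp
    qed
  qed (use n in auto)
qed

end

section \<open>One angle smaller and the other at least \<open>pi / (2 * n)\<close>\<close>

text \<open>
  The half skeleton of the word B has ten edges. Entry 0 of both lists belongs to the first vertex, which
  in every doubled skeleton has sign 1 and a full fan. At \<open>V\<^sub>n\<close> the edges have directions 0 and, with
  \<open>x = pi / (2 * n)\<close>, alternately \<open>2 * x\<close> and \<open>- 2 * x\<close> in the middle part.
\<close>

definition sB :: "nat \<Rightarrow> real" where
  "sB i = [1, 1, 1, -1, 1, -1, 1, -1, -1, -1] ! i"

definition kB :: "nat \<Rightarrow> nat" where
  "kB i = [0, 0, 2, 4, 4, 4, 4, 2, 0, 0] ! i"

lemma first_nine: "1 \<le> i \<Longrightarrow> i < 10 \<Longrightarrow> i \<in> {1, 2, 3, 4, 5, 6, 7, 8, 9 :: nat}"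
  by auto

lemma nine_cases:
  assumes "1 \<le> i" "i < 10"
  obtains "i = 1" | "i = 2" | "i = 3" | "i = 4" | "i = 5" | "i = 6" | "i = 7" | "i = 8" | "i = (9 :: nat)"
  using first_nine[OF assms] by blast

context
  fixes n :: nat and x \<mu> a c :: real
  assumes n: "n \<ge> 4"
  defines "x \<equiv> pi / (2 * real n)" and "\<mu> \<equiv> 1 / (2 * real n)" and "a \<equiv> sin x" and "c \<equiv> cos x"
begin

text \<open>
  Near \<open>V\<^sub>n\<close>, heights and their derivatives become polynomials in \<open>\<mu>\<close>, \<open>a\<close> and \<open>c\<close>. The quantities \<open>\<mu>\<close> and \<open>a\<close> are treated as
  independent except for the bounds in \<open>x_bounds\<close> and \<open>trig_bounds\<close>.
\<close>

abbreviation "HB \<equiv> heading n sB kB"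
abbreviation "VB \<equiv> vertex n sB kB"
abbreviation "TB \<equiv> spoke_tip n sB kB"

lemma x_bounds: "0 < x" "x \<le> pi / 8" "pi * \<mu> = x" "0 < \<mu>" "\<mu> \<le> 1 / 8"
  using n by (auto simp: x_def \<mu>_def field_simps)

lemma trig_bounds: "0 < a" "0 < c" "1 / 2 < c" "c\<^sup>2 = 1 - a\<^sup>2" "9 * \<mu>\<^sup>2 \<le> a\<^sup>2" "a\<^sup>2 \<le> 4 / 25"
proof -
  have "pi < 16 / 5" using pi_approx(2) by simp
  then have x4: "x < 2 / 5" using x_bounds(2) by linarith
  show a: "0 < a" unfolding a_def using x_bounds x4 pi_gt3 by (intro sin_gt_zero) linarith+
  show c: "1 / 2 < c" unfolding c_def x_def using half_less_cos[of n] n by simp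
  then show "0 < c" by simp
  show "c\<^sup>2 = 1 - a\<^sup>2" unfolding a_def c_def by (rule cos_squared_eq)
  have "a \<le> x" unfolding a_def using x_bounds by (intro sin_x_le_x) auto
  then have "a\<^sup>2 \<le> (2 / 5)\<^sup>2" using a x4 by (intro power_mono) auto
  then show "a\<^sup>2 \<le> 4 / 25" by (simp add: power2_eq_square)
  have "\<bar>sin x - (\<Sum>m<3. sin_coeff m * x ^ m)\<bar> \<le> inverse (fact 3) * \<bar>x\<bar> ^ 3"
    by (rule Maclaurin_sin_bound)
  then have "\<bar>a - x\<bar> * 6 \<le> x ^ 3"
    using x_bounds(1) by (simp add: a_def sin_coeff_def eval_nat_numeral fact_numeral)
  then have "x - x ^ 3 / 6 \<le> a" using abs_ge_minus_self[of "a - x"] by simp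
  moreover have "x ^ 3 \<le> x * (4 / 25)"
  proof -
    have "x * x \<le> 2 / 5 * (2 / 5)" using x4 x_bounds(1) by (intro mult_mono) auto
    then show ?thesis using x_bounds(1) by (simp add: power3_eq_cube)
  qed
  moreover have "31 / 10 * \<mu> \<le> x" using x_bounds(3,4) pi_approx(1) mult_right_mono[of "31/10" pi \<mu>] by simp
  ultimately have "3 * \<mu> \<le> a" using x_bounds(4) by linarith
  then have "(3 * \<mu>)\<^sup>2 \<le> a\<^sup>2" using x_bounds(4) by (intro power_mono) auto
  then show "9 * \<mu>\<^sup>2 \<le> a\<^sup>2" by (simp add: power_mult_distrib)
qed

lemma heading_B:
  "HB E (Suc 0) = 0"
  "HB E 2 = snd E"
  "HB E 3 = 2 * x + (1 - 2 * \<mu>) * fst E + snd E"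
  "HB E 4 = - 2 * x + (1 - 2 * \<mu>) * fst E + 4 * \<mu> * snd E"
  "HB E 5 = 2 * x + (2 - 6 * \<mu>) * fst E + 4 * \<mu> * snd E"
  "HB E 6 = - 2 * x + (2 - 6 * \<mu>) * fst E + (8 * \<mu> - 1) * snd E"
  "HB E 7 = 2 * x + (3 - 10 * \<mu>) * fst E + (8 * \<mu> - 1) * snd E"
  "HB E 8 = (3 - 10 * \<mu>) * fst E + (10 * \<mu> - 2) * snd E"
  "HB E 9 = (2 - 10 * \<mu>) * fst E + (10 * \<mu> - 2) * snd E"
  "HB E 10 = (2 - 10 * \<mu>) * fst E + (10 * \<mu> - 3) * snd E"
proof -
  have al: "alpha n E i = x - \<mu> * defect E i" for i
    by (simp add: alpha_def x_def \<mu>_def diff_divide_distrib)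
  have Suc: "HB E (Suc i) = HB E i + sB i * (defect E i + kB i * alpha n E i)" if "i \<ge> 1" for i
    using that by (simp add: heading_def)
  show 1: "HB E (Suc 0) = 0" by (simp add: heading_def)
  show 2: "HB E 2 = snd E" using Suc[of 1] 1 by (simp add: sB_def kB_def al defect_def eval_nat_numeral)
  show 3: "HB E 3 = 2 * x + (1 - 2 * \<mu>) * fst E + snd E"
    using Suc[of 2] 2 by (simp add: sB_def kB_def al defect_def algebra_simps)
  show 4: "HB E 4 = - 2 * x + (1 - 2 * \<mu>) * fst E + 4 * \<mu> * snd E"
    using Suc[of 3] 3 by (simp add: sB_def kB_def al defect_def algebra_simps)
  show 5: "HB E 5 = 2 * x + (2 - 6 * \<mu>) * fst E + 4 * \<mu> * snd E"
    using Suc[of 4] 4 by (simp add: sB_def kB_def al defect_def algebra_simps)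
  show 6: "HB E 6 = - 2 * x + (2 - 6 * \<mu>) * fst E + (8 * \<mu> - 1) * snd E"
    using Suc[of 5] 5 by (simp add: sB_def kB_def al defect_def algebra_simps)
  show 7: "HB E 7 = 2 * x + (3 - 10 * \<mu>) * fst E + (8 * \<mu> - 1) * snd E"
    using Suc[of 6] 6 by (simp add: sB_def kB_def al defect_def algebra_simps)
  show 8: "HB E 8 = (3 - 10 * \<mu>) * fst E + (10 * \<mu> - 2) * snd E"
    using Suc[of 7] 7 by (simp add: sB_def kB_def al defect_def algebra_simps)
  show 9: "HB E 9 = (2 - 10 * \<mu>) * fst E + (10 * \<mu> - 2) * snd E"
    using Suc[of 8] 8 by (simp add: sB_def kB_def al defect_def algebra_simps)
  show "HB E 10 = (2 - 10 * \<mu>) * fst E + (10 * \<mu> - 3) * snd E"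
    using Suc[of 9] 9 by (simp add: sB_def kB_def al defect_def algebra_simps)
qed

lemma vertex_B:
  "VB E 0 = 0" "VB E (Suc 0) = cis (HB E (Suc 0))" "VB E 2 = VB E (Suc 0) + cis (HB E 2)" "VB E 3 = VB E 2 + cis (HB E 3)"
  "VB E 4 = VB E 3 + cis (HB E 4)" "VB E 5 = VB E 4 + cis (HB E 5)" "VB E 6 = VB E 5 + cis (HB E 6)"
  "VB E 7 = VB E 6 + cis (HB E 7)" "VB E 8 = VB E 7 + cis (HB E 8)" "VB E 9 = VB E 8 + cis (HB E 9)"
  "VB E 10 = VB E 9 + cis (HB E 10)"
  by (simp_all add: vertex_def eval_nat_numeral del: heading_B)

text \<open>
  The displacement along the half skeleton at \<open>V\<^sub>n\<close>. Its slope is \<open>tan x / 5\<close>, and the heights of the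
  vertices over its direction are \<open>2 * a * c\<close> times linear functions of \<open>a\<^sup>2\<close> with integer coefficients.
\<close>

definition S0 :: complex where
  "S0 = complex_of_real (2 * c) * Complex (5 * c) a"

lemma S0: "VB 0 10 = S0"
proof -
  have "cos (2 * x) = 2 * c\<^sup>2 - 1" "sin (2 * x) = 2 * a * c"
    by (simp_all add: a_def c_def cos_double_cos sin_double)
  then show ?thesis
    by (simp add: vertex_B heading_B S0_def complex_eq_iff power2_eq_square algebra_simps)
qed

lemma multiple_angles:
  "cos x = c" "sin x = a"
  "cos (2 * x) = 1 - 2 * a\<^sup>2" "sin (2 * x) = 2 * a * c"
  "cos (3 * x) = c * (1 - 4 * a\<^sup>2)" "sin (3 * x) = a * (3 - 4 * a\<^sup>2)"
proof -
  show "cos x = c" "sin x = a" by (simp_all add: a_def c_def)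
  show 2: "cos (2 * x) = 1 - 2 * a\<^sup>2" "sin (2 * x) = 2 * a * c"
    by (simp_all add: a_def c_def cos_double_sin sin_double)
  have "3 * x = 2 * x + x" by simp
  then have 3: "cos (3 * x) = (1 - 2 * a\<^sup>2) * c - 2 * a * c * a" "sin (3 * x) = 2 * a * c * c + (1 - 2 * a\<^sup>2) * a"
    using cos_add[of "2 * x" x] sin_add[of "2 * x" x] by (simp_all add: 2 a_def[symmetric] c_def[symmetric])
  show "cos (3 * x) = c * (1 - 4 * a\<^sup>2)" unfolding 3 by algebra
  show "sin (3 * x) = a * (3 - 4 * a\<^sup>2)" unfolding 3 using trig_bounds(4) by algebra
qed

lemma height_unit: "Im (cis y * cnj S0) = 2 * c * (5 * c * sin y - a * cos y)"
  by (simp add: S0_def algebra_simps)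

lemma progress_unit: "Re (cis y * cnj S0) = 2 * c * (5 * c * cos y + a * sin y)"
  by (simp add: S0_def algebra_simps)

definition short_height :: "real \<Rightarrow> real" where
  "short_height y = Im (cis y * cnj S0) / (2 * c)"

text \<open>
  The heights over the direction of \<open>S0\<close> of the long and short edges that occur at \<open>V\<^sub>n\<close>, in the common
  unit \<open>2 * a * c\<close>.
\<close>

lemma unit_heights:
  "Im (cis 0 * cnj S0) = - (2 * a * c)"
  "Im (cis (2 * x) * cnj S0) = 2 * a * c * (9 - 8 * a\<^sup>2)"
  "Im (cis (- (2 * x)) * cnj S0) = 2 * a * c * (12 * a\<^sup>2 - 11)"
  "short_height x = 2 * a * c * 2"
  "short_height (- x) = 2 * a * c * (- 3)"
  "short_height (3 * x) = 2 * a * c * (7 - 8 * a\<^sup>2)"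
  "short_height (- (3 * x)) = 2 * a * c * (12 * a\<^sup>2 - 8)"
proof -
  have c: "2 * c \<noteq> 0" and cc: "c\<^sup>2 = 1 - a\<^sup>2" using trig_bounds by auto
  have m: "cos (- (2 * x)) = 1 - 2 * a\<^sup>2" "sin (- (2 * x)) = - (2 * a * c)"
    "cos (- (3 * x)) = c * (1 - 4 * a\<^sup>2)" "sin (- (3 * x)) = - (a * (3 - 4 * a\<^sup>2))"
    "cos (- x) = c" "sin (- x) = - a"
    using multiple_angles by (simp_all only: cos_minus sin_minus)
  note ma = multiple_angles m
  show "Im (cis 0 * cnj S0) = - (2 * a * c)" unfolding height_unit by simp
  show "Im (cis (2 * x) * cnj S0) = 2 * a * c * (9 - 8 * a\<^sup>2)"
    unfolding height_unit ma using cc by algebra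
  show "Im (cis (- (2 * x)) * cnj S0) = 2 * a * c * (12 * a\<^sup>2 - 11)"
    unfolding height_unit ma using cc by algebra
  show "short_height x = 2 * a * c * 2"
    "short_height (- x) = 2 * a * c * (- 3)"
    using c unfolding short_height_def height_unit ma by simp_all
  show "short_height (3 * x) = 2 * a * c * (7 - 8 * a\<^sup>2)"
    using c unfolding short_height_def height_unit ma by (simp add: field_simps)
  show "short_height (- (3 * x)) = 2 * a * c * (12 * a\<^sup>2 - 8)"
    using c unfolding short_height_def height_unit ma by (simp add: field_simps)
qed

lemma vertex_heights_B:
  "Im (VB 0 1 * cnj S0) = 2 * a * c * (- 1)"
  "Im (VB 0 2 * cnj S0) = 2 * a * c * (- 2)"
  "Im (VB 0 3 * cnj S0) = 2 * a * c * (7 - 8 * a\<^sup>2)"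
  "Im (VB 0 4 * cnj S0) = 2 * a * c * (4 * a\<^sup>2 - 4)"
  "Im (VB 0 5 * cnj S0) = 2 * a * c * (5 - 4 * a\<^sup>2)"
  "Im (VB 0 6 * cnj S0) = 2 * a * c * (8 * a\<^sup>2 - 6)"
  "Im (VB 0 7 * cnj S0) = 2 * a * c * 3"
  "Im (VB 0 8 * cnj S0) = 2 * a * c * 2"
  "Im (VB 0 9 * cnj S0) = 2 * a * c * 1"
proof -
  have step: "Im ((v + cis y) * cnj S0) = Im (v * cnj S0) + Im (cis y * cnj S0)" for v y
    by (simp add: distrib_right)
  have hd: "HB 0 2 = 0" "HB 0 3 = 2 * x" "HB 0 4 = - (2 * x)" "HB 0 5 = 2 * x" "HB 0 6 = - (2 * x)"
    "HB 0 7 = 2 * x" "HB 0 8 = 0" "HB 0 9 = 0"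
    by (simp_all add: heading_B)
  show 1: "Im (VB 0 1 * cnj S0) = 2 * a * c * (- 1)"
    using unit_heights(1) by (simp add: vertex_B heading_B del: times_complex.simps)
  show 2: "Im (VB 0 2 * cnj S0) = 2 * a * c * (- 2)"
    unfolding vertex_B(3) step hd unit_heights 1[unfolded One_nat_def] by (simp add: algebra_simps)
  show 3: "Im (VB 0 3 * cnj S0) = 2 * a * c * (7 - 8 * a\<^sup>2)"
    unfolding vertex_B(4) step hd unit_heights 2 by (simp add: algebra_simps)
  show 4: "Im (VB 0 4 * cnj S0) = 2 * a * c * (4 * a\<^sup>2 - 4)"
    unfolding vertex_B(5) step hd unit_heights 3 by (simp add: algebra_simps)
  show 5: "Im (VB 0 5 * cnj S0) = 2 * a * c * (5 - 4 * a\<^sup>2)"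
    unfolding vertex_B(6) step hd unit_heights 4 by (simp add: algebra_simps)
  show 6: "Im (VB 0 6 * cnj S0) = 2 * a * c * (8 * a\<^sup>2 - 6)"
    unfolding vertex_B(7) step hd unit_heights 5 by (simp add: algebra_simps)
  show 7: "Im (VB 0 7 * cnj S0) = 2 * a * c * 3"
    unfolding vertex_B(8) step hd unit_heights 6 by (simp add: algebra_simps)
  show 8: "Im (VB 0 8 * cnj S0) = 2 * a * c * 2"
    unfolding vertex_B(9) step hd unit_heights 7 by (simp add: algebra_simps)
  show "Im (VB 0 9 * cnj S0) = 2 * a * c * 1"
    unfolding vertex_B(10) step hd unit_heights 8 by (simp add: algebra_simps)
qed

lemma sB_kB_bounds:
  assumes "1 \<le> i" "i < 10"
  shows "sB i = 1 \<or> sB i = -1" "even (kB i)" "kB i \<le> 4"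
  using first_nine[OF assms] by (auto simp: sB_def kB_def)

text \<open>
  The first inner spoke is a short side next to the incoming skeleton edge, and the last one is a short
  side next to the outgoing edge.
\<close>

lemma end_spokes_B:
  assumes i: "1 \<le> i" "i < 10"
  shows "Im (TB 0 i 1 * cnj S0) = Im (VB 0 i * cnj S0) - short_height (HB 0 i - sB i * x)"
    and "Im (TB 0 i (2 * n - kB i - 1) * cnj S0) =
      Im (VB 0 i * cnj S0) + short_height (HB 0 i + sB i * (kB i + 1) * x)"
proof -
  note sk = sB_kB_bounds[OF i]
  have lin: "Im ((v - r *\<^sub>R w) * cnj S0) = Im (v * cnj S0) - r * Im (w * cnj S0)" for v w r
    by (simp add: algebra_simps)
  have rad: "spoke_radius n 0 i j = 1 / (2 * c)" if "odd j" for j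
    using that spoke_radius_0[of n i j] n by (simp add: c_def x_def)
  have al: "alpha n 0 i = x" by (simp add: alpha_0 x_def)
  show "Im (TB 0 i 1 * cnj S0) = Im (VB 0 i * cnj S0) - short_height (HB 0 i - sB i * x)"
    unfolding spoke_tip_def lin al short_height_def using rad[of 1] by (simp add: cis_mult del: times_complex.simps)
  have M: "odd (2 * n - kB i - 1)" "real (2 * n - kB i - 1) = 2 * real n - real (kB i) - 1"
    using sk n by (auto simp: of_nat_diff)
  have "(2 * n) * x = pi" using n by (simp add: x_def)
  then have "HB 0 i + - sB i * (2 * real n - real (kB i) - 1) * x = HB 0 i + sB i * (kB i + 1) * x - sB i * pi"
    by (simp add: algebra_simps)
  then have "cis (HB 0 i) * cis (- sB i * real (2 * n - kB i - 1) * x) =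
      cis (HB 0 i + sB i * (kB i + 1) * x - sB i * pi)"
    unfolding cis_mult M(2) by (simp only:)
  also have "\<dots> = - cis (HB 0 i + sB i * (kB i + 1) * x)"
    using sk(1) by (auto simp: complex_eq_iff)
  finally show "Im (TB 0 i (2 * n - kB i - 1) * cnj S0) =
      Im (VB 0 i * cnj S0) + short_height (HB 0 i + sB i * (kB i + 1) * x)"
    unfolding spoke_tip_def lin al short_height_def using rad[OF M(1)] by (simp del: times_complex.simps)
qed

text \<open>
  At \<open>V\<^sub>n\<close> all skeleton vertices strictly inside the half skeleton are on their sides of the path. So are
  the ends of the first and the last inner spokes, except for two points that lie on the path: the end of spoke 1 of fan 3,
  and the obtuse vertex between fans 7 and 8, which is the end of a spoke of both.
\<close>

lemma strict_heights_B:
  assumes i: "1 \<le> i" "i < 10"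
  shows "sB i * Im (VB 0 i * cnj S0) < 0"
    and "sB i * Im (TB 0 i 1 * cnj S0) \<ge> 0"
    and "i \<notin> {3, 8} \<Longrightarrow> sB i * Im (TB 0 i 1 * cnj S0) > 0"
    and "sB i * Im (TB 0 i (2 * n - kB i - 1) * cnj S0) \<ge> 0"
    and "i \<noteq> 7 \<Longrightarrow> sB i * Im (TB 0 i (2 * n - kB i - 1) * cnj S0) > 0"
proof -
  have s: "a\<^sup>2 \<ge> 0" "a\<^sup>2 \<le> 4 / 25" using trig_bounds by auto
  have hd: "HB 0 1 = 0" "HB 0 2 = 0" "HB 0 3 = 2 * x" "HB 0 4 = - (2 * x)" "HB 0 5 = 2 * x" "HB 0 6 = - (2 * x)"
    "HB 0 7 = 2 * x" "HB 0 8 = 0" "HB 0 9 = 0"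
    by (simp_all add: heading_B)
  have sk: "sB 1 = 1" "sB 2 = 1" "sB 3 = -1" "sB 4 = 1" "sB 5 = -1" "sB 6 = 1" "sB 7 = -1" "sB 8 = -1" "sB 9 = -1"
    "kB 1 = 0" "kB 2 = 2" "kB 3 = 4" "kB 4 = 4" "kB 5 = 4" "kB 6 = 4" "kB 7 = 2" "kB 8 = 0" "kB 9 = 0"
    by (simp_all add: sB_def kB_def)
  have cases: "i \<in> {1, 2, 3, 4, 5, 6, 7, 8, 9}" using first_nine[OF i] .
  define u where "u = 2 * a * c"
  note vals = hd[unfolded One_nat_def] sk[unfolded One_nat_def] vertex_heights_B[folded u_def, unfolded One_nat_def]
    unit_heights(4-)[folded u_def]
  have dir1: "HB 0 i - sB i * x = [0, - x, - x, 3 * x, - (3 * x), 3 * x, - (3 * x), 3 * x, x, x] ! i"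
    by (cases rule: nine_cases[OF i]) (simp_all add: vals)
  have dir2: "HB 0 i + sB i * (kB i + 1) * x = [0, x, 3 * x, - (3 * x), 3 * x, - (3 * x), 3 * x, - x, - x, - x] ! i"
    by (cases rule: nine_cases[OF i]) (simp_all add: vals)
  \<comment> \<open>Lists of heights, indexed by the fan; position 0 is a default.\<close>
  have tips1: "sB i * Im (TB 0 i 1 * cnj S0) = u * ([0, 2, 1, 0, 4 - 8 * a\<^sup>2, 2 - 4 * a\<^sup>2, 2 - 4 * a\<^sup>2, 4 - 8 * a\<^sup>2, 0, 1] ! i)"
    unfolding end_spokes_B[OF i] dir1
    by (cases rule: nine_cases[OF i]) (simp_all add: vals right_diff_distrib distrib_left del: times_complex.simps)
  have tips2: "sB i * Im (TB 0 i (2 * n - kB i - 1) * cnj S0) =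
      u * ([0, 1, 5 - 8 * a\<^sup>2, 1 - 4 * a\<^sup>2, 3 - 4 * a\<^sup>2, 3 - 8 * a\<^sup>2, 1, 0, 1, 2] ! i)"
    unfolding end_spokes_B[OF i] dir2
    by (cases rule: nine_cases[OF i]) (simp_all add: vals right_diff_distrib distrib_left del: times_complex.simps)
  have tips3: "sB i * Im (VB 0 i * cnj S0) = - (u * ([0, 1, 2, 7 - 8 * a\<^sup>2, 4 - 4 * a\<^sup>2, 5 - 4 * a\<^sup>2, 6 - 8 * a\<^sup>2, 3, 2, 1] ! i))"
    by (cases rule: nine_cases[OF i]) (simp_all add: vals right_diff_distrib distrib_left del: times_complex.simps)
  note tips = tips1 tips2 tips3
  have u: "u > 0" using trig_bounds by (simp add: u_def)
  show "sB i * Im (VB 0 i * cnj S0) < 0"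
    unfolding tips using s u by (cases rule: nine_cases[OF i]) (simp_all add: zero_less_mult_iff)
  show "sB i * Im (TB 0 i 1 * cnj S0) \<ge> 0" unfolding tips
    using s u by (cases rule: nine_cases[OF i]) (simp_all add: zero_le_mult_iff)
  show "sB i * Im (TB 0 i (2 * n - kB i - 1) * cnj S0) \<ge> 0" unfolding tips
    using s u by (cases rule: nine_cases[OF i]) (simp_all add: zero_le_mult_iff)
  show "sB i * Im (TB 0 i 1 * cnj S0) > 0" if "i \<notin> {3, 8}" unfolding tips
    using s u that by (cases rule: nine_cases[OF i]) (simp_all add: zero_less_mult_iff)
  show "sB i * Im (TB 0 i (2 * n - kB i - 1) * cnj S0) > 0" if "i \<noteq> 7" unfolding tips
    using s u that by (cases rule: nine_cases[OF i]) (simp_all add: zero_less_mult_iff)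
qed

text \<open>
  The height of \<open>f\<close> over the fixed direction of \<open>S0\<close> changes at \<open>V\<^sub>n\<close> with rate \<open>\<alpha>\<close> in the first defect
  and rate \<open>\<beta>\<close> in the second. A long edge of direction \<open>cis \<theta>\<close> contributes the rate of \<open>\<theta>\<close> times its
  extent in the direction of \<open>S0\<close>; for a short side there is also the change of its length.
\<close>

definition climbs :: "(real \<times> real \<Rightarrow> complex) \<Rightarrow> real \<Rightarrow> real \<Rightarrow> bool" where
  "climbs f \<alpha> \<beta> \<longleftrightarrow> (\<exists>f'. (f has_derivative f') (at 0) \<and> (\<forall>h. Im (f' h * cnj S0) = \<alpha> * fst h + \<beta> * snd h))"

lemma climbs_add: "climbs f \<alpha> \<beta> \<Longrightarrow> climbs g \<gamma> \<delta> \<Longrightarrow> climbs (\<lambda>E. f E + g E) (\<alpha> + \<gamma>) (\<beta> + \<delta>)"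
  unfolding climbs_def
  by (elim exE conjE, rule exI, rule conjI, erule (1) has_derivative_add) (simp add: algebra_simps)

lemma climbs_diff: "climbs f \<alpha> \<beta> \<Longrightarrow> climbs g \<gamma> \<delta> \<Longrightarrow> climbs (\<lambda>E. f E - g E) (\<alpha> - \<gamma>) (\<beta> - \<delta>)"
  unfolding climbs_def
  by (elim exE conjE, rule exI, rule conjI, erule (1) has_derivative_diff) (simp add: algebra_simps)

lemma climbs_spoke:
  assumes "(r has_derivative (\<lambda>h. r1 * fst h + r2 * snd h)) (at 0)"
  shows "climbs (\<lambda>E. r E *\<^sub>R cis (y + u * fst E + w * snd E))
    (r1 * Im (cis y * cnj S0) + r 0 * u * Re (cis y * cnj S0))
    (r2 * Im (cis y * cnj S0) + r 0 * w * Re (cis y * cnj S0))"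
  unfolding climbs_def
proof (intro exI conjI allI)
  show "((\<lambda>E. r E *\<^sub>R cis (y + u * fst E + w * snd E)) has_derivative
      (\<lambda>h. r 0 *\<^sub>R ((u * fst h + w * snd h) *\<^sub>R (\<i> * cis y)) + (r1 * fst h + r2 * snd h) *\<^sub>R cis y)) (at 0)"
    by (auto intro!: derivative_eq_intros assms)
qed (simp add: algebra_simps)

lemma climbs_cis:
  "climbs (\<lambda>E. cis (y + u * fst E + w * snd E)) (u * Re (cis y * cnj S0)) (w * Re (cis y * cnj S0))"
  using climbs_spoke[of "\<lambda>_. 1" 0 0 y u w] by (auto intro!: derivative_eq_intros)

lemma progress_values:
  "Re (cis 0 * cnj S0) = 2 * (1 - a\<^sup>2) * 5"
  "Re (cis (2 * x) * cnj S0) = 2 * (1 - a\<^sup>2) * (5 - 8 * a\<^sup>2)"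
  "Re (cis (- 2 * x) * cnj S0) = 2 * (1 - a\<^sup>2) * (5 - 12 * a\<^sup>2)"
  "Re (cis (3 * x) * cnj S0) / (2 * c) = 5 - 22 * a\<^sup>2 + 16 * a ^ 4"
  "Re (cis (- x) * cnj S0) / (2 * c) = 5 - 6 * a\<^sup>2"
proof -
  have c: "2 * c \<noteq> 0" and cc: "c\<^sup>2 = 1 - a\<^sup>2" using trig_bounds by auto
  have m: "cos (- 2 * x) = 1 - 2 * a\<^sup>2" "sin (- 2 * x) = - (2 * a * c)" "cos (- x) = c" "sin (- x) = - a"
    using multiple_angles by simp_all
  note ma = multiple_angles m
  show "Re (cis 0 * cnj S0) = 2 * (1 - a\<^sup>2) * 5" unfolding progress_unit using cc by (simp, algebra)
  show "Re (cis (2 * x) * cnj S0) = 2 * (1 - a\<^sup>2) * (5 - 8 * a\<^sup>2)"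
    unfolding progress_unit ma using cc by algebra
  show "Re (cis (- 2 * x) * cnj S0) = 2 * (1 - a\<^sup>2) * (5 - 12 * a\<^sup>2)"
    unfolding progress_unit ma using cc by algebra
  have "Re (cis (3 * x) * cnj S0) / (2 * c) = 5 * c * (c * (1 - 4 * a\<^sup>2)) + a * (a * (3 - 4 * a\<^sup>2))"
    using c unfolding progress_unit ma by simp
  then show "Re (cis (3 * x) * cnj S0) / (2 * c) = 5 - 22 * a\<^sup>2 + 16 * a ^ 4" using cc by algebra
  have "Re (cis (- x) * cnj S0) / (2 * c) = 5 * c * c + a * (- a)"
    using c unfolding progress_unit ma by simp
  then show "Re (cis (- x) * cnj S0) / (2 * c) = 5 - 6 * a\<^sup>2" using cc by algebra
qed

text \<open>
  The length of the short side opposite the acute angle at the even skeleton vertices.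
\<close>

definition short_radius :: "real \<times> real \<Rightarrow> real" where
  "short_radius E = sin (alpha n E 0) / sin (pi - alpha n E 0 - alpha n E 1)"

lemma alpha_linear: "alpha n E i = x - \<mu> * defect E i"
  by (simp add: alpha_def x_def \<mu>_def diff_divide_distrib)

lemma short_radius:
  "short_radius 0 = 1 / (2 * c)"
  "(short_radius has_derivative (\<lambda>h. - \<mu> / (4 * a * c\<^sup>2) * fst h + \<mu> * (1 - 2 * a\<^sup>2) / (4 * a * c\<^sup>2) * snd h)) (at 0)"
proof -
  have nz: "a \<noteq> 0" "c \<noteq> 0" using trig_bounds by auto
  have eq: "short_radius E = sin (x - \<mu> * fst E) / sin (2 * x - \<mu> * (fst E + snd E))" for E
  proof -
    have "sin (pi - alpha n E 0 - alpha n E 1) = sin (alpha n E 0 + alpha n E 1)"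
      using sin_pi_minus[of "alpha n E 0 + alpha n E 1"] by (simp add: algebra_simps)
    then show ?thesis by (simp add: short_radius_def alpha_linear defect_def algebra_simps)
  qed
  show "short_radius 0 = 1 / (2 * c)" unfolding eq using nz by (simp add: multiple_angles)
  have s2: "sin (2 * x) \<noteq> 0" using nz by (simp add: multiple_angles)
  have "((\<lambda>E. sin (x - \<mu> * fst E) / sin (2 * x - \<mu> * (fst E + snd E))) has_derivative
      (\<lambda>h. ((- \<mu> * fst h * cos x) * sin (2 * x) - sin x * (- \<mu> * (fst h + snd h) * cos (2 * x))) / (sin (2 * x) * sin (2 * x)))) (at 0)"
    using s2 by (auto intro!: derivative_eq_intros)
  also have "(\<lambda>h :: real \<times> real. ((- \<mu> * fst h * cos x) * sin (2 * x) - sin x * (- \<mu> * (fst h + snd h) * cos (2 * x))) / (sin (2 * x) * sin (2 * x))) =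
      (\<lambda>h. - \<mu> / (4 * a * c\<^sup>2) * fst h + \<mu> * (1 - 2 * a\<^sup>2) / (4 * a * c\<^sup>2) * snd h)"
  proof
    fix h :: "real \<times> real"
    have "(- \<mu> * fst h * cos x) * sin (2 * x) - sin x * (- \<mu> * (fst h + snd h) * cos (2 * x)) =
        a * (- \<mu> * fst h + \<mu> * (1 - 2 * a\<^sup>2) * snd h)"
      unfolding multiple_angles using trig_bounds(4) by algebra
    moreover have "sin (2 * x) * sin (2 * x) = a * (4 * a * c\<^sup>2)"
      unfolding multiple_angles by (simp add: power2_eq_square)
    ultimately show "((- \<mu> * fst h * cos x) * sin (2 * x) - sin x * (- \<mu> * (fst h + snd h) * cos (2 * x))) / (sin (2 * x) * sin (2 * x)) =
        - \<mu> / (4 * a * c\<^sup>2) * fst h + \<mu> * (1 - 2 * a\<^sup>2) / (4 * a * c\<^sup>2) * snd h"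
      using nz by (simp add: add_divide_distrib diff_divide_distrib)
  qed
  finally show "(short_radius has_derivative (\<lambda>h. - \<mu> / (4 * a * c\<^sup>2) * fst h + \<mu> * (1 - 2 * a\<^sup>2) / (4 * a * c\<^sup>2) * snd h)) (at 0)"
    unfolding eq[abs_def] .
qed

lemma climbs_heading:
  assumes "\<And>E. HB E j = y + u * fst E + w * snd E"
  shows "climbs (\<lambda>E. cis (HB E j)) (u * Re (cis y * cnj S0)) (w * Re (cis y * cnj S0))"
  unfolding assms by (rule climbs_cis)

lemma climbs_step:
  assumes "climbs (\<lambda>E. VB E i) \<alpha> \<beta>" and "\<And>E. HB E (Suc i) = y + u * fst E + w * snd E"
    and "\<alpha>' = \<alpha> + u * Re (cis y * cnj S0)" "\<beta>' = \<beta> + w * Re (cis y * cnj S0)"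
  shows "climbs (\<lambda>E. VB E (Suc i)) \<alpha>' \<beta>'"
  using climbs_add[OF assms(1) climbs_heading[OF assms(2)]] unfolding assms(3,4)
  by (simp add: vertex_def)

lemma climbs_vertices:
  defines "s \<equiv> a\<^sup>2"
  defines "F \<equiv> 2 * (1 - s)" and "G \<equiv> 5 - 8 * s" and "H \<equiv> 5 - 12 * s"
  shows "climbs (\<lambda>E. VB E 3) (F * ((1 - 2 * \<mu>) * G)) (F * (5 + G))"
    and "climbs (\<lambda>E. VB E 7) (F * ((3 - 8 * \<mu>) * (G + H) + (3 - 10 * \<mu>) * G)) (F * (5 + G + (12 * \<mu> - 1) * (G + H)))"
    and "climbs (\<lambda>E. VB E 10)
      (F * ((3 - 8 * \<mu>) * (G + H) + (3 - 10 * \<mu>) * G + (7 - 30 * \<mu>) * 5))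
      (F * (5 + G + (12 * \<mu> - 1) * (G + H) + (30 * \<mu> - 7) * 5))"
proof -
  note C = progress_values(1-3)[folded s_def, folded F_def, folded G_def H_def]
  have V0: "climbs (\<lambda>E. VB E 0) 0 0"
    by (auto simp: climbs_def vertex_B intro!: exI[of _ "\<lambda>_. 0"])
  have V1: "climbs (\<lambda>E. VB E (Suc 0)) 0 0"
    by (rule climbs_step[OF V0, of 0 0 0]) (simp_all add: heading_B)
  have V2: "climbs (\<lambda>E. VB E (Suc (Suc 0))) 0 (F * 5)"
  proof (rule climbs_step[OF V1, of 0 0 1])
    show "HB E (Suc (Suc 0)) = 0 + 0 * fst E + 1 * snd E" for E
      using heading_B(2) by (simp add: numeral_2_eq_2)
  qed (simp_all only: C)
  have V3: "climbs (\<lambda>E. VB E (Suc 2)) (F * ((1 - 2 * \<mu>) * G)) (F * (5 + G))"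
    by (rule climbs_step[OF V2[folded numeral_2_eq_2], of "2 * x" "1 - 2 * \<mu>" 1])
      (use C in \<open>simp_all add: heading_B algebra_simps\<close>)
  then show 3: "climbs (\<lambda>E. VB E 3) (F * ((1 - 2 * \<mu>) * G)) (F * (5 + G))" by simp
  have V4: "climbs (\<lambda>E. VB E (Suc 3)) (F * ((1 - 2 * \<mu>) * G + (1 - 2 * \<mu>) * H)) (F * (5 + G + 4 * \<mu> * H))"
    by (rule climbs_step[OF 3, of "- 2 * x" "1 - 2 * \<mu>" "4 * \<mu>"])
      (simp_all only: C, simp_all add: heading_B algebra_simps)
  then have 4: "climbs (\<lambda>E. VB E 4) (F * ((1 - 2 * \<mu>) * G + (1 - 2 * \<mu>) * H)) (F * (5 + G + 4 * \<mu> * H))" by simp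
  have V5: "climbs (\<lambda>E. VB E (Suc 4)) (F * ((3 - 8 * \<mu>) * G + (1 - 2 * \<mu>) * H)) (F * (5 + G + 4 * \<mu> * (G + H)))"
    by (rule climbs_step[OF 4, of "2 * x" "2 - 6 * \<mu>" "4 * \<mu>"])
      (simp_all only: C, simp_all add: heading_B algebra_simps)
  then have 5: "climbs (\<lambda>E. VB E 5) (F * ((3 - 8 * \<mu>) * G + (1 - 2 * \<mu>) * H)) (F * (5 + G + 4 * \<mu> * (G + H)))" by simp
  have V6: "climbs (\<lambda>E. VB E (Suc 5)) (F * ((3 - 8 * \<mu>) * (G + H))) (F * (5 + G + 4 * \<mu> * (G + H) + (8 * \<mu> - 1) * H))"
    by (rule climbs_step[OF 5, of "- 2 * x" "2 - 6 * \<mu>" "8 * \<mu> - 1"])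
      (simp_all only: C, simp_all add: heading_B algebra_simps)
  then have 6: "climbs (\<lambda>E. VB E 6) (F * ((3 - 8 * \<mu>) * (G + H))) (F * (5 + G + 4 * \<mu> * (G + H) + (8 * \<mu> - 1) * H))" by simp
  have V7: "climbs (\<lambda>E. VB E (Suc 6)) (F * ((3 - 8 * \<mu>) * (G + H) + (3 - 10 * \<mu>) * G)) (F * (5 + G + (12 * \<mu> - 1) * (G + H)))"
    by (rule climbs_step[OF 6, of "2 * x" "3 - 10 * \<mu>" "8 * \<mu> - 1"])
      (simp_all only: C, simp_all add: heading_B algebra_simps)
  then show 7: "climbs (\<lambda>E. VB E 7) (F * ((3 - 8 * \<mu>) * (G + H) + (3 - 10 * \<mu>) * G)) (F * (5 + G + (12 * \<mu> - 1) * (G + H)))" by simp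
  have V8: "climbs (\<lambda>E. VB E (Suc 7)) (F * ((3 - 8 * \<mu>) * (G + H) + (3 - 10 * \<mu>) * G + (3 - 10 * \<mu>) * 5))
      (F * (5 + G + (12 * \<mu> - 1) * (G + H) + (10 * \<mu> - 2) * 5))"
    by (rule climbs_step[OF 7, of 0 "3 - 10 * \<mu>" "10 * \<mu> - 2"])
      (simp_all only: C, simp_all add: heading_B algebra_simps)
  then have 8: "climbs (\<lambda>E. VB E 8) (F * ((3 - 8 * \<mu>) * (G + H) + (3 - 10 * \<mu>) * G + (3 - 10 * \<mu>) * 5))
      (F * (5 + G + (12 * \<mu> - 1) * (G + H) + (10 * \<mu> - 2) * 5))" by simp
  have V9: "climbs (\<lambda>E. VB E (Suc 8)) (F * ((3 - 8 * \<mu>) * (G + H) + (3 - 10 * \<mu>) * G + (5 - 20 * \<mu>) * 5))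
      (F * (5 + G + (12 * \<mu> - 1) * (G + H) + (20 * \<mu> - 4) * 5))"
    by (rule climbs_step[OF 8, of 0 "2 - 10 * \<mu>" "10 * \<mu> - 2"])
      (simp_all only: C, simp_all add: heading_B algebra_simps)
  then have 9: "climbs (\<lambda>E. VB E 9) (F * ((3 - 8 * \<mu>) * (G + H) + (3 - 10 * \<mu>) * G + (5 - 20 * \<mu>) * 5))
      (F * (5 + G + (12 * \<mu> - 1) * (G + H) + (20 * \<mu> - 4) * 5))" by simp
  have V10: "climbs (\<lambda>E. VB E (Suc 9)) (F * ((3 - 8 * \<mu>) * (G + H) + (3 - 10 * \<mu>) * G + (7 - 30 * \<mu>) * 5))
      (F * (5 + G + (12 * \<mu> - 1) * (G + H) + (30 * \<mu> - 7) * 5))"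
    by (rule climbs_step[OF 9, of 0 "2 - 10 * \<mu>" "10 * \<mu> - 3"])
      (simp_all only: C, simp_all add: heading_B algebra_simps)
  then show "climbs (\<lambda>E. VB E 10) (F * ((3 - 8 * \<mu>) * (G + H) + (3 - 10 * \<mu>) * G + (7 - 30 * \<mu>) * 5))
      (F * (5 + G + (12 * \<mu> - 1) * (G + H) + (30 * \<mu> - 7) * 5))" by simp
qed

text \<open>
  The points that lie on the path at \<open>V\<^sub>n\<close>, as explicit functions of the defects. The proviso of the last
  equation holds near \<open>V\<^sub>n\<close>; it keeps the lengths of the short sides meaningful.
\<close>

lemma degenerate_spokes_B:
  "TB E 3 1 = VB E 3 - short_radius E *\<^sub>R cis (3 * x + (1 - 2 * \<mu>) * fst E + (1 - \<mu>) * snd E)"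
  "TB E 7 (2 * n - 3) = VB E 7 + short_radius E *\<^sub>R cis (- x + (3 - 10 * \<mu>) * fst E + (11 * \<mu> - 2) * snd E)"
  "sin (pi - alpha n E 0 - alpha n E 1) \<noteq> 0 \<Longrightarrow> TB E 8 1 = TB E 7 (2 * n - 3)"
proof -
  have s: "sB 3 = -1" "sB 7 = -1" "sB 8 = -1" by (simp_all add: sB_def)
  have al: "alpha n E 4 = alpha n E 0" "alpha n E 8 = alpha n E 0" "alpha n E 9 = alpha n E 1"
    "alpha n E 3 = alpha n E 1" "alpha n E 7 = alpha n E 1"
    by (simp_all add: alpha_def defect_def)
  have "2 * n - 3 = Suc (2 * (n - 2))" using n by simp
  then have odd: "odd (2 * n - 3)" by (metis even_Suc even_mult_iff even_numeral)
  have rad: "spoke_radius n E 3 1 = short_radius E" "spoke_radius n E 7 (2 * n - 3) = short_radius E"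
    "spoke_radius n E 8 1 = sin (alpha n E 1) / sin (pi - alpha n E 0 - alpha n E 1)"
    using al odd by (simp_all add: spoke_radius_def short_radius_def)
  have "HB E 3 + alpha n E 1 = 3 * x + (1 - 2 * \<mu>) * fst E + (1 - \<mu>) * snd E"
    by (simp add: heading_B alpha_linear defect_def algebra_simps)
  then show "TB E 3 1 = VB E 3 - short_radius E *\<^sub>R cis (3 * x + (1 - 2 * \<mu>) * fst E + (1 - \<mu>) * snd E)"
    unfolding spoke_tip_def rad by (simp add: s al cis_mult)
  have "real (2 * n - 3) = 2 * real n - 3" using n by (simp add: of_nat_diff)
  moreover have "2 * real n * alpha n E 1 = pi - snd E" using n by (simp add: alpha_def defect_def)
  ultimately have ang: "HB E 7 + real (2 * n - 3) * alpha n E 1 = HB E 8 - alpha n E 1 + pi"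
    by (simp add: heading_B alpha_linear defect_def algebra_simps)
  have "cis (HB E 8 - alpha n E 1 + pi) = - cis (HB E 8 - alpha n E 1)"
    by (simp add: complex_eq_iff)
  then have tip7: "TB E 7 (2 * n - 3) = VB E 7 + short_radius E *\<^sub>R cis (HB E 8 - alpha n E 1)"
    unfolding spoke_tip_def rad using ang by (simp add: s al cis_mult)
  then show "TB E 7 (2 * n - 3) = VB E 7 + short_radius E *\<^sub>R cis (- x + (3 - 10 * \<mu>) * fst E + (11 * \<mu> - 2) * snd E)"
    by (simp add: heading_B alpha_linear defect_def algebra_simps)
  assume nz: "sin (pi - alpha n E 0 - alpha n E 1) \<noteq> 0"
  define A B where "A = alpha n E 0" and "B = alpha n E 1"
  have "sin (pi - A - B) = sin A * cos B + cos A * sin B"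
    using sin_pi_minus[of "A + B"] by (simp add: algebra_simps sin_add)
  then have "sin (pi - A - B) *\<^sub>R cis (HB E 8) = sin A *\<^sub>R cis (HB E 8 - B) + sin B *\<^sub>R cis (HB E 8 + A)"
    by (simp add: complex_eq_iff cos_add cos_diff sin_add sin_diff algebra_simps)
  then have "cis (HB E 8) = short_radius E *\<^sub>R cis (HB E 8 - B) + (sin B / sin (pi - A - B)) *\<^sub>R cis (HB E 8 + A)"
    using nz unfolding short_radius_def A_def[symmetric] B_def[symmetric]
    by (simp add: complex_eq_iff field_simps)
  then have v8: "VB E 8 = VB E 7 + (short_radius E *\<^sub>R cis (HB E 8 - B) + (sin B / sin (pi - A - B)) *\<^sub>R cis (HB E 8 + A))"
    using vertex_B(9) by metis
  have "cis (HB E 8) * cis (- sB 8 * real 1 * alpha n E 8) = cis (HB E 8 + A)"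
    by (simp add: s al cis_mult A_def)
  then show "TB E 8 1 = TB E 7 (2 * n - 3)"
    unfolding tip7 unfolding spoke_tip_def rad v8 by (simp add: A_def B_def)
qed

text \<open>
  The point \<open>Q\<close> is a real multiple \<open>l\<close> of \<open>S0\<close> at \<open>V\<^sub>n\<close>. As the direction of the path turns as well, the
  rates of \<open>Q\<close> are to be diminished by \<open>l\<close> times those of the end point \<open>VB E 10\<close>.
\<close>

lemma degenerate_tip:
  assumes Q: "climbs Q \<alpha> \<beta>" "Q 0 = complex_of_real l * S0" and S: "climbs (\<lambda>E. VB E 10) \<gamma> \<delta>"
    and b: "\<beta> - l * \<delta> > 0" and a: "2 * (\<alpha> - l * \<gamma>) + \<bar>l * norm S0 ^ 2 - C\<bar> < 0"
  shows "\<forall>\<^sub>F E in nhds 0. 0 < fst E \<and> snd E \<le> 0 \<longrightarrow>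
    -1 * Im (Q E * cnj (VB E 10)) * cos (fst E / 2) - \<bar>Re (Q E * cnj (VB E 10)) - C\<bar> * sin (fst E / 2) > 0"
proof -
  obtain Q' where Q': "(Q has_derivative Q') (at 0)" "\<And>h. Im (Q' h * cnj S0) = \<alpha> * fst h + \<beta> * snd h"
    using Q(1) unfolding climbs_def by blast
  obtain S' where S': "((\<lambda>E. VB E 10) has_derivative S') (at 0)" "\<And>h. Im (S' h * cnj S0) = \<gamma> * fst h + \<delta> * snd h"
    using S unfolding climbs_def by blast
  have Im_of_real_mult: "Im (complex_of_real r * z) = r * Im z" for r z by simp
  have Z0: "Q 0 * cnj (VB 0 10) = complex_of_real (l * norm S0 ^ 2)"
    by (simp add: Q(2) S0 complex_norm_square[symmetric] mult.assoc of_real_power[symmetric] del: of_real_power)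
  show ?thesis
  proof (rule degenerate_germ[where Z' = "\<lambda>h. Q 0 * cnj (S' h) + Q' h * cnj (VB 0 10)"])
    show "((\<lambda>E. Q E * cnj (VB E 10)) has_derivative (\<lambda>h. Q 0 * cnj (S' h) + Q' h * cnj (VB 0 10))) (at 0)"
      using has_derivative_mult[OF Q'(1) has_derivative_cnj[OF S'(1)]] by simp
    show "Im (Q 0 * cnj (S' h) + Q' h * cnj (VB 0 10)) = (\<alpha> - l * \<gamma>) * fst h + (\<beta> - l * \<delta>) * snd h" for h
    proof -
      have "Q 0 * cnj (S' h) = complex_of_real l * cnj (S' h * cnj S0)" by (simp add: Q(2))
      then have "Im (Q 0 * cnj (S' h)) = - l * (\<gamma> * fst h + \<delta> * snd h)"
        unfolding S'(2)[symmetric] by (simp only: Im_of_real_mult complex_cnj) (simp add: algebra_simps)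
      then show ?thesis using Q'(2)[of h] by (simp add: S0 algebra_simps del: times_complex.simps)
    qed
    show "Im (Q 0 * cnj (VB 0 10)) = 0" unfolding Z0 by (rule Im_complex_of_real)
    show "2 * (\<alpha> - l * \<gamma>) + \<bar>Re (Q 0 * cnj (VB 0 10)) - C\<bar> < 0"
      using a unfolding Z0 Re_complex_of_real .
  qed (fact b)
qed

lemma degenerate_tips_0:
  "TB 0 3 1 = complex_of_real (1 / (4 * (1 - a\<^sup>2))) * S0"
  "TB 0 7 (2 * n - 3) = complex_of_real (1 - 1 / (4 * (1 - a\<^sup>2))) * S0"
proof -
  have c: "c \<noteq> 0" and cc: "1 - a\<^sup>2 = c\<^sup>2" using trig_bounds by auto
  have m: "cis (2 * x) = Complex (1 - 2 * a\<^sup>2) (2 * a * c)" "cis (- (2 * x)) = Complex (1 - 2 * a\<^sup>2) (- (2 * a * c))"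
    "cis (3 * x) = Complex (c * (1 - 4 * a\<^sup>2)) (a * (3 - 4 * a\<^sup>2))" "cis (- x) = Complex c (- a)"
    using multiple_angles by (simp_all add: complex_eq_iff)
  have S: "complex_of_real (1 / (4 * c\<^sup>2)) * S0 = Complex (5 / 2) (a / (2 * c))"
    using c by (simp add: S0_def complex_eq_iff power2_eq_square)
  have "TB 0 3 1 = 2 + cis (2 * x) - (1 / (2 * c)) *\<^sub>R cis (3 * x)"
    unfolding degenerate_spokes_B by (simp add: vertex_B heading_B short_radius)
  also have "\<dots> = Complex (5 / 2) (a / (2 * c))"
  proof -
    have "2 * a * c - a * (3 - 4 * a\<^sup>2) / (2 * c) = a / (2 * c)"
    proof -
      have "(2 * a * c) * (2 * c) = a * (3 - 4 * a\<^sup>2) + a" using cc by algebra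
      then have "2 * a * c = (a * (3 - 4 * a\<^sup>2) + a) / (2 * c)" using c by (simp add: eq_divide_eq)
      then show ?thesis by (simp add: add_divide_distrib)
    qed
    then show ?thesis using c unfolding m by (simp add: complex_eq_iff field_simps)
  qed
  finally show "TB 0 3 1 = complex_of_real (1 / (4 * (1 - a\<^sup>2))) * S0" unfolding cc S .
  have "TB 0 7 (2 * n - 3) = 2 + 3 * cis (2 * x) + 2 * cis (- (2 * x)) + (1 / (2 * c)) *\<^sub>R cis (- x)"
    unfolding degenerate_spokes_B by (simp add: vertex_B heading_B short_radius)
  also have "\<dots> = S0 - Complex (5 / 2) (a / (2 * c))"
  proof -
    have "S0 = Complex (10 * c\<^sup>2) (2 * a * c)" by (simp add: S0_def complex_eq_iff power2_eq_square)
    then show ?thesis using c unfolding m cc[symmetric] by (simp add: complex_eq_iff field_simps)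
  qed
  also have "\<dots> = complex_of_real (1 - 1 / (4 * c\<^sup>2)) * S0" unfolding S[symmetric] by (simp add: left_diff_distrib)
  finally show "TB 0 7 (2 * n - 3) = complex_of_real (1 - 1 / (4 * (1 - a\<^sup>2))) * S0" unfolding cc .
qed

lemma degenerate_tips_climb:
  "climbs (\<lambda>E. TB E 3 1) (5 - 4 * a\<^sup>2 - 3 * \<mu>) (15 - 14 * a\<^sup>2 - 2 * \<mu>)"
  "climbs (\<lambda>E. TB E 7 (2 * n - 3))
    (2 * (1 - a\<^sup>2) * ((3 - 8 * \<mu>) * (10 - 20 * a\<^sup>2) + (3 - 10 * \<mu>) * (5 - 8 * a\<^sup>2)) + 3 * \<mu> + (3 - 10 * \<mu>) * (5 - 6 * a\<^sup>2))
    (2 * (1 - a\<^sup>2) * (10 - 8 * a\<^sup>2 + (12 * \<mu> - 1) * (10 - 20 * a\<^sup>2)) - 3 * \<mu> * (1 - 2 * a\<^sup>2) + (11 * \<mu> - 2) * (5 - 6 * a\<^sup>2))"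
proof -
  have nz: "a \<noteq> 0" "c \<noteq> 0" and cc: "c\<^sup>2 = 1 - a\<^sup>2" using trig_bounds by auto
  have I: "Im (cis (3 * x) * cnj S0) = 4 * a * c\<^sup>2 * (7 - 8 * a\<^sup>2)" "Im (cis (- x) * cnj S0) = 4 * a * c\<^sup>2 * (- 3)"
    using unit_heights(5,6) nz by (auto simp: short_height_def field_simps power2_eq_square)
  have C: "1 / (2 * c) * u * Re (cis (3 * x) * cnj S0) = u * (5 - 22 * a\<^sup>2 + 16 * a ^ 4)"
    "1 / (2 * c) * u * Re (cis (- x) * cnj S0) = u * (5 - 6 * a\<^sup>2)" for u
    unfolding progress_values(4,5)[symmetric] by simp_all
  have R: "- \<mu> / (4 * a * c\<^sup>2) * (4 * a * c\<^sup>2 * z) = - \<mu> * z"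
    "\<mu> * (1 - 2 * a\<^sup>2) / (4 * a * c\<^sup>2) * (4 * a * c\<^sup>2 * z) = \<mu> * (1 - 2 * a\<^sup>2) * z" for z
    using nz by simp_all
  have a4: "a ^ 4 = a\<^sup>2 * a\<^sup>2" by (simp add: power2_eq_square power4_eq_xxxx)
  note sp = climbs_spoke[OF short_radius(2), unfolded short_radius(1)]
  have one: "climbs (\<lambda>E. short_radius E *\<^sub>R cis (3 * x + (1 - 2 * \<mu>) * fst E + (1 - \<mu>) * snd E))
      (- \<mu> * (7 - 8 * a\<^sup>2) + (1 - 2 * \<mu>) * (5 - 22 * a\<^sup>2 + 16 * a ^ 4))
      (\<mu> * (1 - 2 * a\<^sup>2) * (7 - 8 * a\<^sup>2) + (1 - \<mu>) * (5 - 22 * a\<^sup>2 + 16 * a ^ 4))"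
    using sp[of "3 * x" "1 - 2 * \<mu>" "1 - \<mu>"] unfolding I C R .
  have two: "climbs (\<lambda>E. short_radius E *\<^sub>R cis (- x + (3 - 10 * \<mu>) * fst E + (11 * \<mu> - 2) * snd E))
      (- \<mu> * (- 3) + (3 - 10 * \<mu>) * (5 - 6 * a\<^sup>2))
      (\<mu> * (1 - 2 * a\<^sup>2) * (- 3) + (11 * \<mu> - 2) * (5 - 6 * a\<^sup>2))"
    using sp[of "- x" "3 - 10 * \<mu>" "11 * \<mu> - 2"] unfolding I C R .
  show "climbs (\<lambda>E. TB E 3 1) (5 - 4 * a\<^sup>2 - 3 * \<mu>) (15 - 14 * a\<^sup>2 - 2 * \<mu>)"
    using climbs_diff[OF climbs_vertices(1) one] unfolding degenerate_spokes_B a4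
    by (simp add: algebra_simps)
  show "climbs (\<lambda>E. TB E 7 (2 * n - 3))
    (2 * (1 - a\<^sup>2) * ((3 - 8 * \<mu>) * (10 - 20 * a\<^sup>2) + (3 - 10 * \<mu>) * (5 - 8 * a\<^sup>2)) + 3 * \<mu> + (3 - 10 * \<mu>) * (5 - 6 * a\<^sup>2))
    (2 * (1 - a\<^sup>2) * (10 - 8 * a\<^sup>2 + (12 * \<mu> - 1) * (10 - 20 * a\<^sup>2)) - 3 * \<mu> * (1 - 2 * a\<^sup>2) + (11 * \<mu> - 2) * (5 - 6 * a\<^sup>2))"
    using climbs_add[OF climbs_vertices(2) two] unfolding degenerate_spokes_B
    by (simp add: algebra_simps)
qed

text \<open>
  The sign conditions on the gradients, with \<open>s = a\<^sup>2\<close>. The constant \<open>C = 7 / 3 * (25 - 24 * s)\<close>, which fixes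
  the position of the path in its strip, is a compromise between the two points on the path: for \<open>n = 4\<close>
  the factor \<open>7 / 3\<close> could only be replaced by numbers between about 2.26 and 2.35.
\<close>

lemma gradient_bounds:
  assumes s: "0 \<le> s" "s \<le> 4 / 25" "9 * \<mu>\<^sup>2 \<le> s"
  shows "2 * (137 * \<mu> - 120 * \<mu> * s + 38 * s - 35) + 4 / 3 * (25 - 24 * s) < 0"
    and "2 * (113 * \<mu> - 120 * \<mu> * s + 10 * s - 15) + (25 - 24 * s) * (2 / 3 - 4 * s) < 0"
    and "2 * (113 * \<mu> - 120 * \<mu> * s + 10 * s - 15) - (25 - 24 * s) * (2 / 3 - 4 * s) < 0"
    and "65 / 2 - 20 * s - 137 * \<mu> + 120 * \<mu> * s > 0"
    and "85 / 2 - 52 * s - 113 * \<mu> + 120 * \<mu> * s > 0"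
proof -
  have m: "0 < \<mu>" "\<mu> \<le> 1 / 8" using x_bounds by auto
  have lin: "\<mu> * (k - 120 * s) \<le> 1 / 8 * (k - 120 * s)" if "k \<ge> 113" for k
    using that m s by (intro mult_right_mono) auto
  have l137: "137 * \<mu> - 120 * \<mu> * s \<le> 137 / 8 - 15 * s" using lin[of 137] by (simp add: algebra_simps)
  have l113: "113 * \<mu> - 120 * \<mu> * s \<le> 113 / 8 - 15 * s" using lin[of 113] by (simp add: algebra_simps)
  have ss: "0 \<le> s\<^sup>2" by simp
  show "2 * (137 * \<mu> - 120 * \<mu> * s + 38 * s - 35) + 4 / 3 * (25 - 24 * s) < 0"
    using l137 s(2) by (simp add: algebra_simps)
  show "65 / 2 - 20 * s - 137 * \<mu> + 120 * \<mu> * s > 0" using l137 s(2) by linarith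
  show "85 / 2 - 52 * s - 113 * \<mu> + 120 * \<mu> * s > 0" using l113 s(2) by linarith
  have eq: "2 * (113 * \<mu> - 120 * \<mu> * s + 10 * s - 15) - (25 - 24 * s) * (2 / 3 - 4 * s) =
      2 * (113 * \<mu> - 120 * \<mu> * s) + 136 * s - 140 / 3 - 96 * s\<^sup>2"
    by (simp add: algebra_simps power2_eq_square)
  show "2 * (113 * \<mu> - 120 * \<mu> * s + 10 * s - 15) - (25 - 24 * s) * (2 / 3 - 4 * s) < 0"
  proof -
    define X where "X = 113 * \<mu> - 120 * \<mu> * s"
    have "X \<le> 113 / 8 - 15 * s" using l113 by (simp only: X_def)
    then have "2 * X + 136 * s - 140 / 3 - 96 * s\<^sup>2 < 0" using s(2) ss by linarith
    then show ?thesis unfolding eq by (simp only: X_def)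
  qed
  \<comment> \<open>This bound would fail for \<open>s = 0\<close> and \<open>\<mu> = 1 / 8\<close>; it depends on \<open>9 * \<mu>\<^sup>2 \<le> s\<close>, and
    the quantity \<open>q\<close> increases with \<open>s\<close>.\<close>
  define q where "q = 20 / 3 + 48 * s - 48 * s\<^sup>2 - 113 * \<mu> + 120 * \<mu> * s"
  have "q > 0"
  proof -
    define t where "t = 9 * \<mu>\<^sup>2"
    have t: "0 \<le> t" "t \<le> s" using s by (auto simp: t_def)
    have "(s - t) * (48 - 48 * (s + t) + 120 * \<mu>) \<ge> 0" using t s m by (intro mult_nonneg_nonneg) auto
    then have "20 / 3 + 48 * t - 48 * t\<^sup>2 - 113 * \<mu> + 120 * \<mu> * t \<le> q"
      by (simp add: q_def algebra_simps power2_eq_square)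
    moreover have "48 * t\<^sup>2 = 3888 * \<mu> * \<mu> ^ 3" "120 * \<mu> * t = 1080 * \<mu> ^ 3" "48 * t = 432 * \<mu>\<^sup>2"
      by (simp_all add: t_def power2_eq_square power3_eq_cube)
    ultimately have *: "20 / 3 + 432 * \<mu>\<^sup>2 - 3888 * \<mu> * \<mu> ^ 3 - 113 * \<mu> + 1080 * \<mu> ^ 3 \<le> q" by simp
    define y z where "y = \<mu>\<^sup>2" and "z = \<mu> ^ 3"
    have "3888 * \<mu> * z \<le> 486 * z" using m by (intro mult_right_mono) (auto simp: z_def)
    with * have "20 / 3 + 432 * y - 113 * \<mu> + 594 * z \<le> q" by (simp add: y_def z_def)
    \<comment> \<open>Tangents at \<open>\<mu> = 11 / 100\<close> and at \<open>\<mu> = 106 / 1000\<close>, near the minimum of the cubic.\<close>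
    moreover have "z \<ge> 363 / 10000 * \<mu> - 2662 / 1000000"
    proof -
      have "z - 363 / 10000 * \<mu> + 2662 / 1000000 = (\<mu> - 11 / 100)\<^sup>2 * (\<mu> + 22 / 100)"
        by (simp add: z_def power2_eq_square power3_eq_cube field_simps)
      also have "\<dots> \<ge> 0" using m by simp
      finally show ?thesis by simp
    qed
    moreover have "y \<ge> 212 / 1000 * \<mu> - 11236 / 1000000"
    proof -
      have "(\<mu> - 106 / 1000)\<^sup>2 = y - 212 / 1000 * \<mu> + 11236 / 1000000"
        by (simp add: y_def power2_eq_square field_simps)
      moreover have "(\<mu> - 106 / 1000)\<^sup>2 \<ge> 0" by simp
      ultimately show ?thesis by linarith
    qed
    ultimately show ?thesis using m by linarith
  qed
  then show "2 * (113 * \<mu> - 120 * \<mu> * s + 10 * s - 15) + (25 - 24 * s) * (2 / 3 - 4 * s) < 0"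
    by (simp add: q_def algebra_simps power2_eq_square)
qed

lemma norm_S0: "norm S0 ^ 2 = 4 * (1 - a\<^sup>2) * (25 - 24 * a\<^sup>2)"
proof -
  have "norm S0 ^ 2 = 4 * c\<^sup>2 * (25 * c\<^sup>2 + a\<^sup>2)"
    unfolding cmod_power2 by (simp add: S0_def power2_eq_square algebra_simps)
  then show ?thesis using trig_bounds(4) by algebra
qed

lemma degenerate_tip_germs:
  defines "C \<equiv> 7 / 3 * (25 - 24 * a\<^sup>2)"
  shows "\<forall>\<^sub>F E in nhds 0. 0 < fst E \<and> snd E \<le> 0 \<longrightarrow>
      -1 * Im (TB E 3 1 * cnj (VB E 10)) * cos (fst E / 2) - \<bar>Re (TB E 3 1 * cnj (VB E 10)) - C\<bar> * sin (fst E / 2) > 0"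
    and "\<forall>\<^sub>F E in nhds 0. 0 < fst E \<and> snd E \<le> 0 \<longrightarrow>
      -1 * Im (TB E 7 (2 * n - 3) * cnj (VB E 10)) * cos (fst E / 2) -
      \<bar>Re (TB E 7 (2 * n - 3) * cnj (VB E 10)) - C\<bar> * sin (fst E / 2) > 0"
proof -
  define s where "s = a\<^sup>2"
  have s: "0 \<le> s" "s \<le> 4 / 25" "9 * \<mu>\<^sup>2 \<le> s" using trig_bounds by (auto simp: s_def)
  note g = gradient_bounds[OF s]
  define K where "K = (3 - 8 * \<mu>) * (10 - 20 * s) + (3 - 10 * \<mu>) * (5 - 8 * s) + (7 - 30 * \<mu>) * 5"
  define L where "L = 10 - 8 * s + (12 * \<mu> - 1) * (10 - 20 * s) + (30 * \<mu> - 7) * 5"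
  have V: "climbs (\<lambda>E. VB E 10) (2 * (1 - s) * K) (2 * (1 - s) * L)"
    using climbs_vertices(3) unfolding s_def[symmetric] K_def L_def by (simp add: algebra_simps)
  have "1 - s \<noteq> 0" using s by simp
  then have half: "1 / (4 * (1 - s)) * (2 * (1 - s) * z) = z / 2" for z by (simp add: divide_simps)
  have nrm: "1 / (4 * (1 - s)) * norm S0 ^ 2 = 25 - 24 * s"
    unfolding norm_S0 s_def[symmetric] using \<open>1 - s \<noteq> 0\<close> by simp
  have C: "C = 7 / 3 * (25 - 24 * s)" by (simp add: C_def s_def)
  have p25: "25 - 24 * s > 0" using s by simp
  show "\<forall>\<^sub>F E in nhds 0. 0 < fst E \<and> snd E \<le> 0 \<longrightarrow>
      -1 * Im (TB E 3 1 * cnj (VB E 10)) * cos (fst E / 2) - \<bar>Re (TB E 3 1 * cnj (VB E 10)) - C\<bar> * sin (fst E / 2) > 0"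
  proof (rule degenerate_tip[OF degenerate_tips_climb(1) degenerate_tips_0(1) V[unfolded s_def]]; fold s_def)
    have "15 - 14 * s - 2 * \<mu> - L / 2 = 65 / 2 - 20 * s - 137 * \<mu> + 120 * \<mu> * s"
      by (simp add: L_def field_simps)
    then show "15 - 14 * s - 2 * \<mu> - 1 / (4 * (1 - s)) * (2 * (1 - s) * L) > 0" unfolding half using g(4) by simp
    have e1: "5 - 4 * s - 3 * \<mu> - K / 2 = 137 * \<mu> - 120 * \<mu> * s + 38 * s - 35" by (simp add: K_def field_simps)
    have "25 - 24 * s - C = - (4 / 3 * (25 - 24 * s))" by (simp add: C field_simps)
    then have e2: "\<bar>25 - 24 * s - C\<bar> = 4 / 3 * (25 - 24 * s)" using p25 by (simp only: abs_minus) simp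
    show "2 * (5 - 4 * s - 3 * \<mu> - 1 / (4 * (1 - s)) * (2 * (1 - s) * K)) + \<bar>1 / (4 * (1 - s)) * norm S0 ^ 2 - C\<bar> < 0"
      unfolding half nrm e1 e2 by (rule g(1))
  qed
  show "\<forall>\<^sub>F E in nhds 0. 0 < fst E \<and> snd E \<le> 0 \<longrightarrow>
      -1 * Im (TB E 7 (2 * n - 3) * cnj (VB E 10)) * cos (fst E / 2) -
      \<bar>Re (TB E 7 (2 * n - 3) * cnj (VB E 10)) - C\<bar> * sin (fst E / 2) > 0"
  proof (rule degenerate_tip[OF degenerate_tips_climb(2) degenerate_tips_0(2) V[unfolded s_def]]; fold s_def)
    have half': "(1 - 1 / (4 * (1 - s))) * (2 * (1 - s) * z) = 2 * (1 - s) * z - z / 2" for z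
      unfolding left_diff_distrib half by simp
    have nrm': "(1 - 1 / (4 * (1 - s))) * norm S0 ^ 2 = (25 - 24 * s) * (3 - 4 * s)"
      unfolding left_diff_distrib nrm unfolding norm_S0 s_def[symmetric] by (simp add: algebra_simps)
    have "2 * (1 - s) * (10 - 8 * s + (12 * \<mu> - 1) * (10 - 20 * s)) - 3 * \<mu> * (1 - 2 * s) + (11 * \<mu> - 2) * (5 - 6 * s)
        - (2 * (1 - s) * L - L / 2) = 85 / 2 - 52 * s - 113 * \<mu> + 120 * \<mu> * s"
      by (simp add: L_def field_simps)
    then show "2 * (1 - s) * (10 - 8 * s + (12 * \<mu> - 1) * (10 - 20 * s)) - 3 * \<mu> * (1 - 2 * s) + (11 * \<mu> - 2) * (5 - 6 * s)
        - (1 - 1 / (4 * (1 - s))) * (2 * (1 - s) * L) > 0"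
      unfolding half' using g(5) by linarith
    have A: "2 * (1 - s) * ((3 - 8 * \<mu>) * (10 - 20 * s) + (3 - 10 * \<mu>) * (5 - 8 * s)) + 3 * \<mu> + (3 - 10 * \<mu>) * (5 - 6 * s)
        - (2 * (1 - s) * K - K / 2) = 113 * \<mu> - 120 * \<mu> * s + 10 * s - 15"
      by (simp add: K_def field_simps)
    have "(25 - 24 * s) * (3 - 4 * s) - C = (25 - 24 * s) * (2 / 3 - 4 * s)" by (simp add: C algebra_simps)
    then have "2 * (113 * \<mu> - 120 * \<mu> * s + 10 * s - 15) + \<bar>(25 - 24 * s) * (3 - 4 * s) - C\<bar> < 0"
      using g(2,3) by linarith
    then show "2 * (2 * (1 - s) * ((3 - 8 * \<mu>) * (10 - 20 * s) + (3 - 10 * \<mu>) * (5 - 8 * s)) + 3 * \<mu> + (3 - 10 * \<mu>) * (5 - 6 * s)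
        - (1 - 1 / (4 * (1 - s))) * (2 * (1 - s) * K)) + \<bar>(1 - 1 / (4 * (1 - s))) * norm S0 ^ 2 - C\<bar> < 0"
      unfolding half' nrm' A .
  qed
qed

text \<open>
  In the full fans the end spokes make the angle \<open>x\<close> with the real axis, on either side of the fan.
\<close>

lemma fan_B:
  assumes j: "1 \<le> j" "j < 2 * n"
  shows "Im (cis (j * (pi / (2 * n))) * cnj (VB 0 10)) > 0"
proof -
  have ac: "0 < a * c" "0 < c" using trig_bounds by auto
  have nx: "2 * n * x = pi" using n by (simp add: x_def)
  have lo: "Im (cnj S0 * cis x) = 4 * c * (2 * a * c)"
    using unit_heights(4) ac by (simp add: short_height_def field_simps)
  have "cis (pi - x) = - cis (- x)" by (simp add: complex_eq_iff)
  then have hi: "Im (cnj S0 * cis (pi - x)) = 6 * c * (2 * a * c)"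
    using unit_heights(5) ac by (simp add: short_height_def field_simps)
  have pos: "0 < 4 * c * (2 * a * c)" using ac by simp
  consider "j = 1" | "j = 2 * n - 1" | "1 < j" "j < 2 * n - 1" using j by linarith
  then have "Im (cnj S0 * cis (j * x)) > 0"
  proof cases
    case 1
    then show ?thesis using lo pos by simp
  next
    case 2
    then have "j * x = pi - x" using nx n by (simp add: of_nat_diff algebra_simps)
    then show ?thesis using hi pos by simp
  next
    case 3
    have "real 1 * x < real j * x" using 3 x_bounds(1) by (intro mult_strict_right_mono) auto
    moreover have "real j * x < real (2 * n - 1) * x" using 3 x_bounds(1) by (intro mult_strict_right_mono) (auto simp del: of_nat_diff)
    moreover have "real (2 * n - 1) * x = pi - x" using nx n by (simp add: of_nat_diff algebra_simps)
    ultimately have "x < j * x" "j * x < pi - x" by (simp_all only: of_nat_1 mult_1)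
    moreover have "4 * c * (2 * a * c) \<le> 6 * c * (2 * a * c)" using pos by simp
    ultimately have "4 * c * (2 * a * c) < Im (cnj S0 * cis (j * x))"
      using pos lo hi x_bounds(1) by (intro sine_on_arc[of x _ "pi - x"]) linarith+
    then show ?thesis using pos by linarith
  qed
  moreover have "real j * (pi / real (2 * n)) = j * x" by (simp add: x_def)
  ultimately show ?thesis unfolding S0 by (simp only: mult.commute[of _ "cnj S0"])
qed

text \<open>
  The conditions that are strict at \<open>V\<^sub>n\<close> follow by continuity, and the three spokes that end on the path are
  covered by \<open>degenerate_tip_germs\<close>. The label \<open>A\<close> may be 1 or 2, which yields the words B and C.
\<close>

lemma word_B_germ:
  assumes A: "A \<in> {1, 2}"
  shows "\<forall>\<^sub>F E in nhds 0. 0 < fst E \<and> snd E \<le> 0 \<longrightarrow>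
    offset_point A n E \<in> orbit_tile (doubled_word A (2 * n) 10 sB kB)"
proof -
  define C where "C = 7 / 3 * (25 - 24 * a\<^sup>2)"
  have n3: "n \<ge> 3" using n by simp
  let ?R = "\<lambda>E :: real \<times> real. 0 < fst E \<and> snd E \<le> 0"
  let ?spoke = "\<lambda>E i j. sB i * Im (TB E i j * cnj (VB E 10)) * cos (fst E / 2) -
      \<bar>Re (TB E i j * cnj (VB E 10)) - C\<bar> * sin (fst E / 2) > 0"
  note germs = degenerate_tip_germs[folded C_def]
  have s: "0 \<le> a\<^sup>2" "a\<^sup>2 \<le> 4 / 25" using trig_bounds by auto
  have neg: "sB 3 = -1" "sB 7 = -1" "sB 8 = -1" by (simp_all add: sB_def)
  have tip8: "\<forall>\<^sub>F E in nhds 0. ?R E \<longrightarrow> ?spoke E 8 1"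
  proof -
    have "\<forall>\<^sub>F E in nhds 0. sin (pi - alpha n E 0 - alpha n E 1) > 0"
      using sin_sum_alpha_0[OF n3] isCont_alpha[OF n3]
      by (intro eventually_pos_nhds) (auto intro!: continuous_intros)
    then show ?thesis using germs(2)
    proof eventually_elim
      case (elim E)
      then show ?case using degenerate_spokes_B(3)[of E] by (simp add: neg del: times_complex.simps)
    qed
  qed
  show ?thesis
  proof (rule doubled_word_germ[OF n3 A, where R = ?R and c = C])
    show "C < norm (VB 0 10) ^ 2"
    proof -
      have "(7 / 3) * (25 - 24 * a\<^sup>2) < (4 * (1 - a\<^sup>2)) * (25 - 24 * a\<^sup>2)"
        using s by (intro mult_strict_right_mono) auto
      then show ?thesis by (simp add: S0 norm_S0 C_def)
    qed
    show "0 < C" using s by (simp add: C_def)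
    show "sB i = 1 \<or> sB i = -1" if "1 \<le> i" "i < 10" for i by (rule sB_kB_bounds(1)[OF that])
    show "even (kB i) \<and> kB i + 2 \<le> 2 * n" if "1 \<le> i" "i < 10" for i
      using sB_kB_bounds(2,3)[OF that] n by simp
    show "Im (cis (j * (pi / (2 * n))) * cnj (VB 0 10)) > 0" if "1 \<le> j" "j < 2 * n" for j
      by (rule fan_B[OF that])
    show "cis (HB 0 10) = 1" by (simp add: heading_B)
    show "\<forall>\<^sub>F E in nhds 0. ?R E \<longrightarrow> sB i * Im (VB E i * cnj (VB E 10)) * cos (fst E / 2) +
        \<bar>Re (VB E i * cnj (VB E 10)) - C\<bar> * sin (fst E / 2) < 0" if "1 \<le> i" "i < 10" for i
      using strict_pivot_germ[OF n3, of sB i kB 10 C] strict_heights_B(1)[OF that, folded S0]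
      by (auto elim: eventually_mono simp del: times_complex.simps)
    show "\<forall>\<^sub>F E in nhds 0. ?R E \<longrightarrow> ?spoke E i j" if ij: "1 \<le> i" "i < 10" "1 \<le> j" "j < 2 * n - kB i" for i j
    proof -
      note h = strict_heights_B[OF ij(1,2), folded S0] and sk = sB_kB_bounds[OF ij(1,2)]
      consider "i = 3" "j = 1" | "i = 7" "j = 2 * n - kB i - 1" | "i = 8" "j = 1"
        | "sB i * Im (TB 0 i j * cnj (VB 0 10)) > 0"
      proof -
        have "1 < j \<and> j < 2 * n - kB i - 1 \<or> j = 1 \<or> j = 2 * n - kB i - 1" using ij(3,4) by linarith
        then show thesis
        proof (elim disjE conjE)
          assume "1 < j" "j < 2 * n - kB i - 1"
          moreover have "even (2 * n - kB i)" using sk(2) by simp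
          ultimately show thesis
            using that(4) inner_spokes[where s = sB and i = i and k = kB and S = "VB 0 10", OF n3 sk(1) _ _ _ _ h(1,2,4)]
            by simp
        next
          assume "j = 1"
          then show thesis using that(1,3,4) h(3) by auto
        next
          assume "j = 2 * n - kB i - 1"
          then show thesis using that(2,4) h(5) by auto
        qed
      qed
      then show ?thesis
      proof cases
        case 1
        then show ?thesis using germs(1) by (simp add: neg del: times_complex.simps)
      next
        case 2
        moreover have "2 * n - kB 7 - 1 = 2 * n - 3" by (simp add: kB_def)
        ultimately show ?thesis using germs(2) by (simp add: neg del: times_complex.simps)
      next
        case 3
        then show ?thesis using tip8 by simp
      next
        case 4
        from strict_spoke_germ[OF n3, of sB, OF this, of C] show ?thesis
          by (auto elim: eventually_mono simp del: times_complex.simps)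
      qed
    qed
  qed auto
qed

end

section \<open>The three tiles near \<open>V\<^sub>n\<close>\<close>

lemma is_word_doubled_word:
  assumes "A \<in> {1, 2}" "N \<ge> 2" "m > 0"
  shows "is_word (doubled_word A N m s k)"
proof -
  have "3 - lab A i \<in> {1, 2}" for i using assms(1) by (auto simp: lab_def)
  then have "set (fan_word A i t M) \<subseteq> {1, 2, 3}" for i t M by (auto simp: fan_word_def)
  moreover have "fan_word A 0 (first_spoke m s 0) (mirror_fan N m k 0) \<noteq> []"
    using assms(2) by (simp add: fan_word_def first_spoke_def mirror_fan_def)
  ultimately show ?thesis
    using assms(3) by (fastforce simp: is_word_def doubled_word_def)
qed

lemma offset_point_V:
  assumes "n > 0"
  shows "offset_point 1 n (- 2 * real n * fst p, - 2 * real n * snd p) = V n + p"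
    and "offset_point 2 n (- 2 * real n * snd p, - 2 * real n * fst p) = V n + p"
  using assms by (simp_all add: offset_point_def alpha_def defect_def V_def prod_eq_iff field_simps)

text \<open>
  A point on the boundary of the quadrant is a limit of points moved slightly along the diagonal.
\<close>

lemma nonneg_in_closure_quadrant:
  assumes p: "p \<in> ball 0 \<epsilon>" "fst p \<ge> 0" "snd p \<ge> 0"
  shows "V n + p \<in> closure (N_quadrant 1 1 n \<epsilon>)"
  unfolding closure_approachable
proof (intro allI impI)
  fix e :: real assume e: "e > 0"
  define r where "r = min e (\<epsilon> - norm p)"
  have r: "r > 0" using e p(1) by (simp add: r_def)
  define q where "q = (r / 4, r / 4)"
  have "norm q \<le> r / 4 + r / 4" using norm_Pair_le[of "r / 4" "r / 4"] r by (simp add: q_def)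
  then have q: "norm q < r" using r by linarith
  have "norm (p + q) < \<epsilon>" using norm_triangle_ineq[of p q] q by (simp add: r_def)
  moreover have "sgn (fst (p + q)) = 1" "sgn (snd (p + q)) = 1"
    using p r by (auto simp: q_def sgn_if)
  ultimately have "p + q \<in> B_quadrant 1 1 \<epsilon>" by (simp add: B_quadrant_def)
  then have "V n + (p + q) \<in> N_quadrant 1 1 n \<epsilon>" by (simp add: N_quadrant_def)
  moreover have "dist (V n + (p + q)) (V n + p) < e"
    using q by (simp add: dist_norm r_def)
  ultimately show "\<exists>y\<in>N_quadrant 1 1 n \<epsilon>. dist y (V n + p) < e" by blast
qed

theorem theorem1p3:
  fixes n :: nat
  assumes "n \<ge> 4"
  shows "\<exists>(A :: nat list) (B :: nat list) (C :: nat list) (\<epsilon> :: real).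
           is_word A \<and> is_word B \<and> is_word C \<and> \<epsilon> > 0 \<and>
           N_quadrant (-1) (-1) n \<epsilon> \<subseteq> orbit_tile A \<and>
           N_quadrant (-1) 1 n \<epsilon> \<subseteq> orbit_tile B \<and>
           N_quadrant 1 (-1) n \<epsilon> \<subseteq> orbit_tile C \<and>
           N_ball n \<epsilon> - closure (N_quadrant 1 1 n \<epsilon>)
             \<subseteq> orbit_tile A \<union> orbit_tile B \<union> orbit_tile C"
proof -
  let ?A = "doubled_word 1 (2 * n) 2 (\<lambda>_. -1) (\<lambda>_. 0)"
    and ?B = "doubled_word 1 (2 * n) 10 sB kB" and ?C = "doubled_word 2 (2 * n) 10 sB kB"
  have "\<forall>\<^sub>F E in nhds 0. (0 < fst E \<and> 0 < snd E \<longrightarrow> offset_point 1 n E \<in> orbit_tile ?A) \<and>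
      (0 < fst E \<and> snd E \<le> 0 \<longrightarrow> offset_point 1 n E \<in> orbit_tile ?B) \<and>
      (0 < fst E \<and> snd E \<le> 0 \<longrightarrow> offset_point 2 n E \<in> orbit_tile ?C)"
    using word_A_germ[of n] word_B_germ[OF assms, of 1] word_B_germ[OF assms, of 2] assms
    by (intro eventually_conj) simp_all
  then obtain d where d: "d > 0" and
    tiles: "\<And>E. norm E < d \<Longrightarrow> (0 < fst E \<and> 0 < snd E \<longrightarrow> offset_point 1 n E \<in> orbit_tile ?A) \<and>
      (0 < fst E \<and> snd E \<le> 0 \<longrightarrow> offset_point 1 n E \<in> orbit_tile ?B) \<and>
      (0 < fst E \<and> snd E \<le> 0 \<longrightarrow> offset_point 2 n E \<in> orbit_tile ?C)"
    unfolding eventually_nhds_metric dist_0_norm[symmetric] dist_commute[of _ 0] by blast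
  have n: "n > 0" using assms by simp
  define \<epsilon> where "\<epsilon> = d / (2 * real n)"
  have small: "norm (- 2 * real n * fst p, - 2 * real n * snd p) < d"
    "norm (- 2 * real n * snd p, - 2 * real n * fst p) < d" if "p \<in> ball 0 \<epsilon>" for p
  proof -
    have "norm ((- 2 * real n) *\<^sub>R p) < d" using that n by (simp add: \<epsilon>_def field_simps)
    then show "norm (- 2 * real n * fst p, - 2 * real n * snd p) < d"
      by (cases p) simp
    then show "norm (- 2 * real n * snd p, - 2 * real n * fst p) < d"
      by (simp add: norm_Pair add.commute)
  qed
  have A: "V n + p \<in> orbit_tile ?A" if "p \<in> ball 0 \<epsilon>" "fst p < 0" "snd p < 0" for p
    using tiles[OF small(1)[OF that(1)]] that n offset_point_V(1)[OF n, of p] by (simp add: mult_less_0_iff)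
  have B: "V n + p \<in> orbit_tile ?B" if "p \<in> ball 0 \<epsilon>" "fst p < 0" "snd p \<ge> 0" for p
    using tiles[OF small(1)[OF that(1)]] that n offset_point_V(1)[OF n, of p] by (simp add: mult_less_0_iff)
  have C: "V n + p \<in> orbit_tile ?C" if "p \<in> ball 0 \<epsilon>" "fst p \<ge> 0" "snd p < 0" for p
    using tiles[OF small(2)[OF that(1)]] that n offset_point_V(2)[OF n, of p] by (simp add: mult_less_0_iff)
  show ?thesis
  proof (intro exI conjI subsetI)
    show "is_word ?A" "is_word ?B" "is_word ?C" using n by (auto intro!: is_word_doubled_word)
    show "\<epsilon> > 0" using d n by (simp add: \<epsilon>_def)
    show "x \<in> orbit_tile ?A" if "x \<in> N_quadrant (-1) (-1) n \<epsilon>" for x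
      using that A by (auto simp: N_quadrant_def B_quadrant_def sgn_if split: if_splits)
    show "x \<in> orbit_tile ?B" if "x \<in> N_quadrant (-1) 1 n \<epsilon>" for x
      using that B by (auto simp: N_quadrant_def B_quadrant_def sgn_if split: if_splits)
    show "x \<in> orbit_tile ?C" if "x \<in> N_quadrant 1 (-1) n \<epsilon>" for x
      using that C by (auto simp: N_quadrant_def B_quadrant_def sgn_if split: if_splits)
    show "x \<in> orbit_tile ?A \<union> orbit_tile ?B \<union> orbit_tile ?C"
      if x: "x \<in> N_ball n \<epsilon> - closure (N_quadrant 1 1 n \<epsilon>)" for x
    proof -
      obtain p where p: "x = V n + p" "p \<in> ball 0 \<epsilon>" using x unfolding N_ball_def by blast
      then have "fst p < 0 \<or> snd p < 0" using x nonneg_in_closure_quadrant[of p \<epsilon> n] by force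
      then show ?thesis using A[OF p(2)] B[OF p(2)] C[OF p(2)] p(1) by (meson UnI1 UnI2 not_le)
    qed
  qed
qed

end
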